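(* Let $\mathcal X,\mathcal Y,\mathcal Z$ be finite sets and $P_{XYZ}\in\mathcal P(\mathcal X\times\mathcal Y\times\mathcal Z)$. Consider the sequence of hypothesis testing problems with null hypothesis $(X^n,Y^n,Z^n)\sim P_{XYZ}^{\times n}$ and alternative hypothesis "$X^n\leftrightarrow Y^n\leftrightarrow Z^n$ is Markov and $(X^n,Y^n,Z^n)$ is permutation invariant", i.e. $\mathcal Q_n$ is the set of all permutation invariant $Q_{X^nY^nZ^n}\in\mathcal P((\mathcal X\times\mathcal Y\times\mathcal Z)^n)$ of the form $Q_{Y^n}\times Q_{X^n|Y^n}\times Q_{Z^n|Y^n}$. For $s>0$ let $$I_s(X\!:\!Z|Y)=\min D_s(P_{XYZ}\|Q_Y\times Q_{X|Y}\times Q_{Z|Y}),$$ where the minimum is over all $Q_Y\in\mathcal P(\mathcal Y)$ and all channels $Q_{X|Y}\in\mathcal P(\mathcal X|\mathcal Y)$, $Q_{Z|Y}\in\mathcal P(\mathcal Z|\mathcal Y)$. Let $\phi(s)=(s-1)I_s(X\!:\!Z|Y)$, $R_{2/3}=\lim_{s\searrow2/3}(s\phi'(s)-\phi(s))$ and $R_\infty=\lim_{s\to\infty}(s\phi'(s)-\phi(s))$. Then the threshold rate and the strong converse threshold rate are both equal to the conditional mutual information $I(X\!:\!Z|Y)=D(P_{XYZ}\|P_Y\times P_{X|Y}\times P_{Z|Y})$. Moreover, for every $R>R_{2/3}$ the error exponent is $$\mathrm e_R=\sup_{s\in(\frac23,1)}\frac{1-s}{s}\big(I_s(X\!:\!Z|Y)-R\big),$$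 and for every $0<R<R_\infty$ the strong converse exponent is $$\mathrm{sc}_R=\sup_{s>1}\frac{s-1}{s}\big(R-I_s(X\!:\!Z|Y)\big).$$
   Context: $\mathcal P(\cdot)$ is the set of probability mass functions on a finite set; a distribution on $\mathcal A^n$ is permutation invariant if it is invariant under all permutations of the $n$ coordinates; $\mathcal P(\mathcal Z|\mathcal Y)$ is the set of channels (conditional distributions) from $\mathcal Y$ to $\mathcal Z$; $(Q_Y\times Q_{X|Y}\times Q_{Z|Y})(x,y,z)=Q_Y(y)Q_{X|Y}(x|y)Q_{Z|Y}(z|y)$, and similarly on $n$-fold products; $P^{\times n}$ is the $n$-fold i.i.d. product. $\log$ and $\exp$ are inverse to each other, in any fixed base; $-\log0=+\infty$. For a finite set $\mathcal A$, $P\in\mathcal P(\mathcal A)$, $\mathcal Q_n\subseteq\mathcal P(\mathcal A^n)$ (here $\mathcal A=\mathcal X\times\mathcal Y\times\mathcal Z$, $P=P_{XYZ}$) and a test $T:\mathcal A^n\to[0,1]$ put $\alpha(T)=\sum_{a^n}P^{\times n}(a^n)(1-T(a^n))$, $\beta(T)=\sup_{Q\in\mathcal Q_n}\sum_{a^n}Q(a^n)T(a^n)$, and $\hat\alpha_n(\mu)=\min_T\{\alpha(T):\beta(T)\le\mu\}$. Threshold rate: $\sup\{R\in\mathbb R:\limsup_n\hat\alpha_n(\exp(-nR))=0\}$; strong converse threshold rate: $\inf\{R\in\mathbb R:\liminf_n\hat\alpha_n(\exp(-nR))=1\}$; error exponent: $\mathrm e_R=\liminf_n-\frac1n\log\hat\alpha_n(\exp(-nR))$;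 strong converse exponent: $\mathrm{sc}_R=\limsup_n-\frac1n\log(1-\hat\alpha_n(\exp(-nR)))$ (both for $R>0$). Rényi divergence: for $s\in(0,1)\cup(1,\infty)$, $D_s(P\|Q)=\frac1{s-1}\log\sum_{a:P(a)>0}P(a)^sQ(a)^{1-s}$ (equal to $+\infty$ if $s>1$ and $Q(a)=0<P(a)$ for some $a$, or if $s<1$ and the sum is $0$); $D_1(P\|Q)=D(P\|Q)=\sum_aP(a)(\log P(a)-\log Q(a))$. *)

theory Defs
  imports "HOL-Probability.Probability" "HOL-Combinatorics.Permutations"
begin

text \<open>
  Finite alphabets are types of class \<^class>\<open>finite\<close>, and elements of the \<open>n\<close>-fold product
  of \<open>'a\<close> are lists of length \<open>n\<close>. A channel from \<open>'y\<close> to \<open>'z\<close> is a function \<open>'y \<Rightarrow> 'z pmf\<close>.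
  The parameter \<open>b\<close> is the base of \<open>log\<close> and \<open>exp\<close>, so that \<open>exp x\<close> is \<open>b powr x\<close>.
\<close>

definition words :: "nat \<Rightarrow> 'a list set" where
  "words n = {w. length w = n}"

lemma finite_words [simp]: "finite (words n :: 'a::finite list set)"
  using finite_lists_length_eq[of "UNIV :: 'a set" n] by (simp add: words_def)


subsection \<open>Hypothesis testing with a composite alternative\<close>

text \<open>Only the values of a test on \<open>words n\<close> matter.\<close>

definition is_test :: "nat \<Rightarrow> ('a list \<Rightarrow> real) \<Rightarrow> bool" where
  "is_test n T \<longleftrightarrow> (\<forall>w\<in>words n. 0 \<le> T w \<and> T w \<le> 1)"

definition type1_error :: "'a::finite pmf \<Rightarrow> nat \<Rightarrow> ('a list \<Rightarrow> real) \<Rightarrow> real" where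
  "type1_error P n T = (\<Sum>w\<in>words n. pmf (replicate_pmf n P) w * (1 - T w))"

definition type2_error :: "'a::finite list pmf set \<Rightarrow> nat \<Rightarrow> ('a list \<Rightarrow> real) \<Rightarrow> real" where
  "type2_error \<Q> n T = (SUP Q\<in>\<Q>. \<Sum>w\<in>words n. pmf Q w * T w)"

text \<open>The infimum is a minimum; see \<open>min_type1_error_attained\<close> below.\<close>

definition min_type1_error ::
    "'a::finite pmf \<Rightarrow> (nat \<Rightarrow> 'a list pmf set) \<Rightarrow> nat \<Rightarrow> real \<Rightarrow> real" where
  "min_type1_error P \<Q> n \<mu> =
     Inf (type1_error P n ` {T. is_test n T \<and> type2_error (\<Q> n) n T \<le> \<mu>})"

definition elog :: "real \<Rightarrow> real \<Rightarrow> ereal" where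
  "elog b x = (if x \<le> 0 then -\<infinity> else ereal (log b x))"

definition threshold_rate ::
    "real \<Rightarrow> 'a::finite pmf \<Rightarrow> (nat \<Rightarrow> 'a list pmf set) \<Rightarrow> ereal" where
  "threshold_rate b P \<Q> =
     Sup (ereal ` {R. limsup (\<lambda>n. ereal (min_type1_error P \<Q> n (b powr (- real n * R)))) = 0})"

definition strong_converse_threshold_rate ::
    "real \<Rightarrow> 'a::finite pmf \<Rightarrow> (nat \<Rightarrow> 'a list pmf set) \<Rightarrow> ereal" where
  "strong_converse_threshold_rate b P \<Q> =
     Inf (ereal ` {R. liminf (\<lambda>n. ereal (min_type1_error P \<Q> n (b powr (- real n * R)))) = 1})"

definition error_exponent ::
    "real \<Rightarrow> 'a::finite pmf \<Rightarrow> (nat \<Rightarrow> 'a list pmf set) \<Rightarrow> real \<Rightarrow> ereal" where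
  "error_exponent b P \<Q> R =
     liminf (\<lambda>n. - (ereal (1 / real n) *
       elog b (min_type1_error P \<Q> n (b powr (- real n * R)))))"

definition strong_converse_exponent ::
    "real \<Rightarrow> 'a::finite pmf \<Rightarrow> (nat \<Rightarrow> 'a list pmf set) \<Rightarrow> real \<Rightarrow> ereal" where
  "strong_converse_exponent b P \<Q> R =
     limsup (\<lambda>n. - (ereal (1 / real n) *
       elog b (1 - min_type1_error P \<Q> n (b powr (- real n * R)))))"


subsection \<open>Renyi divergence\<close>

definition kl_div :: "real \<Rightarrow> 'a::finite pmf \<Rightarrow> 'a pmf \<Rightarrow> ereal" where
  "kl_div b P Q =
     (if set_pmf P \<subseteq> set_pmf Q
      then ereal (\<Sum>a\<in>set_pmf P. pmf P a * (log b (pmf P a) - log b (pmf Q a)))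
      else \<infinity>)"

definition renyi_div :: "real \<Rightarrow> real \<Rightarrow> 'a::finite pmf \<Rightarrow> 'a pmf \<Rightarrow> ereal" where
  "renyi_div b s P Q =
     (let S = (\<Sum>a\<in>set_pmf P. pmf P a powr s * pmf Q a powr (1 - s)) in
      if s = 1 then kl_div b P Q
      else if s > 1 \<and> \<not> set_pmf P \<subseteq> set_pmf Q then \<infinity>
      else if s < 1 \<and> S = 0 then \<infinity>
      else ereal (1 / (s - 1) * log b S))"


subsection \<open>Markov distributions\<close>

definition markov_pmf :: "'y pmf \<Rightarrow> ('y \<Rightarrow> 'x pmf) \<Rightarrow> ('y \<Rightarrow> 'z pmf) \<Rightarrow> ('x \<times> 'y \<times> 'z) pmf" where
  "markov_pmf QY QX QZ =
     do {y \<leftarrow> QY; x \<leftarrow> QX y; z \<leftarrow> QZ y; return_pmf (x, y, z)}"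

lemma pmf_markov_pmf:
  "pmf (markov_pmf QY QX QZ) (x, y, z) = pmf QY y * pmf (QX y) x * pmf (QZ y) z"
proof -
  have "markov_pmf QY QX QZ =
      QY \<bind> (\<lambda>y. map_pmf (\<lambda>(x, z). (x, y, z)) (pair_pmf (QX y) (QZ y)))"
    by (simp add: markov_pmf_def pair_pmf_def map_bind_pmf)
  moreover have "pmf (map_pmf (\<lambda>(x, z). (x, y', z)) (pair_pmf (QX y') (QZ y'))) (x, y, z)
      = indicator {y} y' * (pmf (QX y) x * pmf (QZ y) z)" for y'
  proof (cases "y' = y")
    case True
    have "inj (\<lambda>(x, z). (x, y, z))"
      by (auto simp: inj_def)
    from pmf_map_inj'[OF this, of "pair_pmf (QX y) (QZ y)" "(x, z)"] True
    show ?thesis by (simp add: pmf_pair)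
  next
    case False
    then show ?thesis by (auto simp: pmf_eq_0_set_pmf)
  qed
  ultimately show ?thesis
    by (simp add: pmf_bind measure_pmf_single)
qed

definition permutation_invariant :: "nat \<Rightarrow> 'a list pmf \<Rightarrow> bool" where
  "permutation_invariant n Q \<longleftrightarrow>
     (\<forall>\<pi>. \<pi> permutes {..<n} \<longrightarrow> map_pmf (permute_list \<pi>) Q = Q)"

definition zip3 :: "'x list \<times> 'y list \<times> 'z list \<Rightarrow> ('x \<times> 'y \<times> 'z) list" where
  "zip3 = (\<lambda>(xs, ys, zs). zip xs (zip ys zs))"

definition markov_perm_inv :: "nat \<Rightarrow> ('x \<times> 'y \<times> 'z) list pmf set" where
  "markov_perm_inv n =
     {Q. permutation_invariant n Q \<and>
       (\<exists>QY QX QZ.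
          set_pmf QY \<subseteq> words n \<and>
          (\<forall>ys\<in>words n. set_pmf (QX ys) \<subseteq> words n \<and> set_pmf (QZ ys) \<subseteq> words n) \<and>
          Q = map_pmf zip3 (markov_pmf QY QX QZ))}"

definition renyi_cmi :: "real \<Rightarrow> real \<Rightarrow> ('x::finite \<times> 'y::finite \<times> 'z::finite) pmf \<Rightarrow> ereal" where
  "renyi_cmi b s P = (INF (QY, QX, QZ). renyi_div b s P (markov_pmf QY QX QZ))"

text \<open>
  For \<open>y\<close> outside the support of the \<open>Y\<close>-marginal the two channels below are unspecified,
  which has no influence on \<open>cmi\<close>.
\<close>

definition cmi :: "real \<Rightarrow> ('x::finite \<times> 'y::finite \<times> 'z::finite) pmf \<Rightarrow> ereal" where
  "cmi b P =
     (let cond = (\<lambda>y. cond_pmf P {a. fst (snd a) = y}) in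
      kl_div b P (markov_pmf (map_pmf (fst \<circ> snd) P)
        (\<lambda>y. map_pmf fst (cond y)) (\<lambda>y. map_pmf (snd \<circ> snd) (cond y))))"

text \<open>\<open>renyi_cmi b s P\<close> is finite for \<open>s > 0\<close>, so that the conversion to \<^typ>\<open>real\<close> loses nothing.\<close>

definition phi :: "real \<Rightarrow> ('x::finite \<times> 'y::finite \<times> 'z::finite) pmf \<Rightarrow> real \<Rightarrow> real" where
  "phi b P s = (s - 1) * real_of_ereal (renyi_cmi b s P)"

definition critical_rate ::
    "real \<Rightarrow> ('x::finite \<times> 'y::finite \<times> 'z::finite) pmf \<Rightarrow> real \<Rightarrow> ereal" where
  "critical_rate b P s = ereal (s * deriv (phi b P) s - phi b P s)"

definition R_two_thirds :: "real \<Rightarrow> ('x::finite \<times> 'y::finite \<times> 'z::finite) pmf \<Rightarrow> ereal" where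
  "R_two_thirds b P = Lim (at_right (2/3)) (critical_rate b P)"

definition R_infinity :: "real \<Rightarrow> ('x::finite \<times> 'y::finite \<times> 'z::finite) pmf \<Rightarrow> ereal" where
  "R_infinity b P = Lim at_top (critical_rate b P)"


subsection \<open>Attainment of the minimal type-I error\<close>

lemma type2_error_le_iff:
  assumes "\<Q> \<noteq> {}" and "is_test n T"
  shows "type2_error \<Q> n T \<le> \<mu> \<longleftrightarrow> (\<forall>Q\<in>\<Q>. (\<Sum>w\<in>words n. pmf Q w * T w) \<le> \<mu>)"
proof -
  have "(\<Sum>w\<in>words n. pmf Q w * T w) \<le> 1" for Q
  proof -
    have "(\<Sum>w\<in>words n. pmf Q w * T w) \<le> (\<Sum>w\<in>words n. pmf Q w)"
      using assms(2) by (intro sum_mono) (auto simp: is_test_def mult_left_le)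
    also have "\<dots> \<le> 1"
      by (simp add: measure_measure_pmf_finite[symmetric])
    finally show ?thesis .
  qed
  then have "bdd_above ((\<lambda>Q. \<Sum>w\<in>words n. pmf Q w * T w) ` \<Q>)"
    by (auto intro!: bdd_aboveI)
  then show ?thesis
    using assms(1) by (simp add: type2_error_def cSUP_le_iff)
qed

lemma min_type1_error_attained:
  assumes "\<Q> n \<noteq> {}" and "\<mu> \<ge> 0"
  shows "\<exists>T. is_test n T \<and> type2_error (\<Q> n) n T \<le> \<mu> \<and>
             type1_error P n T = min_type1_error P \<Q> n \<mu>"
proof -
  define K :: "('a list \<Rightarrow> real) set" where "K = Pi\<^sub>E UNIV (\<lambda>_. {0..1})"
  define C where "C = K \<inter> (\<Inter>Q\<in>\<Q> n. {T. (\<Sum>w\<in>words n. pmf Q w * T w) \<le> \<mu>})"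
  have "compact K"
    unfolding K_def using compactin_PiE[of "\<lambda>_. euclideanreal" UNIV "\<lambda>_::'a list. {0..1}"]
    by (simp add: euclidean_product_topology)
  moreover have "closed (\<Inter>Q\<in>\<Q> n. {T. (\<Sum>w\<in>words n. pmf Q w * T w) \<le> \<mu>})"
    by (intro closed_INT ballI closed_Collect_le continuous_intros) auto
  ultimately have "compact C"
    unfolding C_def by (rule compact_Int_closed)
  moreover have "(\<lambda>_. 0) \<in> C"
    using assms by (auto simp: C_def K_def)
  moreover have "continuous_on C (\<lambda>T. T w)" for w
    by (rule continuous_on_subset[OF continuous_on_product_coordinates]) simp
  then have "continuous_on C (type1_error P n)"
    unfolding type1_error_def by (intro continuous_on_sum continuous_intros)
  ultimately obtain T where T: "T \<in> C" "\<forall>U\<in>C. type1_error P n T \<le> type1_error P n U"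
    using continuous_attains_inf[of C "type1_error P n"] by blast
  have test: "is_test n U" if "U \<in> C" for U
    using that by (auto simp: C_def K_def is_test_def PiE_def Pi_def)
  let ?F = "{T. is_test n T \<and> type2_error (\<Q> n) n T \<le> \<mu>}"
  have TF: "T \<in> ?F"
    using T(1) test[OF T(1)] type2_error_le_iff[OF assms(1) test[OF T(1)]] by (auto simp: C_def)
  have "type1_error P n T \<le> type1_error P n U" if U: "U \<in> ?F" for U
  proof -
    define V where "V = (\<lambda>w. if w \<in> words n then U w else 0)"
    have "V \<in> C"
      using U type2_error_le_iff[OF assms(1), of n U \<mu>]
      by (auto simp: C_def K_def V_def is_test_def)
    moreover have "type1_error P n V = type1_error P n U"
      by (simp add: type1_error_def V_def)
    ultimately show ?thesis
      using T(2) by metis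
  qed
  then have "type1_error P n T = min_type1_error P \<Q> n \<mu>"
    unfolding min_type1_error_def using TF
    by (intro cInf_eq_minimum[symmetric]) auto
  with TF show ?thesis by auto
qed

lemma markov_perm_inv_nonempty: "(markov_perm_inv n :: ('x \<times> 'y \<times> 'z) list pmf set) \<noteq> {}"
proof -
  fix x :: 'x and y :: 'y and z :: 'z
  let ?Q = "map_pmf zip3 (markov_pmf (return_pmf (replicate n y))
              (\<lambda>_. return_pmf (replicate n x)) (\<lambda>_. return_pmf (replicate n z)))"
  have Q: "?Q = return_pmf (replicate n (x, y, z))"
    by (simp add: markov_pmf_def bind_return_pmf zip3_def zip_replicate)
  have "permute_list \<pi> (replicate n (x, y, z)) = replicate n (x, y, z)"
    if "\<pi> permutes {..<n}" for \<pi>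
    using permutes_in_image[OF that] by (simp add: permute_list_def list_eq_iff_nth_eq)
  then have "permutation_invariant n ?Q"
    by (simp add: permutation_invariant_def Q)
  moreover have "\<exists>QY QX QZ. set_pmf QY \<subseteq> words n \<and>
      (\<forall>ys\<in>words n. set_pmf (QX ys) \<subseteq> words n \<and> set_pmf (QZ ys) \<subseteq> words n) \<and>
      ?Q = map_pmf zip3 (markov_pmf QY QX QZ)"
    by (rule exI[of _ "return_pmf (replicate n y)"], rule exI[of _ "\<lambda>_. return_pmf (replicate n x)"],
        rule exI[of _ "\<lambda>_. return_pmf (replicate n z)"]) (simp add: words_def)
  ultimately have "?Q \<in> markov_perm_inv n"
    by (simp add: markov_perm_inv_def)
  then show ?thesis by blast
qed

end

theory Submission
  imports Defs "HOL-Real_Asymp.Real_Asymp" "HOL-Combinatorics.Multiset_Permutations"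
begin

text \<open>
  Write \<open>I(V)\<close> for the conditional mutual information of a distribution \<open>V\<close> on triples and
  \<open>D(V||P)\<close> for its relative entropy to \<open>P\<close>.
  The Gibbs variational principle gives \<open>phi(s) = max_V ((s - 1) I(V) - s D(V||P))\<close>: for
  \<open>s < 1\<close> both optimisations are maximisations, for \<open>s > 1\<close> the minimum over Markov distributions
  and the maximum over \<open>V\<close> are exchanged by a saddle point argument. For \<open>s > 1/2\<close> the functional is
  strictly concave, hence the maximiser \<open>V_s\<close> is unique and continuous in \<open>s\<close>, \<open>phi\<close> is
  differentiable, and \<open>s phi'(s) - phi(s) = I(V_s)\<close>; so every rate \<open>R\<close> strictly between the
  critical rates is attained as \<open>I(V_s)\<close>.

  Operationally, a permutation invariant Markov distribution gives a word of type \<open>V\<close> at most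
  the probability \<open>exp (- n (H(XY) + H(YZ) - H(Y)))\<close>, up to a polynomial factor. Hence the test that accepts
  if the empirical \<open>I\<close> is at least \<open>R\<close> has type-II error \<open>exp (- n R)\<close>. Changing the measure from
  \<open>P\<close> to any \<open>V\<close> with \<open>I(V) < R\<close> (resp. \<open>I(V) > R\<close>) shows that the error (resp. strong
  converse) exponent is at most \<open>D(V||P)\<close>. With \<open>I(V)\<close> close to \<open>R\<close> and \<open>V = V_s\<close> this matches the
  remaining bounds, which come from counting types and from a Renyi divergence estimate.
\<close>

subsection \<open>Entropies and the Markov projection\<close>

text \<open>Entropies and exponents use natural logarithms; the base appears only through division
  by \<open>ln b\<close> and the rate \<open>R * ln b\<close>. Distributions are mostly real
  functions, so that the simplex is a compact subset of a product space and mixtures are pointwise.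
  Since \<open>ln 0 = 0\<close>, a cross entropy is meaningful only where its second argument is
  positive: hence the positivity conditions on supports, and the restriction of \<open>V\<close> to
  distributions vanishing where \<open>P\<close> does.

  The obstacle for \<open>s > 1\<close> is that the Markov distributions are in general not convex,
  so a minimax theorem does not apply to them directly. What replaces it is that the best Markov
  distribution for a given \<open>V\<close> is explicit, namely the product of its
  \<open>Y\<close>-marginal and its two conditional laws.

  The two directions see different parts of the alternative. Bounds valid for every test compare
  \<open>P\<close> only with memoryless Markov distributions. The type-II bound has to cover all
  symmetric ones; it succeeds because such a law is fixed by its marginals on \<open>XY\<close>,
  \<open>YZ\<close> and \<open>Y\<close>, which are symmetric themselves.\<close>

lemma continuous_on_x_ln_x: "continuous_on {0..} (\<lambda>x::real. x * ln x)"
  unfolding continuous_on_def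
proof
  fix x :: real assume "x \<in> {0..}"
  show "((\<lambda>x. x * ln x) \<longlongrightarrow> x * ln x) (at x within {0..})"
  proof (cases "x = 0")
    case True
    have "((\<lambda>x::real. x * ln x) \<longlongrightarrow> 0) (at_right 0)" by real_asymp
    then show ?thesis using True by (simp add: at_within_Ici_at_right)
  next
    case False
    then have "((\<lambda>x. x * ln x) \<longlongrightarrow> x * ln x) (at x)" using \<open>x \<in> {0..}\<close>
      by (intro tendsto_intros) auto
    then show ?thesis by (rule tendsto_within_subset) auto
  qed
qed

text \<open>With \<open>U\<close> and \<open>W\<close> the two total sums,
  \<open>ln t <= t - 1\<close> gives
  \<open>u a - w a * (U / W) <= u a * (ln (u a * W) - ln (w a * U))\<close> for positive terms; on
  summation the left side vanishes. Used for the Gibbs inequality and, fibre by fibre, for data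
  processing.\<close>

lemma log_sum_inequality:
  fixes u w :: "'i \<Rightarrow> real"
  assumes "finite A" and u: "\<And>a. a \<in> A \<Longrightarrow> 0 \<le> u a" and w: "\<And>a. a \<in> A \<Longrightarrow> 0 \<le> w a"
    and ac: "\<And>a. a \<in> A \<Longrightarrow> w a = 0 \<Longrightarrow> u a = 0"
  shows "sum u A * (ln (sum u A) - ln (sum w A)) \<le> (\<Sum>a\<in>A. u a * (ln (u a) - ln (w a)))"
proof (cases "sum u A = 0")
  case True
  then have "\<forall>a\<in>A. u a = 0" using sum_nonneg_eq_0_iff[OF assms(1), of u] u by auto
  then show ?thesis using True by simp
next
  case False
  define U W where "U = sum u A" and "W = sum w A"
  have U: "U > 0" using False u by (simp add: U_def less_le sum_nonneg)
  have "\<exists>a\<in>A. u a \<noteq> 0" using False by (meson sum.neutral)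
  then obtain a0 where a0: "a0 \<in> A" "u a0 \<noteq> 0" by blast
  then have "w a0 > 0" using ac[of a0] w[of a0] by force
  moreover have "w a0 \<le> W" unfolding W_def using a0(1) w assms(1) by (intro member_le_sum) auto
  ultimately have W: "W > 0" by linarith
  have *: "u a - w a * (U / W) \<le> u a * (ln (u a) - ln (w a)) - u a * (ln U - ln W)" if a: "a \<in> A" for a
  proof (cases "u a = 0")
    case True
    then show ?thesis using w[OF a] U W by simp
  next
    case False
    then have ua: "u a > 0" using u[OF a] by simp
    then have wa: "w a > 0" using ac[OF a] w[OF a] by force
    have "ln (w a * U / (u a * W)) \<le> w a * U / (u a * W) - 1"
      using ua wa U W by (intro ln_le_minus_one) simp
    then have "ln (w a) + ln U - ln (u a) - ln W \<le> w a * U / (u a * W) - 1"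
      using ua wa U W by (simp add: ln_mult ln_div)
    then have "u a * (ln (w a) + ln U - ln (u a) - ln W) \<le> u a * (w a * U / (u a * W) - 1)"
      using ua by (intro mult_left_mono) auto
    moreover have "u a * (w a * U / (u a * W) - 1) = w a * (U / W) - u a"
      using ua W by (simp add: field_simps)
    ultimately show ?thesis by (simp add: algebra_simps)
  qed
  have "(\<Sum>a\<in>A. u a - w a * (U / W)) \<le> (\<Sum>a\<in>A. u a * (ln (u a) - ln (w a)) - u a * (ln U - ln W))"
    by (intro sum_mono *)
  moreover have "(\<Sum>a\<in>A. u a - w a * (U / W)) = 0"
    unfolding sum_subtractf sum_distrib_right[symmetric] U_def[symmetric] W_def[symmetric]
    using W by simp
  moreover have "(\<Sum>a\<in>A. u a * (ln (u a) - ln (w a)) - u a * (ln U - ln W))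
     = (\<Sum>a\<in>A. u a * (ln (u a) - ln (w a))) - U * (ln U - ln W)"
    by (simp add: sum_subtractf sum_distrib_right[symmetric] U_def[symmetric])
  ultimately show ?thesis by (simp add: U_def W_def)
qed

text \<open>\<open>w\<close> stays unnormalised: for tilted weights the right-hand side is the
  logarithm of a partition sum, for a probability vector it is \<open>0\<close>.\<close>

lemma gibbs_inequality:
  fixes u w :: "'i \<Rightarrow> real"
  assumes "finite A" and "\<And>a. a \<in> A \<Longrightarrow> 0 \<le> u a" and "\<And>a. a \<in> A \<Longrightarrow> 0 \<le> w a"
    and "\<And>a. a \<in> A \<Longrightarrow> w a = 0 \<Longrightarrow> u a = 0" and "sum u A = 1"
  shows "(\<Sum>a\<in>A. u a * (ln (w a) - ln (u a))) \<le> ln (sum w A)"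
proof -
  have "(\<Sum>a\<in>A. u a * (ln (w a) - ln (u a))) = - (\<Sum>a\<in>A. u a * (ln (u a) - ln (w a)))"
    unfolding sum_negf[symmetric] by (intro sum.cong) (auto simp: algebra_simps)
  then show ?thesis using log_sum_inequality[of A u w] assms by simp
qed


definition prob_simplex :: "('a::finite \<Rightarrow> real) set" where
  "prob_simplex = {V. (\<forall>a. 0 \<le> V a) \<and> sum V UNIV = 1}"

definition marg :: "('a::finite \<Rightarrow> 'b) \<Rightarrow> ('a \<Rightarrow> real) \<Rightarrow> 'b \<Rightarrow> real" where
  "marg g V b = (\<Sum>a | g a = b. V a)"

definition ent :: "('a::finite \<Rightarrow> real) \<Rightarrow> real" where
  "ent V = - (\<Sum>a\<in>UNIV. V a * ln (V a))"

definition pXY :: "'x \<times> 'y \<times> 'z \<Rightarrow> 'x \<times> 'y" where "pXY a = (fst a, fst (snd a))"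
definition pY :: "'x \<times> 'y \<times> 'z \<Rightarrow> 'y" where "pY a = fst (snd a)"

text \<open>The entropy form of I(X:Z|Y) is visibly continuous on the whole simplex, boundary
  included.\<close>

definition mutual_info :: "('x::finite \<times> 'y::finite \<times> 'z::finite \<Rightarrow> real) \<Rightarrow> real" where
  "mutual_info V = ent (marg pXY V) + ent (marg snd V) - ent (marg pY V) - ent V"

text \<open>Where the \<open>Y\<close>-marginal vanishes, the division yields \<open>0\<close>, which is the right value.\<close>

definition markov_proj :: "('x::finite \<times> 'y::finite \<times> 'z::finite \<Rightarrow> real) \<Rightarrow> 'x \<times> 'y \<times> 'z \<Rightarrow> real" where
  "markov_proj V a = marg pXY V (pXY a) * marg snd V (snd a) / marg pY V (pY a)"

section \<open>Marginals on the simplex and the Markov projection\<close>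

lemma prob_simplex_nonneg: "V \<in> prob_simplex \<Longrightarrow> 0 \<le> V a"
  by (simp add: prob_simplex_def)

lemma prob_simplex_sum: "V \<in> prob_simplex \<Longrightarrow> sum V UNIV = 1"
  by (simp add: prob_simplex_def)

lemma prob_simplex_le_1: "V \<in> prob_simplex \<Longrightarrow> V a \<le> 1"
  using member_le_sum[of a UNIV V] by (auto simp: prob_simplex_def)

lemma pmf_in_prob_simplex: "pmf P \<in> prob_simplex"
  by (simp add: prob_simplex_def sum_pmf_eq_1)

lemma marg_nonneg: "(\<And>a. 0 \<le> V a) \<Longrightarrow> 0 \<le> marg g V b"
  by (simp add: marg_def sum_nonneg)

lemma marg_ge: "(\<And>a. 0 \<le> V a) \<Longrightarrow> V a \<le> marg g V (g a)"
  unfolding marg_def by (intro member_le_sum) auto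

lemma sum_marg:
  fixes g :: "'a::finite \<Rightarrow> 'b::finite"
  shows "(\<Sum>b\<in>UNIV. marg g V b * h b) = (\<Sum>a\<in>UNIV. V a * h (g a))"
proof -
  have "(\<Sum>b\<in>UNIV. marg g V b * h b) = (\<Sum>b\<in>UNIV. \<Sum>a\<in>{x \<in> UNIV. g x = b}. V a * h (g a))"
    by (auto simp: marg_def sum_distrib_right intro!: sum.cong)
  also have "\<dots> = (\<Sum>a\<in>UNIV. V a * h (g a))"
    by (rule sum.group) auto
  finally show ?thesis .
qed

lemma marg_in_prob_simplex:
  fixes g :: "'a::finite \<Rightarrow> 'b::finite"
  assumes "V \<in> prob_simplex" shows "marg g V \<in> prob_simplex"
  using sum_marg[of g V "\<lambda>_. 1"] assms by (auto simp: prob_simplex_def marg_nonneg)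

lemma marg_marg:
  fixes g :: "'a::finite \<Rightarrow> 'b::finite"
  shows "marg h (marg g V) = marg (h \<circ> g) V"
proof
  fix c
  have "marg h (marg g V) c = (\<Sum>b\<in>UNIV. marg g V b * (if h b = c then 1 else 0))"
    by (simp add: marg_def[of h] if_distrib[of "\<lambda>x. _ * x"] sum.If_cases cong: if_cong)
  also have "\<dots> = marg (h \<circ> g) V c"
    unfolding sum_marg by (simp add: marg_def if_distrib[of "\<lambda>x. _ * x"] sum.If_cases cong: if_cong)
  finally show "marg h (marg g V) c = marg (h \<circ> g) V c" .
qed

lemma ent_marg:
  fixes g :: "'a::finite \<Rightarrow> 'b::finite"
  shows "ent (marg g V) = - (\<Sum>a\<in>UNIV. V a * ln (marg g V (g a)))"
  unfolding ent_def by (simp add: sum_marg)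

lemma pmf_map_eq_marg: "pmf (map_pmf g P) b = marg g (pmf P) b" for P :: "'a::finite pmf"
  by (simp add: pmf_map marg_def measure_measure_pmf_finite vimage_def)

lemma prob_simplex_pmf:
  assumes "V \<in> (prob_simplex :: ('a::finite \<Rightarrow> real) set)"
  obtains p where "pmf p = V"
proof
  show "pmf (embed_pmf V) = V"
  proof
    fix a
    have "(\<integral>\<^sup>+x. V x \<partial>count_space UNIV) = ennreal (sum V UNIV)"
      using assms by (simp add: nn_integral_count_space_finite prob_simplex_def)
    then show "pmf (embed_pmf V) a = V a"
      using assms by (intro pmf_embed_pmf) (auto simp: prob_simplex_def)
  qed
qed

lemma markov_proj_pos:
  assumes "\<And>a. 0 \<le> V a" "V a > 0" 
  shows "markov_proj V a > 0"
  using marg_ge[of V a pXY] marg_ge[of V a snd] marg_ge[of V a pY] assms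
  unfolding markov_proj_def by (smt (verit) divide_pos_pos mult_pos_pos)

lemma mutual_info_eq:
  assumes "V \<in> prob_simplex"
  shows "mutual_info V = (\<Sum>a\<in>UNIV. V a * (ln (V a) - ln (markov_proj V a)))"
proof -
  note nn = prob_simplex_nonneg[OF assms]
  have "V a * (ln (V a) - ln (markov_proj V a)) = V a * ln (marg pY V (pY a)) + V a * ln (V a)
      - V a * ln (marg pXY V (pXY a)) - V a * ln (marg snd V (snd a))" for a
  proof (cases "V a = 0")
    case False
    then have "V a > 0" using nn[of a] by simp
    then have "marg pXY V (pXY a) > 0" "marg snd V (snd a) > 0" "marg pY V (pY a) > 0"
      using marg_ge[of V a pXY] marg_ge[of V a snd] marg_ge[of V a pY] nn by force+
    then show ?thesis by (simp add: markov_proj_def ln_mult ln_div algebra_simps)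
  qed simp
  then show ?thesis
    unfolding mutual_info_def ent_marg by (simp add: ent_def sum.distrib sum_subtractf)
qed

definition markov_of :: "('x::finite \<times> 'y::finite \<times> 'z::finite) pmf \<Rightarrow> ('x \<times> 'y \<times> 'z) pmf" where
  "markov_of P = markov_pmf (map_pmf (fst \<circ> snd) P)
     (\<lambda>y. map_pmf fst (cond_pmf P {a. fst (snd a) = y}))
     (\<lambda>y. map_pmf (snd \<circ> snd) (cond_pmf P {a. fst (snd a) = y}))"

text \<open>Where the \<open>Y\<close>-marginal vanishes both sides are \<open>0\<close>, whatever
  the unspecified conditional laws are; elsewhere conditioning divides the pair marginals by the
  \<open>Y\<close>-marginal.\<close>

lemma pmf_markov_of:
  fixes P :: "('x::finite \<times> 'y::finite \<times> 'z::finite) pmf"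
  shows "pmf (markov_of P) a = markov_proj (pmf P) a"
proof -
  obtain x y z where a: "a = (x, y, z)" by (cases a)
  let ?A = "{a. fst (snd a) = y} :: ('x \<times> 'y \<times> 'z) set"
  have m: "measure (measure_pmf P) ?A = marg pY (pmf P) y"
    by (simp add: measure_measure_pmf_finite marg_def pY_def)
  have mY: "pmf (map_pmf (fst \<circ> snd) P) y = marg pY (pmf P) y"
    unfolding pmf_map_eq_marg by (simp add: marg_def pY_def)
  show ?thesis
  proof (cases "marg pY (pmf P) y = 0")
    case True
    then show ?thesis unfolding markov_of_def a pmf_markov_pmf mY
      by (simp add: markov_proj_def pY_def)
  next
    case False
    then have ne: "set_pmf P \<inter> ?A \<noteq> {}"
      using m by (metis measure_pmf_zero_iff)
    have "marg fst (pmf (cond_pmf P ?A)) x = marg pXY (pmf P) (x, y) / marg pY (pmf P) y"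
      unfolding marg_def pmf_cond[OF ne] sum_divide_distrib m[unfolded marg_def]
      by (intro sum.mono_neutral_cong_right) (auto simp: pXY_def)
    moreover have "marg (snd \<circ> snd) (pmf (cond_pmf P ?A)) z = marg snd (pmf P) (y, z) / marg pY (pmf P) y"
      unfolding marg_def pmf_cond[OF ne] sum_divide_distrib m[unfolded marg_def]
      by (intro sum.mono_neutral_cong_right) (auto simp: pXY_def)
    ultimately show ?thesis using False unfolding markov_of_def a pmf_markov_pmf mY
      by (simp add: pmf_map_eq_marg markov_proj_def pXY_def) (simp add: pY_def)
  qed
qed

text \<open>The projection of \<open>V\<close> is the maximum likelihood Markov model for
  \<open>V\<close>: the likelihood ratio splits into one factor each for \<open>Y\<close>,
  \<open>X|Y\<close> and \<open>Z|Y\<close>, and \<open>ln t <= t - 1\<close> is applied to each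
  factor separately. The hypothesis \<open>pos\<close> excludes terms where \<open>ln 0 = 0\<close>
  would hide a value of minus infinity.\<close>

lemma markov_cross_entropy_le:
  fixes V :: "'x::finite \<times> 'y::finite \<times> 'z::finite \<Rightarrow> real"
  assumes V: "V \<in> prob_simplex" and pos: "\<And>a. V a > 0 \<Longrightarrow> pmf (markov_pmf QY QX QZ) a > 0"
  shows "(\<Sum>a\<in>UNIV. V a * ln (pmf (markov_pmf QY QX QZ) a)) \<le> (\<Sum>a\<in>UNIV. V a * ln (markov_proj V a))"
proof -
  note nn = prob_simplex_nonneg[OF V]
  define mXY mYZ mY where "mXY = marg pXY V" and "mYZ = marg snd V" and "mY = marg pY V"
  have mnn: "0 \<le> mXY b" "0 \<le> mYZ c" "0 \<le> mY d" for b c d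
    by (auto simp: mXY_def mYZ_def mY_def marg_nonneg nn)
  \<comment> \<open>Ratios of \<open>QY\<close>, \<open>QX\<close>, \<open>QZ\<close> to the
    \<open>Y\<close>-marginal and the conditional laws of \<open>V\<close>. Their product is the
    ratio of the two Markov distributions, and each has \<open>V\<close>-mean at most 1; vanishing
    marginals may drop terms, so equality can fail.\<close>
  define e1 where "e1 = (\<lambda>a::'x \<times> 'y \<times> 'z. pmf QY (pY a) / mY (pY a))"
  define e2 where "e2 = (\<lambda>a::'x \<times> 'y \<times> 'z. pmf (QX (pY a)) (fst a) * mY (pY a) / mXY (pXY a))"
  define e3 where "e3 = (\<lambda>a::'x \<times> 'y \<times> 'z. pmf (QZ (pY a)) (snd (snd a)) * mY (pY a) / mYZ (snd a))"
  have "V a * ln (pmf (markov_pmf QY QX QZ) a) - V a * ln (markov_proj V a)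
     \<le> V a * e1 a + V a * e2 a + V a * e3 a - 3 * V a" for a
  proof (cases "V a = 0")
    case False
    then have Va: "V a > 0" using nn[of a] by simp
    obtain x y z where a: "a = (x, y, z)" by (cases a)
    have m: "mXY (pXY a) > 0" "mYZ (snd a) > 0" "mY (pY a) > 0"
      using marg_ge[of V a pXY] marg_ge[of V a snd] marg_ge[of V a pY] nn Va
      unfolding mXY_def mYZ_def mY_def by force+
    have "pmf QY y * pmf (QX y) x * pmf (QZ y) z > 0"
      using pos[OF Va] by (simp add: a pmf_markov_pmf)
    then have q: "pmf QY y > 0" "pmf (QX y) x > 0" "pmf (QZ y) z > 0"
      by (auto simp: less_le)
    have e: "e1 a > 0" "e2 a > 0" "e3 a > 0"
      using m q by (auto simp: e1_def e2_def e3_def a pY_def)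
    have "ln (pmf (markov_pmf QY QX QZ) a) - ln (markov_proj V a) = ln (e1 a) + ln (e2 a) + ln (e3 a)"
      using m q by (simp add: a pmf_markov_pmf markov_proj_def mXY_def[symmetric] mYZ_def[symmetric] mY_def[symmetric]
          e1_def e2_def e3_def pY_def ln_mult ln_div)
    also have "\<dots> \<le> e1 a + e2 a + e3 a - 3"
      using ln_le_minus_one[OF e(1)] ln_le_minus_one[OF e(2)] ln_le_minus_one[OF e(3)] by simp
    finally have "V a * (ln (pmf (markov_pmf QY QX QZ) a) - ln (markov_proj V a)) \<le> V a * (e1 a + e2 a + e3 a - 3)"
      using Va by (intro mult_left_mono) auto
    then show ?thesis by (simp add: algebra_simps)
  qed simp
  then have "(\<Sum>a\<in>UNIV. V a * ln (pmf (markov_pmf QY QX QZ) a) - V a * ln (markov_proj V a))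
     \<le> (\<Sum>a\<in>UNIV. V a * e1 a + V a * e2 a + V a * e3 a - 3 * V a)"
    by (intro sum_mono)
  also have "\<dots> = (\<Sum>a\<in>UNIV. V a * e1 a) + (\<Sum>a\<in>UNIV. V a * e2 a) + (\<Sum>a\<in>UNIV. V a * e3 a) - 3"
    using prob_simplex_sum[OF V] by (simp add: sum.distrib sum_subtractf sum_distrib_left[symmetric])
  also have "(\<Sum>a\<in>UNIV. V a * e1 a) \<le> 1"
  proof -
    have "(\<Sum>a\<in>UNIV. V a * e1 a) = (\<Sum>y\<in>UNIV. mY y * (pmf QY y / mY y))"
      unfolding mY_def e1_def by (subst sum_marg) simp
    also have "\<dots> \<le> (\<Sum>y\<in>UNIV. pmf QY y)" by (intro sum_mono) simp
    finally show ?thesis by (simp add: sum_pmf_eq_1)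
  qed
  also have "(\<Sum>a\<in>UNIV. V a * e2 a) \<le> 1"
  proof -
    let ?h = "\<lambda>(x,y). pmf (QX y) x * mY y / mXY (x, y)"
    have "(\<Sum>a\<in>UNIV. V a * e2 a) = (\<Sum>b\<in>UNIV. mXY b * ?h b)"
      unfolding mXY_def e2_def by (subst sum_marg) (simp add: pXY_def pY_def)
    also have "\<dots> \<le> (\<Sum>b\<in>UNIV. (\<lambda>(x,y). pmf (QX y) x * mY y) b)"
      by (intro sum_mono) (auto simp: mnn)
    also have "\<dots> = (\<Sum>y\<in>UNIV. mY y * (\<Sum>x\<in>UNIV. pmf (QX y) x))"
      unfolding UNIV_Times_UNIV[symmetric] sum.cartesian_product'
      by (subst sum.swap) (simp add: sum_distrib_left mult.commute)
    also have "\<dots> = 1" using prob_simplex_sum[OF marg_in_prob_simplex[OF V, of pY]]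
      by (simp add: sum_pmf_eq_1 mY_def)
    finally show ?thesis .
  qed
  also have "(\<Sum>a\<in>UNIV. V a * e3 a) \<le> 1"
  proof -
    let ?h = "\<lambda>(y,z). pmf (QZ y) z * mY y / mYZ (y, z)"
    have "(\<Sum>a\<in>UNIV. V a * e3 a) = (\<Sum>b\<in>UNIV. mYZ b * ?h b)"
      unfolding mYZ_def e3_def by (subst sum_marg) (simp add: pY_def split_beta)
    also have "\<dots> \<le> (\<Sum>b\<in>UNIV. (\<lambda>(y,z). pmf (QZ y) z * mY y) b)"
      by (intro sum_mono) (auto simp: mnn)
    also have "\<dots> = (\<Sum>y\<in>UNIV. mY y * (\<Sum>z\<in>UNIV. pmf (QZ y) z))"
      unfolding UNIV_Times_UNIV[symmetric] sum.cartesian_product'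
      by (simp add: sum_distrib_left mult.commute)
    also have "\<dots> = 1" using prob_simplex_sum[OF marg_in_prob_simplex[OF V, of pY]]
      by (simp add: sum_pmf_eq_1 mY_def)
    finally show ?thesis .
  qed
  finally show ?thesis by (simp add: sum_subtractf)
qed

subsection \<open>The variational functional\<close>

definition ac_simplex :: "'a::finite pmf \<Rightarrow> ('a \<Rightarrow> real) set" where
  "ac_simplex P = {V \<in> prob_simplex. \<forall>a. pmf P a = 0 \<longrightarrow> V a = 0}"

definition rel_ent :: "('a::finite \<Rightarrow> real) \<Rightarrow> 'a pmf \<Rightarrow> real" where
  "rel_ent V P = (\<Sum>a\<in>UNIV. V a * (ln (V a) - ln (pmf P a)))"

definition variational :: "('x::finite \<times> 'y::finite \<times> 'z::finite) pmf \<Rightarrow> real \<Rightarrow> ('x \<times> 'y \<times> 'z \<Rightarrow> real) \<Rightarrow> real" where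
  "variational P s V = (s - 1) * mutual_info V - s * rel_ent V P"

text \<open>This is \<open>(s - 1) D(V||Q) - s D(V||P)\<close> multiplied out. Decoupling
  \<open>Q\<close> from \<open>V\<close> leaves, for fixed \<open>Q\<close>, an entropy plus linear
  terms, hence a concave function of \<open>V\<close>; \<open>Q = markov_proj V\<close> gives back
  \<open>variational\<close>.\<close>

definition variational_at :: "'a::finite pmf \<Rightarrow> real \<Rightarrow> ('a \<Rightarrow> real) \<Rightarrow> ('a \<Rightarrow> real) \<Rightarrow> real" where
  "variational_at P s V Q = ent V - (s - 1) * (\<Sum>a\<in>UNIV. V a * ln (Q a)) + s * (\<Sum>a\<in>UNIV. V a * ln (pmf P a))"

lemma ac_simplexD:
  assumes "V \<in> ac_simplex P"
  shows "V \<in> prob_simplex" "\<And>a. 0 \<le> V a" "sum V UNIV = 1" "\<And>a. V a > 0 \<Longrightarrow> pmf P a > 0" "\<And>a. V a \<noteq> 0 \<Longrightarrow> pmf P a > 0"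
  using assms by (auto simp: ac_simplex_def prob_simplex_def less_le)

lemma pmf_in_ac_simplex: "pmf P \<in> ac_simplex P"
  by (simp add: ac_simplex_def pmf_in_prob_simplex)

lemma compact_ac_simplex: "compact (ac_simplex P)"
proof -
  define K :: "('a \<Rightarrow> real) set" where "K = Pi\<^sub>E UNIV (\<lambda>_. {0..1})"
  have "compact K"
    unfolding K_def using compactin_PiE[of "\<lambda>_. euclideanreal" UNIV "\<lambda>_::'a. {0..1}"]
    by (simp add: euclidean_product_topology)
  moreover have "closed {V. (\<forall>a. pmf P a = 0 \<longrightarrow> V a = 0) \<and> sum V UNIV = (1::real)}"
    by (intro closed_Collect_conj closed_Collect_all closed_Collect_imp closed_Collect_eq open_Collect_const
        continuous_intros) auto
  moreover have "ac_simplex P = K \<inter> {V. (\<forall>a. pmf P a = 0 \<longrightarrow> V a = 0) \<and> sum V UNIV = 1}"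
    using prob_simplex_le_1[where 'a='a] by (auto simp: ac_simplex_def K_def PiE_def Pi_def prob_simplex_def)
  ultimately show ?thesis by (simp add: compact_Int_closed)
qed

lemma continuous_on_ent_marg:
  fixes g :: "'a::finite \<Rightarrow> 'b::finite"
  shows "continuous_on prob_simplex (\<lambda>V. ent (marg g V))"
proof -
  have c: "continuous_on prob_simplex (\<lambda>V. marg g V b)" for b
    unfolding marg_def by (intro continuous_intros continuous_on_product_coordinates continuous_on_subset[OF continuous_on_product_coordinates]) auto
  have "continuous_on prob_simplex (\<lambda>V. marg g V b * ln (marg g V b))" for b
    by (rule continuous_on_compose2[OF continuous_on_x_ln_x c])
       (auto simp: prob_simplex_nonneg marg_nonneg)
  then show ?thesis unfolding ent_def by (intro continuous_on_minus continuous_on_sum)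
qed

lemma marg_id: "marg id V = V"
  by (rule ext) (simp add: marg_def)

lemma ent_eq_ent_marg: "ent = (\<lambda>V. ent (marg id V))"
  by (simp add: marg_id)

lemma continuous_on_ent: "continuous_on prob_simplex ent"
  by (subst ent_eq_ent_marg) (rule continuous_on_ent_marg)

lemma continuous_on_mutual_info: "continuous_on prob_simplex mutual_info"
  unfolding mutual_info_def
  by (intro continuous_intros continuous_on_ent_marg continuous_on_ent)

lemma rel_ent_eq: "rel_ent V P = - ent V - (\<Sum>a\<in>UNIV. V a * ln (pmf P a))"
  by (simp add: rel_ent_def ent_def algebra_simps sum_subtractf)

lemma continuous_on_rel_ent: "continuous_on prob_simplex (\<lambda>V. rel_ent V P)"
  unfolding rel_ent_eq
  by (intro continuous_intros continuous_on_ent continuous_on_subset[OF continuous_on_product_coordinates]) auto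

lemma ac_simplex_subset: "ac_simplex P \<subseteq> prob_simplex"
  by (auto simp: ac_simplex_def)

lemma continuous_on_variational: "continuous_on (ac_simplex P) (variational P s)"
  unfolding variational_def
  by (intro continuous_intros continuous_on_subset[OF continuous_on_mutual_info ac_simplex_subset]
     continuous_on_subset[OF continuous_on_rel_ent ac_simplex_subset])

text \<open>A choice, since uniqueness is established only later and for
  \<open>s > 1/2\<close>.\<close>

definition maximizer :: "('x::finite \<times> 'y::finite \<times> 'z::finite) pmf \<Rightarrow> real \<Rightarrow> 'x \<times> 'y \<times> 'z \<Rightarrow> real" where
  "maximizer P s = (SOME V. V \<in> ac_simplex P \<and> (\<forall>U\<in>ac_simplex P. variational P s U \<le> variational P s V))"

text \<open>For \<open>s > 0\<close> this is \<open>phi\<close> in natural units, see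
  \<open>phi_eq_max_variational\<close>.\<close>

definition max_variational :: "('x::finite \<times> 'y::finite \<times> 'z::finite) pmf \<Rightarrow> real \<Rightarrow> real" where
  "max_variational P s = variational P s (maximizer P s)"

lemma maximizer:
  shows "maximizer P s \<in> ac_simplex P" and "U \<in> ac_simplex P \<Longrightarrow> variational P s U \<le> max_variational P s"
proof -
  have "\<exists>V. V \<in> ac_simplex P \<and> (\<forall>U\<in>ac_simplex P. variational P s U \<le> variational P s V)"
    using continuous_attains_sup[OF compact_ac_simplex _ continuous_on_variational, of P s] pmf_in_ac_simplex[of P]
    by blast
  from someI_ex[OF this] show "maximizer P s \<in> ac_simplex P"
    "U \<in> ac_simplex P \<Longrightarrow> variational P s U \<le> max_variational P s"
    unfolding maximizer_def[symmetric] max_variational_def by auto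
qed

lemma variational_eq_variational_at:
  assumes "V \<in> prob_simplex"
  shows "variational P s V = variational_at P s V (markov_proj V)"
proof -
  have "mutual_info V = - ent V - (\<Sum>a\<in>UNIV. V a * ln (markov_proj V a))"
    unfolding mutual_info_eq[OF assms] ent_def by (simp add: algebra_simps sum_subtractf)
  then show ?thesis unfolding variational_def variational_at_def rel_ent_eq
    by (simp only:) (simp add: algebra_simps)
qed

lemma ex_markov_pmf_proj:
  assumes "V \<in> prob_simplex"
  obtains QY QX QZ where "pmf (markov_pmf QY QX QZ) = markov_proj V"
proof -
  obtain p where "pmf p = V" using prob_simplex_pmf[OF assms] .
  then have "pmf (markov_of p) = markov_proj V" using pmf_markov_of[of p] by auto
  then show ?thesis using that unfolding markov_of_def by blast
qed

lemma mix_in_ac_simplex: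
  assumes "V \<in> ac_simplex P" "U \<in> ac_simplex P" "0 \<le> e" "e \<le> 1"
  shows "(\<lambda>a. (1 - e) * V a + e * U a) \<in> ac_simplex P"
  using assms by (auto simp: ac_simplex_def prob_simplex_def sum.distrib sum_distrib_left[symmetric])

lemma marg_mix: "marg g (\<lambda>a. (1 - e) * V a + e * U a) b = (1 - e) * marg g V b + e * marg g U b"
  by (simp add: marg_def sum.distrib sum_distrib_left)

text \<open>By Gibbs, the cross entropy of \<open>V\<close> (or \<open>U\<close>) against the
  mixture is at least its entropy; the weighted mean of the two cross entropies is exactly the
  entropy of the mixture.\<close>

lemma ent_concave:
  assumes V: "V \<in> prob_simplex" and U: "U \<in> prob_simplex" and e: "0 < e" "e < 1"
  shows "(1 - e) * ent V + e * ent U \<le> ent (\<lambda>a. (1 - e) * V a + e * U a)"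
proof -
  let ?M = "\<lambda>a. (1 - e) * V a + e * U a"
  have M0: "V a = 0 \<and> U a = 0" if "?M a = 0" for a
    using that e prob_simplex_nonneg[OF V, of a] prob_simplex_nonneg[OF U, of a]
    by (auto simp: add_nonneg_eq_0_iff)
  have M: "?M \<in> prob_simplex" using V U e
    by (auto simp: prob_simplex_def sum.distrib sum_distrib_left[symmetric])
  have "(\<Sum>a\<in>UNIV. W a * (ln (?M a) - ln (W a))) \<le> 0"
    if "W \<in> prob_simplex" "\<And>a. ?M a = 0 \<Longrightarrow> W a = 0" for W
  proof -
    have "(\<Sum>a\<in>UNIV. W a * (ln (?M a) - ln (W a))) \<le> ln (sum ?M UNIV)"
      using that prob_simplex_nonneg[OF M] by (intro gibbs_inequality) (auto simp: prob_simplex_def)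
    then show ?thesis using prob_simplex_sum[OF M] by simp
  qed
  from this[OF V] this[OF U] M0
  have 1: "ent V \<le> - (\<Sum>a\<in>UNIV. V a * ln (?M a))" and 2: "ent U \<le> - (\<Sum>a\<in>UNIV. U a * ln (?M a))"
    by (auto simp: ent_def algebra_simps sum_subtractf)
  have "(1 - e) * ent V + e * ent U \<le> (1 - e) * (- (\<Sum>a\<in>UNIV. V a * ln (?M a))) + e * (- (\<Sum>a\<in>UNIV. U a * ln (?M a)))"
    using 1 2 e by (intro add_mono mult_left_mono) auto
  also have "\<dots> = ent ?M"
    unfolding ent_def sum_distrib_left sum_negf[symmetric] sum.distrib[symmetric]
    by (intro sum.cong) (auto simp: algebra_simps)
  finally show ?thesis .
qed

text \<open>
  Optimality of \<open>W = maximizer P s\<close> against the mixtures \<open>(1 - e) W + e V\<close>, with the Markov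
  projection of the mixture inserted, bounds \<open>variational_at\<close> by \<open>max_variational\<close> for every \<open>e\<close>;
  letting \<open>e\<close> tend to \<open>0\<close> needs no derivatives, but first that the projections stay bounded
  away from \<open>0\<close> on the support of \<open>P\<close>, for which \<open>V = P\<close> is used.
\<close>

lemma saddle_point:
  assumes s: "s > 1"
  shows "pmf P a > 0 \<Longrightarrow> markov_proj (maximizer P s) a > 0"
    and "V \<in> ac_simplex P \<Longrightarrow> variational_at P s V (markov_proj (maximizer P s)) \<le> max_variational P s"
proof -
  define W where "W = maximizer P s"
  define X where "X = (\<lambda>V e a. (1 - e) * W a + e * V a)"
  have W: "W \<in> ac_simplex P" using maximizer(1) by (simp add: W_def)
  note Wd = ac_simplexD[OF W]
  have key: "variational_at P s V (markov_proj (X V e)) \<le> max_variational P s"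
    if V: "V \<in> ac_simplex P" and e: "0 < e" "e < 1" for V e
  proof -
    note Vd = ac_simplexD[OF V]
    have X: "X V e \<in> ac_simplex P" unfolding X_def using e by (intro mix_in_ac_simplex W V) auto
    note Xd = ac_simplexD[OF X]
    obtain QY QX QZ where Q: "pmf (markov_pmf QY QX QZ) = markov_proj (X V e)"
      using ex_markov_pmf_proj[OF Xd(1)] .
    have pos: "markov_proj (X V e) a > 0" if "W a > 0" for a
    proof (rule markov_proj_pos)
      show "0 < X V e a" using e that Vd(2)[of a] unfolding X_def
        by (intro add_pos_nonneg mult_pos_pos mult_nonneg_nonneg) auto
    qed (rule Xd)
    \<comment> \<open>For \<open>W\<close> its own projection is the best Markov model; as
      \<open>s - 1 > 0\<close>, inserting that of the mixture can only raise
      \<open>variational_at\<close> at \<open>W\<close>.\<close>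
    have "(\<Sum>a\<in>UNIV. W a * ln (markov_proj (X V e) a)) \<le> (\<Sum>a\<in>UNIV. W a * ln (markov_proj W a))"
      using markov_cross_entropy_le[OF Wd(1), of QY QX QZ] pos by (simp add: Q)
    then have 1: "variational P s W \<le> variational_at P s W (markov_proj (X V e))"
      unfolding variational_eq_variational_at[OF Wd(1)] variational_at_def using s by simp
    have "(1 - e) * variational_at P s W (markov_proj (X V e)) + e * variational_at P s V (markov_proj (X V e))
       \<le> variational_at P s (X V e) (markov_proj (X V e))"
    proof -
      have lin: "(\<Sum>a\<in>UNIV. X V e a * h a) = (1 - e) * (\<Sum>a\<in>UNIV. W a * h a) + e * (\<Sum>a\<in>UNIV. V a * h a)" for h
        unfolding X_def sum_distrib_left sum.distrib[symmetric] by (intro sum.cong) (auto simp: algebra_simps)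
      have "(1 - e) * ent W + e * ent V \<le> ent (X V e)"
        unfolding X_def by (rule ent_concave[OF Wd(1) Vd(1) e])
      then show ?thesis unfolding variational_at_def lin by (simp add: algebra_simps)
    qed
    also have "\<dots> \<le> max_variational P s"
      unfolding variational_eq_variational_at[OF Xd(1), symmetric] by (rule maximizer(2)[OF X])
    finally have "(1 - e) * variational_at P s W (markov_proj (X V e)) + e * variational_at P s V (markov_proj (X V e)) \<le> max_variational P s" .
    moreover have "(1 - e) * max_variational P s \<le> (1 - e) * variational_at P s W (markov_proj (X V e))"
      using 1 e by (simp add: max_variational_def W_def)
    ultimately have "e * variational_at P s V (markov_proj (X V e)) \<le> e * max_variational P s" by (simp add: algebra_simps)
    then show ?thesis using e by simp
  qed
  have pos: "markov_proj W a > 0" if a: "pmf P a > 0" for a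
  proof -
    \<comment> \<open>\<open>key\<close> with \<open>V = P\<close>, solved for the cross entropy,
      bounds it by \<open>C\<close> for every \<open>e\<close>. All its terms are nonnegative, so
      the one at \<open>a\<close> is at most \<open>C\<close>, which bounds the projection at
      \<open>a\<close> below by \<open>c\<close>.\<close>
    define C where "C = (max_variational P s - ent (pmf P) - s * (\<Sum>a\<in>UNIV. pmf P a * ln (pmf P a))) / (s - 1)"
    define c where "c = exp (- (C / pmf P a))"
    have c: "c > 0" by (simp add: c_def)
    have bound: "c \<le> markov_proj (X (pmf P) e) a" if e: "0 < e" "e < 1" for e
    proof -
      have X: "X (pmf P) e \<in> ac_simplex P" unfolding X_def using e by (intro mix_in_ac_simplex W pmf_in_ac_simplex) auto
      note Xd = ac_simplexD[OF X]
      obtain QY QX QZ where Q: "pmf (markov_pmf QY QX QZ) = markov_proj (X (pmf P) e)"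
        using ex_markov_pmf_proj[OF Xd(1)] .
      have posX: "markov_proj (X (pmf P) e) a > 0" if "pmf P a > 0" for a
      proof (rule markov_proj_pos)
        show "0 < X (pmf P) e a" using e that Wd(2)[of a] unfolding X_def
          by (intro add_nonneg_pos mult_pos_pos mult_nonneg_nonneg) auto
      qed (rule Xd)
      have le1: "markov_proj (X (pmf P) e) a' \<le> 1" for a' unfolding Q[symmetric] by (rule pmf_le_1)
      have t: "0 \<le> - (pmf P a' * ln (markov_proj (X (pmf P) e) a'))" for a'
        using posX[of a'] le1[of a'] by (cases "pmf P a' = 0") (auto simp: mult_nonneg_nonpos less_le)
      have "- ((s - 1) * (\<Sum>a'\<in>UNIV. pmf P a' * ln (markov_proj (X (pmf P) e) a'))) \<le> (s - 1) * C"
      proof -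
        have "(s - 1) * C = max_variational P s - ent (pmf P) - s * (\<Sum>a\<in>UNIV. pmf P a * ln (pmf P a))"
          using s by (simp add: C_def)
        then show ?thesis using key[OF pmf_in_ac_simplex e] unfolding variational_at_def by linarith
      qed
      then have "(s - 1) * (- (\<Sum>a'\<in>UNIV. pmf P a' * ln (markov_proj (X (pmf P) e) a'))) \<le> (s - 1) * C"
        by simp
      then have "- (\<Sum>a'\<in>UNIV. pmf P a' * ln (markov_proj (X (pmf P) e) a')) \<le> C"
        by (rule mult_left_le_imp_le) (use s in simp)
      then have "(\<Sum>a'\<in>UNIV. - (pmf P a' * ln (markov_proj (X (pmf P) e) a'))) \<le> C"
        unfolding sum_negf .
      moreover have "- (pmf P a * ln (markov_proj (X (pmf P) e) a)) \<le> (\<Sum>a'\<in>UNIV. - (pmf P a' * ln (markov_proj (X (pmf P) e) a')))"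
        using t by (intro member_le_sum) auto
      ultimately have "- (pmf P a * ln (markov_proj (X (pmf P) e) a)) \<le> C" by linarith
      then have "- (C / pmf P a) \<le> ln (markov_proj (X (pmf P) e) a)" using a by (simp add: field_simps)
      then show ?thesis unfolding c_def using posX[OF a] by (simp add: ln_ge_iff)
    qed
    \<comment> \<open>If the marginal of \<open>W\<close> vanished, that of the mixture would be at
      most \<open>e\<close>, which fails for \<open>e < c\<close>.\<close>
    have margpos: "marg g W b > 0" if lb: "\<And>e. 0 < e \<Longrightarrow> e < 1 \<Longrightarrow> c \<le> marg g (X (pmf P) e) b" and le: "marg g (pmf P) b \<le> 1"
      for g :: "'a \<times> 'b \<times> 'c \<Rightarrow> 'd" and b
    proof (rule ccontr)
      assume "\<not> ?thesis"
      then have 0: "marg g W b = 0" using marg_nonneg[of W g b] Wd(2) by force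
      define e where "e = min (1/2) (c / 2)"
      have e: "0 < e" "e < 1" "e < c" using c by (auto simp: e_def)
      have "c \<le> e * marg g (pmf P) b" using lb[OF e(1,2)] by (simp add: X_def marg_mix 0)
      also have "\<dots> \<le> e * 1" using e le by (intro mult_left_mono) auto
      finally show False using e by simp
    qed
    have marg_le: "marg snd V (snd a) \<le> marg pY V (pY a)" "marg pXY V (pXY a) \<le> marg pY V (pY a)"
      if "V \<in> prob_simplex" for V :: "'a \<times> 'b \<times> 'c \<Rightarrow> real"
      using that unfolding marg_def
      by (auto intro!: sum_mono2 simp: pY_def pXY_def prob_simplex_nonneg)
    have *: "c \<le> marg pXY (X (pmf P) e) (pXY a) \<and> c \<le> marg snd (X (pmf P) e) (snd a)" if e: "0 < e" "e < 1" for e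
    proof -
      have X: "X (pmf P) e \<in> ac_simplex P" unfolding X_def using e by (intro mix_in_ac_simplex W pmf_in_ac_simplex) auto
      note Xd = ac_simplexD[OF X]
      define m1 m2 m where "m1 = marg pXY (X (pmf P) e) (pXY a)" and "m2 = marg snd (X (pmf P) e) (snd a)"
        and "m = marg pY (X (pmf P) e) (pY a)"
      have "c \<le> m1 * m2 / m" using bound[OF e] by (simp add: markov_proj_def m1_def m2_def m_def)
      moreover have "0 \<le> m1" "0 \<le> m2" by (auto simp: m1_def m2_def marg_nonneg Xd)
      moreover have "m1 \<le> m" "m2 \<le> m" using marg_le[OF Xd(1)] by (auto simp: m1_def m2_def m_def)
      ultimately have m: "m > 0" using c by (cases "m = 0") auto
      \<comment> \<open>Pair marginals are dominated by the \<open>Y\<close>-marginal, so a lower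
        bound on the projection is inherited by both of them.\<close>
      have "m1 * m2 \<le> m1 * m" "m1 * m2 \<le> m * m2"
        using \<open>m1 \<le> m\<close> \<open>m2 \<le> m\<close> \<open>0 \<le> m1\<close> \<open>0 \<le> m2\<close>
        by (simp_all add: mult_left_mono mult_right_mono)
      then have "m1 * m2 / m \<le> m1" "m1 * m2 / m \<le> m2"
        using m by (simp_all add: divide_le_eq mult.commute)
      then show ?thesis using \<open>c \<le> m1 * m2 / m\<close> by (auto simp: m1_def m2_def)
    qed
    have "marg pXY W (pXY a) > 0"
      using * by (intro margpos) (auto intro!: prob_simplex_le_1 marg_in_prob_simplex pmf_in_prob_simplex)
    moreover have "marg snd W (snd a) > 0"
      using * by (intro margpos) (auto intro!: prob_simplex_le_1 marg_in_prob_simplex pmf_in_prob_simplex)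
    moreover have "marg pY W (pY a) > 0"
      using marg_le(1)[OF Wd(1)] calculation(2) by linarith
    ultimately show ?thesis by (simp add: markov_proj_def)
  qed
  then show "pmf P a > 0 \<Longrightarrow> markov_proj (maximizer P s) a > 0" by (simp add: W_def)
  assume V: "V \<in> ac_simplex P"
  \<comment> \<open>Off the support of \<open>V\<close> the term is constantly \<open>0\<close>; on
    it \<open>pos\<close> makes both the division and \<open>ln\<close> continuous at the
    limit.\<close>
  have lim: "((\<lambda>e. V a * ln (markov_proj (X V e) a)) \<longlongrightarrow> V a * ln (markov_proj W a)) (at_right 0)" for a
  proof (cases "V a = 0")
    case False
    then have p: "markov_proj W a > 0" using ac_simplexD(5)[OF V] pos by blast
    then have m: "marg pY W (pY a) \<noteq> 0" by (auto simp: markov_proj_def)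
    have "((\<lambda>e. marg g (X V e) b) \<longlongrightarrow> (1 - 0) * marg g W b + 0 * marg g V b) (at_right 0)" for g :: "'a \<times> 'b \<times> 'c \<Rightarrow> 'd" and b
      unfolding X_def marg_mix by (intro tendsto_intros)
    then have l: "((\<lambda>e. marg g (X V e) b) \<longlongrightarrow> marg g W b) (at_right 0)" for g :: "'a \<times> 'b \<times> 'c \<Rightarrow> 'd" and b
      by simp
    have "((\<lambda>e. markov_proj (X V e) a) \<longlongrightarrow> markov_proj W a) (at_right 0)"
      unfolding markov_proj_def by (intro tendsto_divide tendsto_mult l m)
    then show ?thesis using p by (intro tendsto_intros) auto
  qed simp
  have "((\<lambda>e. variational_at P s V (markov_proj (X V e))) \<longlongrightarrow> variational_at P s V (markov_proj W)) (at_right 0)"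
    unfolding variational_at_def by (intro tendsto_intros lim)
  moreover have "eventually (\<lambda>e. variational_at P s V (markov_proj (X V e)) \<le> max_variational P s) (at_right 0)"
    using key[OF V] by (auto simp: eventually_at_right_field intro!: exI[of _ 1])
  ultimately show "variational_at P s V (markov_proj (maximizer P s)) \<le> max_variational P s"
    unfolding W_def by (rule tendsto_upperbound) simp
qed

subsection \<open>Renyi conditional mutual information\<close>

text \<open>The argument of the logarithm in \<open>renyi_div\<close>. As
  \<open>0 powr x = 0\<close>, for \<open>s > 1\<close> it is the true sum only if the support of
  \<open>P\<close> lies in that of \<open>Q\<close>.\<close>

definition tilt_sum :: "'a::finite pmf \<Rightarrow> real \<Rightarrow> 'a pmf \<Rightarrow> real" where
  "tilt_sum P s Q = (\<Sum>a\<in>set_pmf P. pmf P a powr s * pmf Q a powr (1 - s))"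

lemma variational_at_eq_sum:
  "variational_at P s V Q = (\<Sum>a\<in>UNIV. V a * (s * ln (pmf P a) + (1 - s) * ln (Q a) - ln (V a)))"
  by (simp add: variational_at_def ent_def algebra_simps sum.distrib sum_subtractf sum_distrib_left)

text \<open>One half of the Gibbs variational principle: the Gibbs inequality with the tilted
  weights \<open>P^s Q^(1-s)\<close>, restricted to the support of \<open>V\<close>.\<close>

lemma variational_at_le_ln_tilt_sum:
  assumes V: "V \<in> ac_simplex P" and Q: "\<And>a. V a > 0 \<Longrightarrow> pmf Q a > 0"
  shows "tilt_sum P s Q > 0" and "variational_at P s V (pmf Q) \<le> ln (tilt_sum P s Q)"
proof -
  note Vd = ac_simplexD[OF V]
  define w where "w = (\<lambda>a. pmf P a powr s * pmf Q a powr (1 - s))"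
  define A where "A = {a. V a > 0}"
  have w: "w a > 0" if "a \<in> A" for a
    using that Vd(4)[of a] Q[of a] by (auto simp: w_def A_def)
  have sA: "sum V A = 1"
    unfolding Vd(3)[symmetric] A_def using Vd(2) by (intro sum.mono_neutral_left) (auto simp: less_le)
  then have "A \<noteq> {}" by auto
  then have pos: "sum w A > 0" using w by (intro sum_pos) auto
  have le: "sum w A \<le> tilt_sum P s Q"
    unfolding tilt_sum_def w_def[symmetric] using Vd(4) unfolding A_def w_def
    by (intro sum_mono2) (auto simp: pmf_positive_iff)
  show "tilt_sum P s Q > 0" using pos le by linarith
  have "variational_at P s V (pmf Q) = (\<Sum>a\<in>A. V a * (ln (w a) - ln (V a)))"
    unfolding variational_at_eq_sum
  proof (rule sum.mono_neutral_cong_right)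
    show "\<forall>i\<in>UNIV - A. V i * (s * ln (pmf P i) + (1 - s) * ln (pmf Q i) - ln (V i)) = 0"
      using Vd(2) by (auto simp: A_def less_le)
    fix a assume "a \<in> A"
    then show "V a * (s * ln (pmf P a) + (1 - s) * ln (pmf Q a) - ln (V a)) = V a * (ln (w a) - ln (V a))"
      using Vd(4)[of a] Q[of a] by (simp add: A_def w_def ln_mult ln_powr)
  qed auto
  also have "\<dots> \<le> ln (sum w A)"
    using w sA Vd(2) by (intro gibbs_inequality) (auto simp: less_imp_le less_imp_neq[symmetric] dest: w less_imp_neq)
  also have "\<dots> \<le> ln (tilt_sum P s Q)" using pos le by simp
  finally show "variational_at P s V (pmf Q) \<le> ln (tilt_sum P s Q)" .
qed

text \<open>The equality case of the Gibbs inequality: \<open>V\<close> is the normalised tilted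
  weight.\<close>

lemma ln_tilt_sum_attained:
  assumes S: "tilt_sum P s Q > 0"
  obtains V where "V \<in> ac_simplex P" "\<And>a. V a > 0 \<Longrightarrow> pmf Q a > 0" "variational_at P s V (pmf Q) = ln (tilt_sum P s Q)"
proof -
  define S where "S = tilt_sum P s Q"
  have S: "S > 0" using assms by (simp add: S_def)
  define w where "w = (\<lambda>a. pmf P a powr s * pmf Q a powr (1 - s))"
  define V where "V = (\<lambda>a. w a / S)"
  have w0: "w a = 0 \<longleftrightarrow> pmf P a = 0 \<or> pmf Q a = 0" for a by (simp add: w_def)
  have "sum w UNIV = S"
    unfolding S_def tilt_sum_def w_def[symmetric] by (rule sum.mono_neutral_right) (auto simp: w0 set_pmf_iff)
  then have V: "V \<in> ac_simplex P"
    using S by (auto simp: ac_simplex_def prob_simplex_def V_def w_def sum_divide_distrib[symmetric])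
  have pos: "pmf Q a > 0" if "V a > 0" for a
    using that w0[of a] S by (cases "pmf Q a = 0") (auto simp: V_def less_le)
  have "variational_at P s V (pmf Q) = (\<Sum>a\<in>UNIV. V a * ln S)"
    unfolding variational_at_eq_sum
  proof (rule sum.cong)
    fix a
    show "V a * (s * ln (pmf P a) + (1 - s) * ln (pmf Q a) - ln (V a)) = V a * ln S"
    proof (cases "V a = 0")
      case False
      then have "pmf P a > 0" "pmf Q a > 0" using w0[of a] by (auto simp: V_def less_le)
      then have "ln (V a) = s * ln (pmf P a) + (1 - s) * ln (pmf Q a) - ln S"
        using S by (simp add: V_def w_def ln_div ln_mult ln_powr)
      then show ?thesis by simp
    qed simp
  qed simp
  also have "\<dots> = ln S" using ac_simplexD(3)[OF V] by (simp add: sum_distrib_right[symmetric])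
  finally show ?thesis using that V pos unfolding S_def by blast
qed

lemma renyi_cmi_eqI:
  assumes "\<And>QY QX QZ. ereal c \<le> renyi_div b s P (markov_pmf QY QX QZ)"
    and "renyi_div b s P (markov_pmf QY' QX' QZ') \<le> ereal c"
  shows "renyi_cmi b s P = ereal c" "renyi_cmi b s P = renyi_div b s P (markov_pmf QY' QX' QZ')"
proof -
  have "renyi_cmi b s P = ereal c"
    unfolding renyi_cmi_def
  proof (rule antisym)
    show "(INF (QY, QX, QZ). renyi_div b s P (markov_pmf QY QX QZ)) \<le> ereal c"
      by (rule INF_lower2[of "(QY', QX', QZ')"]) (auto simp: assms(2))
    show "ereal c \<le> (INF (QY, QX, QZ). renyi_div b s P (markov_pmf QY QX QZ))"
      by (rule INF_greatest) (auto simp: assms(1))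
  qed
  then show "renyi_cmi b s P = ereal c" "renyi_cmi b s P = renyi_div b s P (markov_pmf QY' QX' QZ')"
    using assms(1)[of QY' QX' QZ'] assms(2) by auto
qed

text \<open>The cross entropy bound enters with the factor \<open>s - 1\<close>, so its direction
  flips at \<open>s = 1\<close>; the next lemma is the other half.\<close>

lemma variational_le_variational_at:
  assumes V: "V \<in> ac_simplex P" and s: "s \<ge> 1" and Q: "\<And>a. V a > 0 \<Longrightarrow> pmf (markov_pmf QY QX QZ) a > 0"
  shows "variational P s V \<le> variational_at P s V (pmf (markov_pmf QY QX QZ))"
  using markov_cross_entropy_le[OF ac_simplexD(1)[OF V] Q] s
  unfolding variational_eq_variational_at[OF ac_simplexD(1)[OF V]] variational_at_def by (simp add: mult_left_mono)

lemma variational_at_le_variational: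
  assumes V: "V \<in> ac_simplex P" and s: "s \<le> 1" and Q: "\<And>a. V a > 0 \<Longrightarrow> pmf (markov_pmf QY QX QZ) a > 0"
  shows "variational_at P s V (pmf (markov_pmf QY QX QZ)) \<le> variational P s V"
  using markov_cross_entropy_le[OF ac_simplexD(1)[OF V] Q] s
  unfolding variational_eq_variational_at[OF ac_simplexD(1)[OF V]] variational_at_def by (simp add: mult_left_mono_neg)

lemma renyi_div_eq:
  assumes "s \<noteq> 1" "b > 1"
  shows "renyi_div b s P Q = (if s > 1 \<and> \<not> set_pmf P \<subseteq> set_pmf Q \<or> s < 1 \<and> tilt_sum P s Q = 0 then \<infinity>
     else ereal (ln (tilt_sum P s Q) / ((s - 1) * ln b)))"
  using assms by (auto simp: renyi_div_def Let_def tilt_sum_def log_def)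

lemma tilt_sum_nonneg: "0 \<le> tilt_sum P s Q"
  by (simp add: tilt_sum_def sum_nonneg)

text \<open>The projection of the maximiser is an optimal Markov distribution. The bound from below
  tests the Gibbs principle at the maximiser. The bound from above applies to the tilted weight the
  saddle point property if \<open>s > 1\<close>, and optimality of the projection together with
  maximality if \<open>s < 1\<close>.\<close>

lemma tilt_sum_markov_proj:
  assumes s: "s > 0" and Q: "pmf (markov_pmf QY QX QZ) = markov_proj (maximizer P s)"
  shows "tilt_sum P s (markov_pmf QY QX QZ) > 0" "s > 1 \<Longrightarrow> set_pmf P \<subseteq> set_pmf (markov_pmf QY QX QZ)"
    "s \<noteq> 1 \<Longrightarrow> ln (tilt_sum P s (markov_pmf QY QX QZ)) = max_variational P s"
proof -
  let ?W = "maximizer P s" and ?Q = "markov_pmf QY QX QZ"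
  have W: "?W \<in> ac_simplex P" by (rule maximizer)
  have pos: "pmf ?Q a > 0" if "?W a > 0" for a
    unfolding Q by (rule markov_proj_pos) (use that ac_simplexD(2)[OF W] in auto)
  show S: "tilt_sum P s ?Q > 0" by (rule variational_at_le_ln_tilt_sum(1)[OF W pos])
  show sub: "set_pmf P \<subseteq> set_pmf ?Q" if "s > 1"
    using saddle_point(1)[OF that, of P] unfolding Q[symmetric] by (auto simp: pmf_positive_iff)
  assume s1: "s \<noteq> 1"
  have ge: "max_variational P s \<le> ln (tilt_sum P s ?Q)"
    using variational_at_le_ln_tilt_sum(2)[OF W pos, where s=s]
    unfolding max_variational_def variational_eq_variational_at[OF ac_simplexD(1)[OF W]] Q[symmetric] .
  obtain V where V: "V \<in> ac_simplex P" "\<And>a. V a > 0 \<Longrightarrow> pmf ?Q a > 0"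
      "variational_at P s V (pmf ?Q) = ln (tilt_sum P s ?Q)"
    using ln_tilt_sum_attained[OF S] by blast
  have "ln (tilt_sum P s ?Q) \<le> max_variational P s"
  proof (cases "s > 1")
    case True
    show ?thesis using saddle_point(2)[OF True V(1)] unfolding V(3)[symmetric] Q .
  next
    case False
    then show ?thesis using variational_at_le_variational[OF V(1) _ V(2), where s=s] maximizer(2)[OF V(1), of s]
      unfolding V(3) by simp
  qed
  then show "ln (tilt_sum P s ?Q) = max_variational P s" using ge by simp
qed

lemma kl_div_eq:
  assumes "b > 1" "set_pmf P \<subseteq> set_pmf Q"
  shows "kl_div b P Q = ereal ((\<Sum>a\<in>UNIV. pmf P a * (ln (pmf P a) - ln (pmf Q a))) / ln b)"
proof -
  have "(\<Sum>a\<in>set_pmf P. pmf P a * (log b (pmf P a) - log b (pmf Q a))) =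
    (\<Sum>a\<in>UNIV. pmf P a * (ln (pmf P a) - ln (pmf Q a)) / ln b)"
    by (rule sum.mono_neutral_cong_left) (auto simp: log_def diff_divide_distrib right_diff_distrib set_pmf_iff)
  then show ?thesis using assms by (simp add: kl_div_def sum_divide_distrib)
qed

lemma set_pmf_markov_of: "set_pmf P \<subseteq> set_pmf (markov_of P)"
  using markov_proj_pos[of "pmf P"] by (force simp: set_pmf_iff pmf_markov_of less_le)

lemma kl_div_markov_of:
  assumes "b > 1"
  shows "kl_div b P (markov_of P) = ereal (mutual_info (pmf P) / ln b)"
  using kl_div_eq[OF assms set_pmf_markov_of[of P]]
  by (simp add: mutual_info_eq[OF pmf_in_prob_simplex] pmf_markov_of)

lemma cmi_eq:
  assumes "b > 1"
  shows "cmi b P = ereal (mutual_info (pmf P) / ln b)"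
  using kl_div_markov_of[OF assms, of P] by (simp add: cmi_def markov_of_def)

text \<open>Attainment is \<open>tilt_sum_markov_proj\<close>. Against any other Markov
  distribution, \<open>s > 1\<close> tests the Gibbs principle at the maximiser; for
  \<open>s < 1\<close> the tilted weight shows
  \<open>ln (tilt_sum P s Q) <= max_variational P s\<close>, and division by
  \<open>s - 1 < 0\<close> reverses this. The remaining cases have infinite divergence.\<close>

lemma renyi_cmi_eq:
  assumes b: "b > 1" and s: "s > 0" "s \<noteq> 1"
  shows "renyi_cmi b s P = ereal (max_variational P s / ((s - 1) * ln b))" (is ?A)
    and "\<exists>QY QX QZ. renyi_cmi b s P = renyi_div b s P (markov_pmf QY QX QZ)" (is ?B)
proof -
  let ?W = "maximizer P s"
  have W: "?W \<in> ac_simplex P" by (rule maximizer)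
  obtain QY QX QZ where Q: "pmf (markov_pmf QY QX QZ) = markov_proj ?W"
    using ex_markov_pmf_proj[OF ac_simplexD(1)[OF W]] .
  note t = tilt_sum_markov_proj[OF s(1) Q]
  have eq: "renyi_div b s P (markov_pmf QY QX QZ) = ereal (max_variational P s / ((s - 1) * ln b))"
    using t s by (simp add: renyi_div_eq[OF s(2) b])
  have ge: "ereal (max_variational P s / ((s - 1) * ln b)) \<le> renyi_div b s P (markov_pmf RY RX RZ)" for RY RX RZ
  proof (cases "s > 1")
    case True
    show ?thesis
    proof (cases "set_pmf P \<subseteq> set_pmf (markov_pmf RY RX RZ)")
      case sub: True
      have pos: "pmf (markov_pmf RY RX RZ) a > 0" if "?W a > 0" for a
        using ac_simplexD(4)[OF W that] sub by (auto simp: pmf_positive_iff)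
      have "max_variational P s \<le> ln (tilt_sum P s (markov_pmf RY RX RZ))"
        using variational_le_variational_at[OF W _ pos, where s=s] variational_at_le_ln_tilt_sum(2)[OF W pos, where s=s] True
        by (simp add: max_variational_def)
      then show ?thesis using True sub b by (simp add: renyi_div_eq[OF s(2) b] divide_right_mono)
    qed (use True in \<open>simp add: renyi_div_eq[OF s(2) b]\<close>)
  next
    case False
    then have s1: "s < 1" using s by simp
    show ?thesis
    proof (cases "tilt_sum P s (markov_pmf RY RX RZ) = 0")
      case False
      then have S: "tilt_sum P s (markov_pmf RY RX RZ) > 0" using tilt_sum_nonneg by (simp add: less_le)
      obtain V where V: "V \<in> ac_simplex P" "\<And>a. V a > 0 \<Longrightarrow> pmf (markov_pmf RY RX RZ) a > 0"
          "variational_at P s V (pmf (markov_pmf RY RX RZ)) = ln (tilt_sum P s (markov_pmf RY RX RZ))"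
        using ln_tilt_sum_attained[OF S] by blast
      have "ln (tilt_sum P s (markov_pmf RY RX RZ)) \<le> max_variational P s"
        using variational_at_le_variational[OF V(1) _ V(2), where s=s] maximizer(2)[OF V(1), of s] s1
        unfolding V(3) by simp
      moreover have "(s - 1) * ln b < 0" using s1 b by (simp add: mult_neg_pos)
      ultimately show ?thesis using s1 False by (simp add: renyi_div_eq[OF s(2) b] divide_right_mono_neg)
    qed (use s1 in \<open>simp add: renyi_div_eq[OF s(2) b]\<close>)
  qed
  show ?A by (rule renyi_cmi_eqI(1)[OF ge, of QY QX QZ]) (simp add: eq)
  have "renyi_cmi b s P = renyi_div b s P (markov_pmf QY QX QZ)"
    by (rule renyi_cmi_eqI(2)[OF ge]) (simp add: eq)
  then show ?B by blast
qed

text \<open>At \<open>s = 1\<close> the cross entropy bound with \<open>V = P\<close> suffices, and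
  \<open>markov_of P\<close> attains the minimum.\<close>

lemma renyi_cmi_1_eq:
  assumes b: "b > 1"
  shows "renyi_cmi b 1 P = ereal (mutual_info (pmf P) / ln b)" (is ?A)
    and "\<exists>QY QX QZ. renyi_cmi b 1 P = renyi_div b 1 P (markov_pmf QY QX QZ)" (is ?B)
proof -
  have r: "renyi_div b 1 P Q = kl_div b P Q" for Q by (simp add: renyi_div_def)
  have ge: "ereal (mutual_info (pmf P) / ln b) \<le> renyi_div b 1 P (markov_pmf QY QX QZ)" for QY QX QZ
  proof (cases "set_pmf P \<subseteq> set_pmf (markov_pmf QY QX QZ)")
    case True
    then have pos: "pmf (markov_pmf QY QX QZ) a > 0" if "pmf P a > 0" for a
      using that True by (auto simp: pmf_positive_iff)
    have "mutual_info (pmf P) \<le> (\<Sum>a\<in>UNIV. pmf P a * (ln (pmf P a) - ln (pmf (markov_pmf QY QX QZ) a)))"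
      using markov_cross_entropy_le[OF pmf_in_prob_simplex pos]
      unfolding mutual_info_eq[OF pmf_in_prob_simplex] by (simp add: right_diff_distrib sum_subtractf)
    then show ?thesis unfolding r kl_div_eq[OF b True] using b by (simp add: divide_right_mono)
  qed (simp add: r kl_div_def)
  obtain QY QX QZ where Q: "markov_of P = markov_pmf QY QX QZ" unfolding markov_of_def by blast
  have eq: "renyi_div b 1 P (markov_pmf QY QX QZ) = ereal (mutual_info (pmf P) / ln b)"
    using kl_div_markov_of[OF b, of P] by (simp add: r Q)
  show ?A by (rule renyi_cmi_eqI(1)[OF ge, of QY QX QZ]) (simp add: eq)
  have "renyi_cmi b 1 P = renyi_div b 1 P (markov_pmf QY QX QZ)"
    by (rule renyi_cmi_eqI(2)[OF ge]) (simp add: eq)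
  then show ?B by blast
qed

subsection \<open>Differentiability and the critical rates\<close>

definition js_div :: "('a::finite \<Rightarrow> real) \<Rightarrow> ('a \<Rightarrow> real) \<Rightarrow> real" where
  "js_div V U = ent (\<lambda>a. (V a + U a) / 2) - (ent V + ent U) / 2"

lemma js_div_eq:
  "2 * js_div V U = (\<Sum>a\<in>UNIV. V a * (ln (V a) - ln ((V a + U a) / 2)))
     + (\<Sum>a\<in>UNIV. U a * (ln (U a) - ln ((V a + U a) / 2)))"
proof -
  have M: "2 * ent (\<lambda>a. (V a + U a) / 2) = - (\<Sum>a\<in>UNIV. V a * ln ((V a + U a) / 2)) - (\<Sum>a\<in>UNIV. U a * ln ((V a + U a) / 2))"
  proof -
    have e: "2 * ((v + u) / 2 * l) = v * l + u * l" for v u l :: real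
      by (simp add: field_simps)
    have "2 * (\<Sum>a\<in>UNIV. (V a + U a) / 2 * ln ((V a + U a) / 2))
      = (\<Sum>a\<in>UNIV. V a * ln ((V a + U a) / 2)) + (\<Sum>a\<in>UNIV. U a * ln ((V a + U a) / 2))"
      unfolding sum_distrib_left e sum.distrib ..
    then show ?thesis unfolding ent_def by linarith
  qed
  have "2 * js_div V U = 2 * ent (\<lambda>a. (V a + U a) / 2) - ent V - ent U"
    by (simp add: js_div_def field_simps)
  then show ?thesis unfolding M by (simp add: ent_def right_diff_distrib sum_subtractf)
qed

text \<open>Data processing: the log sum inequality on each fibre of \<open>g\<close>, for both
  relative entropies to the midpoint.\<close>

lemma js_div_marg_le:
  fixes g :: "'a::finite \<Rightarrow> 'b::finite"
  assumes V: "\<And>a. 0 \<le> V a" and U: "\<And>a. 0 \<le> U a"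
  shows "js_div (marg g V) (marg g U) \<le> js_div V U"
proof -
  let ?M = "\<lambda>a. (V a + U a) / 2"
  have M: "(marg g V b + marg g U b) / 2 = sum ?M {a. g a = b}" for b
    by (simp add: marg_def sum.distrib sum_divide_distrib[symmetric])
  have M0: "V a = 0 \<and> U a = 0" if "?M a = 0" for a
    using that V[of a] U[of a] by auto
  have *: "(\<Sum>b\<in>UNIV. marg g W b * (ln (marg g W b) - ln (sum ?M {a. g a = b}))) \<le> (\<Sum>a\<in>UNIV. W a * (ln (W a) - ln (?M a)))"
    if W: "\<And>a. 0 \<le> W a" "\<And>a. ?M a = 0 \<Longrightarrow> W a = 0" for W
  proof -
    have "(\<Sum>b\<in>UNIV. marg g W b * (ln (marg g W b) - ln (sum ?M {a. g a = b})))
      \<le> (\<Sum>b\<in>UNIV. \<Sum>a\<in>{a\<in>UNIV. g a = b}. W a * (ln (W a) - ln (?M a)))"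
      unfolding marg_def using W V U by (intro sum_mono) (simp, intro log_sum_inequality, auto)
    also have "\<dots> = (\<Sum>a\<in>UNIV. W a * (ln (W a) - ln (?M a)))"
      by (rule sum.group) auto
    finally show ?thesis .
  qed
  have "2 * js_div (marg g V) (marg g U) \<le> 2 * js_div V U"
    unfolding js_div_eq M using *[of V] *[of U] V U M0 by (intro add_mono) auto
  then show ?thesis by simp
qed

text \<open>Each term obeys \<open>W - m <= W * (ln W - ln m)\<close>, strictly at a positive
  \<open>W\<close> different from \<open>m\<close>, and the linear parts cancel against the
  midpoint. At \<open>a0\<close> at least the larger of \<open>V a0\<close>, \<open>U a0\<close> is
  positive; when only \<open>U a0\<close> is, strictness for \<open>V a0 = 0\<close> comes from
  \<open>W - m = - m < 0\<close>.\<close>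

lemma js_div_pos:
  assumes V: "V \<in> prob_simplex" and U: "U \<in> prob_simplex" and ne: "V \<noteq> U"
  shows "js_div V U > 0"
proof -
  note nn = prob_simplex_nonneg[OF V] prob_simplex_nonneg[OF U]
  let ?M = "\<lambda>a. (V a + U a) / 2"
  have *: "W - m \<le> W * (ln W - ln m) \<and> (W \<noteq> m \<longrightarrow> W - m < W * (ln W - ln m))"
    if "0 \<le> W" "0 \<le> m" "m = 0 \<longrightarrow> W = 0" for W m :: real
  proof (cases "W = 0 \<or> W = m")
    case False
    then have p: "W > 0" "m > 0" using that by auto
    have "ln (m / W) < m / W - 1"
      using p False ln_le_minus_one[of "m / W"] ln_eq_minus_one[of "m / W"] by (auto simp: less_le)
    then have "W * (ln m - ln W) < W * (m / W - 1)" using p by (simp add: ln_div)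
    also have "\<dots> = m - W" using p by (simp add: field_simps)
    finally have "W - m < W * (ln W - ln m)" by (simp add: algebra_simps)
    then show ?thesis by simp
  qed (use that in auto)
  let ?f = "\<lambda>a. V a * (ln (V a) - ln (?M a)) + U a * (ln (U a) - ln (?M a))"
  obtain a0 where a0: "V a0 \<noteq> U a0" using ne by blast
  have "(\<Sum>a\<in>UNIV. (V a - ?M a) + (U a - ?M a)) < (\<Sum>a\<in>UNIV. ?f a)"
  proof (rule sum_strict_mono_ex1)
    show "\<forall>a\<in>UNIV. (V a - ?M a) + (U a - ?M a) \<le> ?f a"
    proof
      fix a show "(V a - ?M a) + (U a - ?M a) \<le> ?f a"
        using *[of "V a" "?M a"] *[of "U a" "?M a"] nn[of a] by (intro add_mono) auto
    qed
    show "\<exists>a\<in>UNIV. (V a - ?M a) + (U a - ?M a) < ?f a"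
    proof (rule bexI[of _ a0])
      have "V a0 - ?M a0 < V a0 * (ln (V a0) - ln (?M a0))"
        using *[of "V a0" "?M a0"] nn[of a0] a0 by auto
      moreover have "U a0 - ?M a0 \<le> U a0 * (ln (U a0) - ln (?M a0))"
        using *[of "U a0" "?M a0"] nn[of a0] by auto
      ultimately show "(V a0 - ?M a0) + (U a0 - ?M a0) < ?f a0" by (rule add_less_le_mono)
    qed simp
  qed simp
  moreover have "(\<Sum>a\<in>UNIV. (V a - ?M a) + (U a - ?M a)) = 0"
    by (rule sum.neutral) auto
  ultimately have "2 * js_div V U > 0" unfolding js_div_eq by (simp add: sum.distrib)
  then show ?thesis by simp
qed

lemma js_div_nonneg: 
  assumes "V \<in> prob_simplex" "U \<in> prob_simplex" shows "0 \<le> js_div V U"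
proof (cases "V = U")
  case True then show ?thesis by (simp add: js_div_def)
qed (use js_div_pos[OF assms] in simp)

text \<open>
  The midpoint gap of \<open>variational P s\<close> is \<open>J + (s - 1) (J_XY + J_YZ - J_Y)\<close> in terms of
  Jensen-Shannon divergences. By data processing the bracket lies between \<open>0\<close> and \<open>2 J\<close>, so
  \<open>s > 1/2\<close> suffices for a positive gap.
\<close>

lemma maximizer_unique:
  assumes s: "s > 1/2" and V: "V \<in> ac_simplex P" and max: "max_variational P s \<le> variational P s V"
  shows "V = maximizer P s"
proof (rule ccontr)
  assume ne: "V \<noteq> maximizer P s"
  define U where "U = maximizer P s"
  define M where "M = (\<lambda>a. (V a + U a) / 2)"
  have U: "U \<in> ac_simplex P" by (simp add: U_def maximizer)
  note Vd = ac_simplexD[OF V] and Ud = ac_simplexD[OF U]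
  have M: "M \<in> ac_simplex P" using mix_in_ac_simplex[OF V U, of "1/2"] by (simp add: M_def add_divide_distrib)
  define J where "J = js_div V U"
  define JXY where "JXY = js_div (marg pXY V) (marg pXY U)"
  define JYZ where "JYZ = js_div (marg snd V) (marg snd U)"
  define JY where "JY = js_div (marg pY V) (marg pY U)"
  have pc: "pY = snd \<circ> pXY" "pY = fst \<circ> snd"
    by (auto simp: fun_eq_iff pY_def pXY_def)
  have "JXY \<le> J" "JYZ \<le> J" unfolding JXY_def JYZ_def J_def
    by (intro js_div_marg_le Vd Ud)+
  moreover have "JY \<le> JXY"
    unfolding JXY_def JY_def pc(1) marg_marg[symmetric] by (intro js_div_marg_le marg_nonneg Vd Ud)
  moreover have "JY \<le> JYZ"
    unfolding JYZ_def JY_def pc(2) marg_marg[symmetric] by (intro js_div_marg_le marg_nonneg Vd Ud)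
  moreover have "0 \<le> JY" unfolding JY_def by (intro js_div_nonneg marg_in_prob_simplex Vd Ud)
  moreover have "0 < J" unfolding J_def using ne by (intro js_div_pos Vd Ud) (simp add: U_def)
  moreover have "variational P s M - (variational P s V + variational P s U) / 2 = (s - 1) * (JXY + JYZ - JY) + J"
  proof -
    have mg: "marg g M = (\<lambda>b. (marg g V b + marg g U b) / 2)" for g :: "'a \<times> 'b \<times> 'c \<Rightarrow> 'd"
      by (auto simp: M_def marg_def fun_eq_iff sum.distrib sum_divide_distrib[symmetric])
    have mi: "mutual_info M - (mutual_info V + mutual_info U) / 2 = JXY + JYZ - JY - J"
      unfolding mutual_info_def mg JXY_def JYZ_def JY_def J_def js_div_def M_def[symmetric] by (simp add: field_simps)
    have "(\<Sum>a\<in>UNIV. M a * ln (pmf P a)) = ((\<Sum>a\<in>UNIV. V a * ln (pmf P a)) + (\<Sum>a\<in>UNIV. U a * ln (pmf P a))) / 2"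
      unfolding M_def by (simp add: sum.distrib[symmetric] sum_divide_distrib algebra_simps)
    then have re: "rel_ent M P - (rel_ent V P + rel_ent U P) / 2 = - J"
      unfolding rel_ent_eq J_def js_div_def by (simp add: M_def field_simps)
    have "variational P s M - (variational P s V + variational P s U) / 2 = (s - 1) * (mutual_info M - (mutual_info V + mutual_info U) / 2)
       - s * (rel_ent M P - (rel_ent V P + rel_ent U P) / 2)"
      unfolding variational_def by (simp add: field_simps)
    then show ?thesis unfolding mi re by (simp add: algebra_simps)
  qed
  moreover note facts = calculation
  have "(s - 1) * (JXY + JYZ - JY) + J > 0"
  proof (cases "s \<ge> 1")
    case True
    then have "0 \<le> (s - 1) * (JXY + JYZ - JY)" using facts by (intro mult_nonneg_nonneg) auto
    then show ?thesis using facts by linarith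
  next
    case False
    then have "(1 - s) * (JXY + JYZ - JY) \<le> (1 - s) * (2 * J)"
      using facts by (intro mult_left_mono) auto
    also have "\<dots> < J" using mult_pos_pos[of J "2 * s - 1"] s facts by (simp add: algebra_simps)
    finally show ?thesis by (simp add: algebra_simps)
  qed
  ultimately have "variational P s M > (variational P s V + variational P s U) / 2" by linarith
  then have "variational P s M > max_variational P s" using max by (simp add: U_def max_variational_def)
  then show False using maximizer(2)[OF M, of s] by simp
qed

section \<open>Dependence of the maximum and the maximiser on \<open>s\<close>\<close>

definition slope :: "('x::finite \<times> 'y::finite \<times> 'z::finite) pmf \<Rightarrow> ('x \<times> 'y \<times> 'z \<Rightarrow> real) \<Rightarrow> real" where
  "slope P V = mutual_info V - rel_ent V P"

text \<open>For fixed \<open>V\<close> the functional is affine in \<open>s\<close>, with this slope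
  and with value \<open>- mutual_info V\<close> at \<open>s = 0\<close>.\<close>

lemma variational_diff: "variational P t V - variational P s V = (t - s) * slope P V"
  by (simp add: variational_def slope_def algebra_simps)

lemma continuous_on_mi_ac: "continuous_on (ac_simplex P) mutual_info"
  by (rule continuous_on_subset[OF continuous_on_mutual_info ac_simplex_subset])

lemma continuous_on_slope: "continuous_on (ac_simplex P) (slope P)"
  unfolding slope_def
  by (intro continuous_intros continuous_on_mi_ac continuous_on_subset[OF continuous_on_rel_ent ac_simplex_subset])

lemma slope_bounded: obtains B where "\<And>V. V \<in> ac_simplex P \<Longrightarrow> \<bar>slope P V\<bar> \<le> B"
proof -
  have "bounded (slope P ` ac_simplex P)"
    by (intro compact_imp_bounded compact_continuous_image continuous_on_slope compact_ac_simplex)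
  then show ?thesis using that by (auto simp: bounded_iff)
qed

text \<open>The \<open>V\<close> whose \<open>h\<close>-value is off by at least \<open>e\<close>
  form a compact set \<open>C\<close>, on which, by uniqueness, the functional stays below its
  maximum by a fixed margin. Moving from \<open>s\<close> to \<open>t\<close> changes it by at most
  \<open>|t - s| * B\<close>, once at each of the two maximisers, so the maximiser at
  \<open>t\<close> avoids \<open>C\<close>.\<close>

lemma tendsto_maximizer:
  fixes h :: "('x::finite \<times> 'y::finite \<times> 'z::finite \<Rightarrow> real) \<Rightarrow> real"
  assumes s: "s > 1/2" and h: "continuous_on (ac_simplex P) h"
  shows "((\<lambda>t. h (maximizer P t)) \<longlongrightarrow> h (maximizer P s)) (at s)"
proof (rule tendstoI)
  fix e :: real assume e: "e > 0"
  let ?K = "ac_simplex P" and ?V = "maximizer P"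
  define C where "C = ?K \<inter> h -` (- ball (h (?V s)) e)"
  have "closed C" unfolding C_def
    by (rule continuous_closed_preimage[OF h compact_imp_closed[OF compact_ac_simplex]]) auto
  moreover have "?K \<inter> C = C" by (auto simp: C_def)
  ultimately have C: "compact C" using compact_Int_closed[OF compact_ac_simplex[of P], of C] by simp
  have "\<exists>c<max_variational P s. \<forall>V\<in>C. variational P s V \<le> c"
  proof (cases "C = {}")
    case True then show ?thesis by (auto intro!: exI[of _ "max_variational P s - 1"])
  next
    case False
    have "continuous_on C (variational P s)" by (rule continuous_on_subset[OF continuous_on_variational]) (simp add: C_def)
    from continuous_attains_sup[OF C False this] obtain V' where V': "V' \<in> C" "\<forall>V\<in>C. variational P s V \<le> variational P s V'"
      by blast
    have "V' \<noteq> ?V s" using V'(1) e by (auto simp: C_def)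
    then have "variational P s V' < max_variational P s"
      using maximizer_unique[OF s, of V' P] V'(1) by (force simp: C_def)
    then show ?thesis using V'(2) by blast
  qed
  then obtain c where c: "c < max_variational P s" "\<And>V. V \<in> C \<Longrightarrow> variational P s V \<le> c" by blast
  obtain B where B: "\<And>V. V \<in> ?K \<Longrightarrow> \<bar>slope P V\<bar> \<le> B" using slope_bounded[of P] by blast
  have B0: "0 \<le> B" using B[OF pmf_in_ac_simplex] by (meson abs_ge_zero order_trans)
  have "((\<lambda>t. \<bar>t - s\<bar> * (2 * B)) \<longlongrightarrow> \<bar>s - s\<bar> * (2 * B)) (at s)" by (intro tendsto_intros)
  then have "eventually (\<lambda>t. \<bar>t - s\<bar> * (2 * B) < max_variational P s - c) (at s)"
    using c(1) by (intro order_tendstoD(2)) auto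
  then show "eventually (\<lambda>t. dist (h (?V t)) (h (?V s)) < e) (at s)"
  proof eventually_elim
    case (elim t)
    have d: "\<bar>variational P t V - variational P s V\<bar> \<le> \<bar>t - s\<bar> * B" if "V \<in> ?K" for V
      unfolding variational_diff abs_mult using B[OF that] by (intro mult_left_mono) auto
    have "variational P t (?V s) \<le> variational P t (?V t)" using maximizer(2)[OF maximizer(1)[of P s], of t] by (simp add: max_variational_def)
    then have "variational P s (?V t) > c"
      using d[OF maximizer(1)[of P s]] d[OF maximizer(1)[of P t]] elim by (simp add: max_variational_def)
    then have "?V t \<notin> C" using c(2) by force
    then show ?case using maximizer(1)[of P t] by (simp add: C_def dist_commute)
  qed
qed

text \<open>Envelope argument: inserting each maximiser into the other problem traps the difference
  quotient between the slopes at the two maximisers, which merge by continuity.\<close>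

lemma has_derivative_max_variational:
  assumes s: "s > 1/2"
  shows "(max_variational P has_real_derivative slope P (maximizer P s)) (at s)"
  unfolding has_field_derivative_iff
proof (rule LIM_zero_cancel, rule Lim_null_comparison)
  let ?V = "maximizer P"
  show "((\<lambda>t. \<bar>slope P (?V t) - slope P (?V s)\<bar>) \<longlongrightarrow> 0) (at s)"
    using tendsto_maximizer[OF s continuous_on_slope] by (intro tendsto_rabs_zero LIM_zero)
  show "eventually (\<lambda>t. norm ((max_variational P t - max_variational P s) / (t - s) - slope P (?V s)) \<le> \<bar>slope P (?V t) - slope P (?V s)\<bar>) (at s)"
    unfolding eventually_at_filter
  proof (intro always_eventually allI impI)
    fix t :: real assume ts: "t \<noteq> s"
    have 1: "(t - s) * slope P (?V s) \<le> max_variational P t - max_variational P s"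
      using variational_diff[of P t "?V s" s] maximizer(2)[OF maximizer(1)[of P s], of t] by (simp add: max_variational_def)
    have 2: "max_variational P t - max_variational P s \<le> (t - s) * slope P (?V t)"
      using variational_diff[of P t "?V t" s] maximizer(2)[OF maximizer(1)[of P t], of s] by (simp add: max_variational_def)
    have "\<bar>max_variational P t - max_variational P s - (t - s) * slope P (?V s)\<bar> \<le> \<bar>(t - s) * slope P (?V t) - (t - s) * slope P (?V s)\<bar>"
      using 1 2 by linarith
    also have "\<dots> = \<bar>slope P (?V t) - slope P (?V s)\<bar> * \<bar>t - s\<bar>"
      by (simp add: right_diff_distrib[symmetric] abs_mult)
    finally have "\<bar>max_variational P t - max_variational P s - (t - s) * slope P (?V s)\<bar> / \<bar>t - s\<bar> \<le> \<bar>slope P (?V t) - slope P (?V s)\<bar>"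
      using ts by (simp add: divide_le_eq)
    moreover have "(max_variational P t - max_variational P s) / (t - s) - slope P (?V s) = (max_variational P t - max_variational P s - (t - s) * slope P (?V s)) / (t - s)"
      using ts by (simp add: field_simps)
    ultimately show "norm ((max_variational P t - max_variational P s) / (t - s) - slope P (?V s)) \<le> \<bar>slope P (?V t) - slope P (?V s)\<bar>"
      by (simp add: abs_divide)
  qed
qed

lemma rel_ent_nonneg:
  assumes V: "V \<in> ac_simplex P" shows "0 \<le> rel_ent V P"
proof -
  have "(\<Sum>a\<in>UNIV. V a * (ln (pmf P a) - ln (V a))) \<le> ln (sum (pmf P) UNIV)"
    using V ac_simplexD[OF V] by (intro gibbs_inequality) (auto simp: ac_simplex_def)
  then show ?thesis by (simp add: rel_ent_def sum_pmf_eq_1 algebra_simps sum_subtractf)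
qed

lemma rel_ent_self: "rel_ent (pmf P) P = 0"
  by (simp add: rel_ent_def)

text \<open>At \<open>s = 1\<close> the functional is \<open>- rel_ent V P\<close>.\<close>

lemma maximizer_1: "maximizer P 1 = pmf P" and max_variational_1: "max_variational P 1 = 0"
proof -
  have "variational P 1 (pmf P) = 0" by (simp add: variational_def rel_ent_self)
  moreover have "max_variational P 1 \<le> 0" using rel_ent_nonneg[OF maximizer(1)[of P 1]] by (simp add: max_variational_def variational_def)
  ultimately show "maximizer P 1 = pmf P" "max_variational P 1 = 0"
    using maximizer_unique[OF _ pmf_in_ac_simplex, of 1 P] maximizer(2)[OF pmf_in_ac_simplex, of P 1] by auto
qed

text \<open>Add the two optimality inequalities with weights \<open>t\<close> and \<open>s\<close>:
  the relative entropies cancel.\<close>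

lemma mutual_info_maximizer_mono:
  assumes st: "0 < s" "s \<le> t"
  shows "mutual_info (maximizer P s) \<le> mutual_info (maximizer P t)"
proof (cases "s = t")
  case False
  then have st': "s < t" using st by simp
  define I I' D D' where "I = mutual_info (maximizer P s)" "I' = mutual_info (maximizer P t)"
    "D = rel_ent (maximizer P s) P" "D' = rel_ent (maximizer P t) P"
  note d = I_I'_D_D'_def
  have "(s - 1) * I' - s * D' \<le> (s - 1) * I - s * D" "(t - 1) * I - t * D \<le> (t - 1) * I' - t * D'"
    using maximizer(2)[OF maximizer(1)[of P t], of s] maximizer(2)[OF maximizer(1)[of P s], of t]
    by (simp_all add: d max_variational_def variational_def)
  then have "t * ((s - 1) * I' - s * D') + s * ((t - 1) * I - t * D) \<le> t * ((s - 1) * I - s * D) + s * ((t - 1) * I' - t * D')"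
    using st st' by (intro add_mono mult_left_mono) auto
  then have "(t - s) * I \<le> (t - s) * I'" by (simp add: algebra_simps)
  then show ?thesis using st' by (simp add: d)
qed simp

text \<open>
  In units of \<open>ln b\<close>, this is the term with index \<open>s\<close> in both suprema of the theorem:
  \<open>(1 - s) / s * (I_s - r) = (s - 1) / s * (r - I_s)\<close>.
\<close>

definition exponent_at :: "('x::finite \<times> 'y::finite \<times> 'z::finite) pmf \<Rightarrow> real \<Rightarrow> real \<Rightarrow> real" where
  "exponent_at P r s = ((s - 1) * r - max_variational P s) / s"

text \<open>The correction is nonpositive if \<open>s < 1\<close> and
  \<open>mutual_info V <= r\<close>, so the exponent is then a lower bound for the relative entropy;
  at \<open>V = maximizer P s\<close> equality holds.\<close>

lemma exponent_at_le:
  assumes "V \<in> ac_simplex P" "s > 0"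
  shows "exponent_at P r s \<le> rel_ent V P + (s - 1) / s * (r - mutual_info V)"
proof -
  have "(s - 1) * r - max_variational P s \<le> (s - 1) * r - variational P s V" using maximizer(2)[OF assms(1)] by simp
  then have "exponent_at P r s \<le> ((s - 1) * r - variational P s V) / s"
    unfolding exponent_at_def using assms(2) by (simp add: divide_right_mono)
  also have "\<dots> = rel_ent V P + (s - 1) / s * (r - mutual_info V)"
    using assms(2) by (simp add: variational_def field_simps)
  finally show ?thesis .
qed

lemma exponent_at_maximizer:
  assumes "s > 0"
  shows "exponent_at P r s = rel_ent (maximizer P s) P + (s - 1) / s * (r - mutual_info (maximizer P s))"
  using assms by (simp add: exponent_at_def max_variational_def variational_def field_simps)

lemma isCont_mutual_info_maximizer:
  "s > 1/2 \<Longrightarrow> isCont (\<lambda>t. mutual_info (maximizer P t)) s"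
  unfolding isCont_def by (rule tendsto_maximizer[OF _ continuous_on_mi_ac])

lemma tendsto_exponent_at_1: "(exponent_at P r \<longlongrightarrow> 0) (at 1)"
proof -
  have "isCont (max_variational P) 1" by (rule DERIV_isCont[OF has_derivative_max_variational]) simp
  then have "(exponent_at P r \<longlongrightarrow> ((1 - 1) * r - max_variational P 1) / 1) (at 1)"
    unfolding exponent_at_def isCont_def by (intro tendsto_intros) auto
  then show ?thesis by (simp add: max_variational_1)
qed

text \<open>If \<open>P\<close> itself has information below \<open>r\<close>, then
  \<open>V = P\<close> costs nothing and the exponent tends to \<open>0\<close> as \<open>s\<close>
  tends to 1. Otherwise the intermediate value theorem on \<open>s0..1\<close> yields a maximiser
  with information just below \<open>r\<close>.\<close>

lemma exponent_approx_below:
  assumes s0: "s0 > 2/3" "mutual_info (maximizer P s0) < r" and e: "e > 0"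
  obtains V s where "V \<in> ac_simplex P" "mutual_info V < r" "2/3 < s" "s < 1" "rel_ent V P \<le> exponent_at P r s + e"
proof (cases "mutual_info (pmf P) < r")
  case True
  have "(exponent_at P r \<longlongrightarrow> 0) (at_left 1)"
    using tendsto_exponent_at_1 by (rule tendsto_within_subset) auto
  then have "eventually (\<lambda>s. -e < exponent_at P r s) (at_left 1)" using e by (intro order_tendstoD(1)) auto
  moreover have "eventually (\<lambda>s. s \<in> {2/3<..<1::real}) (at_left 1)" by (rule eventually_at_leftI[of "2/3"]) auto
  ultimately have "eventually (\<lambda>s. -e < exponent_at P r s \<and> s \<in> {2/3<..<1}) (at_left 1)"
    by eventually_elim auto
  then obtain s where "-e < exponent_at P r s" "s \<in> {2/3<..<1}"
    using eventually_happens[of _ "at_left (1::real)"] by (auto simp: trivial_limit_at_left_real)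
  then show ?thesis using that[OF pmf_in_ac_simplex True, of s] by (simp add: rel_ent_self)
next
  case False
  let ?h = "\<lambda>s. mutual_info (maximizer P s)"
  have s01: "s0 < 1"
  proof (rule ccontr)
    assume "\<not> s0 < 1"
    then have "?h 1 \<le> ?h s0" by (intro mutual_info_maximizer_mono) auto
    then show False using False s0 by (simp add: maximizer_1)
  qed
  \<comment> \<open>Strictly below \<open>r\<close>, as the conclusion demands, but within
    \<open>e\<close> of it, so that the correction in \<open>exponent_at_maximizer\<close> costs at
    most \<open>e\<close>.\<close>
  define r' where "r' = (max (?h s0) (r - e) + r) / 2"
  have r': "?h s0 < r'" "r - e < r'" "r' < r" using s0 e by (auto simp: r'_def max_def)
  have "\<exists>s. s0 \<le> s \<and> s \<le> 1 \<and> ?h s = r'"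
  proof (rule IVT)
    show "\<forall>x. s0 \<le> x \<and> x \<le> 1 \<longrightarrow> isCont ?h x"
    proof (intro allI impI)
      fix x assume "s0 \<le> x \<and> x \<le> 1"
      then have "x > 1/2" using s0 by linarith
      then show "isCont ?h x" by (rule isCont_mutual_info_maximizer)
    qed
  qed (use r' s01 False in \<open>auto simp: maximizer_1\<close>)
  then obtain s where s: "s0 \<le> s" "s \<le> 1" "?h s = r'" by blast
  have "s \<noteq> 1" using s(3) False r' by (auto simp: maximizer_1)
  then have s1: "s < 1" using s by simp
  \<comment> \<open>The factor is at most 1 because \<open>s >= 1/2\<close>.\<close>
  have "(1 - s) / s \<le> 1" "0 \<le> (1 - s) / s" using s s0 s1 by (auto simp: field_simps)
  then have "(1 - s) / s * (r - r') \<le> 1 * e" using r' by (intro mult_mono) auto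
  moreover have "(s - 1) / s * (r - r') = - ((1 - s) / s * (r - r'))"
    using s s0 by (simp add: field_simps)
  ultimately have "rel_ent (maximizer P s) P \<le> exponent_at P r s + e"
    using exponent_at_maximizer[of s P r] s s0 by simp
  then show ?thesis using that[OF maximizer(1)[of P s], of s] s s0 s1 r' by simp
qed

text \<open>Mirror image of \<open>exponent_approx_below\<close>: \<open>s\<close> approaches 1 from
  above, or is found between 1 and \<open>s0\<close> with information just above
  \<open>r\<close>.\<close>

lemma exponent_approx_above:
  assumes s0: "s0 > 0" "r < mutual_info (maximizer P s0)" and e: "e > 0"
  obtains V s where "V \<in> ac_simplex P" "r < mutual_info V" "1 < s" "rel_ent V P \<le> exponent_at P r s + e"
proof (cases "r < mutual_info (pmf P)")
  case True
  have "(exponent_at P r \<longlongrightarrow> 0) (at_right 1)"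
    using tendsto_exponent_at_1 by (rule tendsto_within_subset) auto
  then have "eventually (\<lambda>s. -e < exponent_at P r s) (at_right 1)" using e by (intro order_tendstoD(1)) auto
  moreover have "eventually (\<lambda>s. s \<in> {1<..<2::real}) (at_right 1)" by (rule eventually_at_rightI[of _ 2]) auto
  ultimately have "eventually (\<lambda>s. -e < exponent_at P r s \<and> s \<in> {1<..<2}) (at_right 1)"
    by eventually_elim auto
  then obtain s where "-e < exponent_at P r s" "s \<in> {1<..<2}"
    using eventually_happens[of _ "at_right (1::real)"] by (auto simp: trivial_limit_at_right_real)
  then show ?thesis using that[OF pmf_in_ac_simplex True, of s] by (simp add: rel_ent_self)
next
  case False
  let ?h = "\<lambda>s. mutual_info (maximizer P s)"
  have s01: "1 < s0"
  proof (rule ccontr)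
    assume "\<not> 1 < s0"
    then have "?h s0 \<le> ?h 1" using s0 by (intro mutual_info_maximizer_mono) auto
    then show False using False s0 by (simp add: maximizer_1)
  qed
  define r' where "r' = (min (?h s0) (r + e) + r) / 2"
  have r': "r' < ?h s0" "r' < r + e" "r < r'" using s0 e by (auto simp: r'_def min_def)
  have "\<exists>s. 1 \<le> s \<and> s \<le> s0 \<and> ?h s = r'"
  proof (rule IVT)
    show "\<forall>x. 1 \<le> x \<and> x \<le> s0 \<longrightarrow> isCont ?h x"
    proof (intro allI impI)
      fix x assume "1 \<le> x \<and> x \<le> s0"
      then have "x > 1/2" using s0 by linarith
      then show "isCont ?h x" by (rule isCont_mutual_info_maximizer)
    qed
  qed (use r' s01 False in \<open>auto simp: maximizer_1\<close>)
  then obtain s where s: "1 \<le> s" "s \<le> s0" "?h s = r'" by blast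
  have "s \<noteq> 1" using s(3) False r' by (auto simp: maximizer_1)
  then have s1: "1 < s" using s by simp
  have "(s - 1) / s \<le> 1" "0 \<le> (s - 1) / s" using s1 by (auto simp: field_simps)
  then have "(s - 1) / s * (r' - r) \<le> 1 * e" using r' by (intro mult_mono) auto
  moreover have "(s - 1) / s * (r - r') = - ((s - 1) / s * (r' - r))"
    by (metis minus_diff_eq mult_minus_right)
  ultimately have "rel_ent (maximizer P s) P \<le> exponent_at P r s + e"
    using exponent_at_maximizer[of s P r] s s1 by simp
  then show ?thesis using that[OF maximizer(1)[of P s], of s] s s1 r' by simp
qed

section \<open>Derivative of \<open>phi\<close> and existence of the critical rates\<close>

lemma phi_eq_max_variational:
  assumes "b > 1" "s > 0"
  shows "phi b P s = max_variational P s / ln b"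
proof (cases "s = 1")
  case True then show ?thesis by (simp add: phi_def max_variational_1)
next
  case False
  then show ?thesis using renyi_cmi_eq(1)[OF assms False, of P] by (simp add: phi_def)
qed

lemma phi_has_derivative:
  assumes b: "b > 1" and s: "s > 1/2"
  shows "(phi b P has_real_derivative slope P (maximizer P s) / ln b) (at s)"
\<comment> \<open>\<open>phi\<close> has been identified for positive arguments only; the ball of
  radius \<open>s\<close> about \<open>s\<close> contains no others.\<close>
proof (rule has_field_derivative_transform_within[of "\<lambda>s. max_variational P s / ln b" _ s UNIV s])
  show "((\<lambda>s. max_variational P s / ln b) has_real_derivative slope P (maximizer P s) / ln b) (at s)"
    by (intro DERIV_cdivide has_derivative_max_variational s)
  fix t assume "dist t s < s"
  then have "t > 0" by (simp add: dist_real_def)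
  then show "max_variational P t / ln b = phi b P t" by (simp add: phi_eq_max_variational[OF b])
qed (use s in auto)

text \<open>The tangent of \<open>max_variational\<close> at \<open>s\<close> is the affine function
  of \<open>V_s\<close>, whose intercept is \<open>- mutual_info V_s\<close>.\<close>

lemma critical_rate_eq:
  assumes b: "b > 1" and s: "s > 1/2"
  shows "critical_rate b P s = ereal (mutual_info (maximizer P s) / ln b)"
proof -
  have "deriv (phi b P) s = slope P (maximizer P s) / ln b"
    by (rule DERIV_imp_deriv[OF phi_has_derivative[OF assms]])
  moreover have "s * slope P (maximizer P s) - max_variational P s = mutual_info (maximizer P s)"
    by (simp add: max_variational_def variational_def slope_def algebra_simps)
  ultimately show ?thesis using b s
    by (simp add: critical_rate_def phi_eq_max_variational diff_divide_distrib[symmetric])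
qed

lemma critical_rate_mono:
  assumes b: "b > 1" and s: "s > 1/2" "s \<le> t"
  shows "critical_rate b P s \<le> critical_rate b P t"
  using mutual_info_maximizer_mono[of s t P] assms by (simp add: critical_rate_eq divide_right_mono)

text \<open>Monotonicity gives convergence to the infimum, taken in the extended reals so that it
  always exists; only then does \<open>Lim\<close> in \<open>R_two_thirds\<close> denote a
  limit.\<close>

lemma tendsto_R_two_thirds:
  assumes b: "b > 1"
  shows "(critical_rate b P \<longlongrightarrow> R_two_thirds b P) (at_right (2/3))"
proof -
  let ?L = "INF s\<in>{2/3<..}. critical_rate b P s"
  have "(critical_rate b P \<longlongrightarrow> ?L) (at_right (2/3))"
  proof (rule order_tendstoI)
    fix a assume a: "a < ?L"
    show "eventually (\<lambda>s. a < critical_rate b P s) (at_right (2/3))"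
    proof (rule eventually_at_rightI[of _ 1])
      fix s :: real assume "s \<in> {2/3<..<1}"
      then have "?L \<le> critical_rate b P s" by (intro INF_lower) auto
      then show "a < critical_rate b P s" using a by simp
    qed simp
  next
    fix a assume "?L < a"
    then obtain s where s: "s > 2/3" "critical_rate b P s < a" by (auto simp: INF_less_iff)
    show "eventually (\<lambda>s. critical_rate b P s < a) (at_right (2/3))"
    proof (rule eventually_at_rightI[of _ s])
      fix t assume "t \<in> {2/3<..<s}"
      then have "critical_rate b P t \<le> critical_rate b P s" by (intro critical_rate_mono[OF b]) auto
      then show "critical_rate b P t < a" using s(2) by simp
    qed (use s in simp)
  qed
  then show ?thesis unfolding R_two_thirds_def by (simp add: tendsto_Lim)
qed

lemma tendsto_R_infinity:
  assumes b: "b > 1"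
  shows "(critical_rate b P \<longlongrightarrow> R_infinity b P) at_top"
proof -
  let ?L = "SUP s\<in>{1<..}. critical_rate b P s"
  have "(critical_rate b P \<longlongrightarrow> ?L) at_top"
  proof (rule order_tendstoI)
    fix a assume "a < ?L"
    then obtain s where s: "s > 1" "a < critical_rate b P s" by (auto simp: less_SUP_iff)
    show "eventually (\<lambda>s. a < critical_rate b P s) at_top"
      using eventually_ge_at_top[of s]
    proof eventually_elim
      case (elim t)
      then show ?case using critical_rate_mono[OF b, of s t P] s by auto
    qed
  next
    fix a assume a: "?L < a"
    show "eventually (\<lambda>s. critical_rate b P s < a) at_top"
      using eventually_gt_at_top[of 1]
    proof eventually_elim
      case (elim s)
      then have "critical_rate b P s \<le> ?L" by (intro SUP_upper) auto
      then show ?case using a by simp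
    qed
  qed
  then show ?thesis unfolding R_infinity_def by (simp add: tendsto_Lim)
qed

subsection \<open>Words and product weights\<close>

lemma sum_words_Suc:
  "(\<Sum>w\<in>words (Suc n). f w) = (\<Sum>a\<in>UNIV. \<Sum>w\<in>words n. f (a # w))" for f :: "'a::finite list \<Rightarrow> real"
proof -
  have eq: "words (Suc n) = (\<lambda>(a, w). a # w) ` (UNIV \<times> words n)"
    by (auto simp: words_def length_Suc_conv image_def)
  have "(\<Sum>w\<in>words (Suc n). f w) = (\<Sum>(a, w)\<in>UNIV \<times> words n. f (a # w))"
    unfolding eq by (subst sum.reindex) (auto simp: inj_on_def split_beta prod_eq_iff)
  then show ?thesis by (simp add: sum.cartesian_product)
qed

lemma words_0: "words 0 = {[]}" by (auto simp: words_def)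

text \<open>Arbitrary real weights, so that the unnormalised tilted weights are covered too.\<close>

definition iid :: "('a \<Rightarrow> real) \<Rightarrow> 'a list \<Rightarrow> real" where
  "iid f w = prod_list (map f w)"

lemma iid_simps [simp]: "iid f [] = 1" "iid f (a # w) = f a * iid f w"
  by (simp_all add: iid_def)

lemma iid_nonneg: "(\<And>a. 0 \<le> f a) \<Longrightarrow> 0 \<le> iid f w"
  by (induction w) auto

lemma sum_iid: "(\<Sum>w\<in>words n. iid f w) = (\<Sum>a\<in>UNIV. f a) ^ n" for f :: "'a::finite \<Rightarrow> real"
  by (induction n) (simp_all add: words_0 sum_words_Suc sum_distrib_left[symmetric] sum_distrib_right[symmetric])

lemma iid_cong_mset: "mset w = mset w' \<Longrightarrow> iid f w = iid f w'"
  unfolding iid_def prod_mset_prod_list[symmetric] mset_map by simp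

lemma iid_eq_exp:
  "(\<And>a. a \<in> set w \<Longrightarrow> f a > 0) \<Longrightarrow> iid f w = exp (sum_list (map (\<lambda>a. ln (f a)) w))"
  by (induction w) (auto simp: exp_add)

lemma iid_eq_0: "a \<in> set w \<Longrightarrow> f a = 0 \<Longrightarrow> iid f w = 0"
  by (induction w) auto

lemma iid_pos: "(\<And>a. a \<in> set w \<Longrightarrow> f a > 0) \<Longrightarrow> iid f w > 0"
  by (induction w) auto

lemma pmf_replicate_pmf:
  "pmf (replicate_pmf (length w) P) w = iid (pmf P) w"
proof (induction w)
  case (Cons a w)
  have "replicate_pmf (length (a # w)) P = map_pmf (\<lambda>(x, xs). x # xs) (pair_pmf P (replicate_pmf (length w) P))"
    by (simp add: pair_pmf_def map_bind_pmf)
  moreover have "inj (\<lambda>(x::'a, xs). x # xs)" by (auto simp: inj_def)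
  ultimately show ?case
    using pmf_map_inj'[of "\<lambda>(x, xs). x # xs" "pair_pmf P (replicate_pmf (length w) P)" "(a, w)"]
    by (simp add: pmf_pair Cons)
qed simp

lemma pmf_replicate_words: "w \<in> words n \<Longrightarrow> pmf (replicate_pmf n P) w = iid (pmf P) w"
  using pmf_replicate_pmf[of w P] by (auto simp: words_def)

lemma set_replicate_pmf_subset: "set_pmf (replicate_pmf n P) \<subseteq> words n"
  by (auto simp: set_replicate_pmf words_def)

subsection \<open>Empirical distributions\<close>

definition emp :: "'a list \<Rightarrow> 'a \<Rightarrow> real" where
  "emp w a = real (count (mset w) a) / real (length w)"

lemma sum_count_mult: "(\<Sum>a\<in>UNIV. real (count (mset w) a) * g a) = sum_list (map g w)" for g :: "'a::finite \<Rightarrow> real"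
proof (induction w)
  case (Cons x w)
  have "(\<Sum>a\<in>UNIV. real (count (mset (x # w)) a) * g a)
     = (\<Sum>a\<in>UNIV. (if a = x then g a else 0) + real (count (mset w) a) * g a)"
    by (intro sum.cong) (auto simp: algebra_simps)
  then show ?case using Cons by (simp add: sum.distrib)
qed simp

lemma sum_emp_mult: "(\<Sum>a\<in>UNIV. emp w a * g a) = sum_list (map g w) / real (length w)" for g :: "'a::finite \<Rightarrow> real"
  unfolding sum_count_mult[symmetric] emp_def by (simp add: sum_divide_distrib)

lemma emp_in_prob_simplex: "w \<noteq> [] \<Longrightarrow> emp w \<in> prob_simplex" for w :: "'a::finite list"
  using sum_emp_mult[of w "\<lambda>_. 1"] by (auto simp: prob_simplex_def emp_def sum_list_triv)

lemma marg_emp: "marg g (emp w) = emp (map g w)" for g :: "'a::finite \<Rightarrow> 'b"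
proof
  fix b
  have "(\<Sum>a | g a = b. count (mset w) a) = count (mset (map g w)) b"
  proof (induction w)
    case (Cons x w)
    have "(\<Sum>a | g a = b. count (mset (x # w)) a) = (\<Sum>a | g a = b. (if a = x then 1 else 0) + count (mset w) a)"
      by (intro sum.cong) auto
    then show ?case using Cons by (simp add: sum.distrib)
  qed simp
  then have "(\<Sum>a | g a = b. real (count (mset w) a)) = real (count (mset (map g w)) b)"
    by (metis of_nat_sum)
  then show "marg g (emp w) b = emp (map g w) b"
    by (simp add: marg_def emp_def sum_divide_distrib[symmetric])
qed

lemma iid_eq_exp_emp:
  fixes f :: "'a::finite \<Rightarrow> real"
  assumes "w \<noteq> []" "\<And>a. a \<in> set w \<Longrightarrow> f a > 0"
  shows "iid f w = exp (real (length w) * (\<Sum>a\<in>UNIV. emp w a * ln (f a)))"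
  using assms by (simp add: iid_eq_exp sum_emp_mult)

lemma emp_pos_iff: "emp w a > 0 \<longleftrightarrow> a \<in> set w"
  by (auto simp: emp_def zero_less_divide_iff)

section \<open>Sizes of type classes\<close>

definition type_size :: "'a list \<Rightarrow> real" where
  "type_size w = real (card (permutations_of_multiset (mset w)))"

lemma type_size_pos: "type_size w > 0"
  unfolding type_size_def by (simp add: card_gt_0_iff)

lemma permutations_of_mset_subset_words: "w \<in> words n \<Longrightarrow> permutations_of_multiset (mset w) \<subseteq> words n"
  by (auto simp: words_def permutations_of_multiset_def dest: mset_eq_length)

lemma sum_type_const:
  assumes "\<And>v. mset v = mset w \<Longrightarrow> f v = f w"
  shows "(\<Sum>v\<in>permutations_of_multiset (mset w). f v) = type_size w * (f w :: real)"
proof -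
  have "(\<Sum>v\<in>permutations_of_multiset (mset w). f v) = (\<Sum>v\<in>permutations_of_multiset (mset w). f w)"
    by (intro sum.cong assms) (auto simp: permutations_of_multiset_def)
  then show ?thesis by (simp add: type_size_def)
qed

text \<open>The product weight is constant on the type class, so the left side is the probability of
  that class.\<close>

lemma type_size_mult_iid_le:
  fixes f :: "'a::finite \<Rightarrow> real"
  assumes "\<And>a. 0 \<le> f a" "sum f UNIV = 1"
  shows "type_size w * iid f w \<le> 1"
proof -
  have "type_size w * iid f w = (\<Sum>v\<in>permutations_of_multiset (mset w). iid f v)"
    by (rule sum_type_const[symmetric]) (rule iid_cong_mset)
  also have "\<dots> \<le> (\<Sum>v\<in>words (length w). iid f v)"
  proof (rule sum_mono2)
    show "permutations_of_multiset (mset w) \<subseteq> words (length w)"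
      by (rule permutations_of_mset_subset_words) (simp add: words_def)
  qed (auto simp: iid_nonneg assms)
  also have "\<dots> = 1" by (simp add: sum_iid assms)
  finally show ?thesis .
qed

text \<open>Use the empirical distribution of \<open>w\<close> itself, under which \<open>w\<close>
  has probability \<open>exp (- n H)\<close>.\<close>

lemma type_size_le:
  fixes w :: "'a::finite list"
  assumes w: "w \<noteq> []"
  shows "type_size w \<le> exp (real (length w) * ent (emp w))"
proof -
  note V = emp_in_prob_simplex[OF w]
  have "iid (emp w) w = exp (- (real (length w) * ent (emp w)))"
    using w by (subst iid_eq_exp_emp) (auto simp: emp_pos_iff ent_def)
  moreover have "type_size w * iid (emp w) w \<le> 1"
    by (intro type_size_mult_iid_le prob_simplex_nonneg[OF V] prob_simplex_sum[OF V])
  ultimately have "type_size w * exp (- (real (length w) * ent (emp w))) \<le> 1" by simp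
  then show ?thesis by (simp add: exp_minus inverse_eq_divide pos_divide_le_eq)
qed

text \<open>Crude Stirling bound; the induction step is \<open>ln t <= t - 1\<close> at
  \<open>t = (n + 1) / n\<close>.\<close>

lemma ln_fact_ge: "real n * ln n - n \<le> ln (fact n)"
proof (induction n)
  case (Suc n)
  show ?case
  proof (cases "n = 0")
    case False
    have "ln (real n / (real n + 1)) \<ge> 1 - (real n + 1) / real n"
      using False ln_le_minus_one[of "(real n + 1) / real n"] by (simp add: ln_div)
    then have "real n * (ln (real n) - ln (real n + 1)) \<ge> real n * (1 - (real n + 1) / real n)"
      using False by (simp add: ln_div mult_left_mono)
    moreover have "real n * (1 - (real n + 1) / real n) = - 1" using False by (simp add: field_simps)
    ultimately have "real n * ln (real n) - real n * ln (real n + 1) \<ge> - 1"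
      by (simp add: right_diff_distrib)
    moreover have "ln (fact (Suc n)) = ln (real n + 1) + ln (fact n)" by (simp add: ln_mult add.commute)
    ultimately show ?thesis using Suc False by (simp add: algebra_simps)
  qed simp
qed simp

text \<open>The excess \<open>1 + ln (c + 1)\<close> is what becomes a factor
  \<open>e (n + 1)\<close> per letter; \<open>c + 1\<close> rather than \<open>c\<close> admits
  letters that do not occur.\<close>

lemma ln_fact_le: "ln (fact c) \<le> 1 + ln (real c + 1) + real c * ln c - c"
proof (cases "c = 0")
  case False
  then have "1 \<le> c" by simp
  then have "ln (fact c) \<le> 1 + ln (real c) + real c * ln c - c"
  proof (induction c rule: dec_induct)
    case (step c)
    have "ln (real c / (real c + 1)) \<le> real c / (real c + 1) - 1"
      using step by (intro ln_le_minus_one) auto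
    then have "(real c + 1) * (ln (real c) - ln (real c + 1)) \<le> (real c + 1) * (real c / (real c + 1) - 1)"
      using step by (simp add: ln_div mult_left_mono)
    also have "\<dots> = - 1" by (simp add: field_simps)
    finally have a: "(real c + 1) * ln (real c) - (real c + 1) * ln (real c + 1) \<le> - 1"
      by (simp add: algebra_simps)
    have "ln (fact (Suc c)) = ln (real c + 1) + ln (fact c)" by (simp add: ln_mult add.commute)
    then show ?case using step.IH a by (simp add: algebra_simps)
  qed simp
  then show ?thesis using False by (smt (verit) ln_le_cancel_iff of_nat_0_less_iff neq0_conv)
qed simp

text \<open>The size is the multinomial coefficient. Stirling from below for the numerator and from
  above for each of the \<open>CARD('a)\<close> factorials leaves \<open>n H\<close> and one
  polynomial factor per letter.\<close>

lemma type_size_ge: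
  fixes w :: "'a::finite list"
  assumes w: "w \<noteq> []"
  shows "exp (real (length w) * ent (emp w)) \<le> (exp 1 * (real (length w) + 1)) ^ CARD('a) * type_size w"
proof -
  let ?n = "length w" and ?c = "\<lambda>a. real (count (mset w) a)"
  have n: "real ?n > 0" using w by simp
  have "real (card (permutations_of_multiset (mset w)) * (\<Prod>x\<in>set_mset (mset w). fact (count (mset w) x))) = fact ?n"
    unfolding card_permutations_of_multiset_aux by simp
  moreover have "(\<Prod>x\<in>set_mset (mset w). fact (count (mset w) x)) = (\<Prod>x\<in>UNIV. fact (count (mset w) x) :: nat)"
  proof (rule prod.mono_neutral_left)
    show "\<forall>x\<in>UNIV - set_mset (mset w). fact (count (mset w) x) = (1::nat)"
    proof
      fix x assume "x \<in> UNIV - set_mset (mset w)"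
      then have "count (mset w) x = 0" by simp
      then show "fact (count (mset w) x) = (1::nat)" by (simp only: fact_0)
    qed
  qed auto
  ultimately have "real (card (permutations_of_multiset (mset w)) * (\<Prod>x\<in>UNIV. fact (count (mset w) x))) = fact ?n"
    by (simp only:)
  then have "type_size w * (\<Prod>x\<in>UNIV. fact (count (mset w) x)) = fact ?n"
    by (simp add: type_size_def)
  then have "ln (type_size w) + ln (\<Prod>x\<in>UNIV. fact (count (mset w) x)) = ln (fact ?n)"
    using type_size_pos[of w] by (metis fact_gt_zero ln_mult_pos prod_pos)
  then have "ln (type_size w) = ln (fact ?n) - (\<Sum>x\<in>UNIV. ln (fact (count (mset w) x)))"
    by (simp add: ln_prod)
  moreover have "(\<Sum>x\<in>UNIV. ln (fact (count (mset w) x))) \<le> (\<Sum>x\<in>UNIV. (1 + ln (real ?n + 1)) + ?c x * ln (?c x) - ?c x)"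
  proof (rule sum_mono)
    fix x
    have "count (mset w) x \<le> ?n" by (metis count_le_length size_mset count_le_size)
    then have "ln (?c x + 1) \<le> ln (real ?n + 1)" by simp
    then show "ln (fact (count (mset w) x)) \<le> (1 + ln (real ?n + 1)) + ?c x * ln (?c x) - ?c x"
      using ln_fact_le[of "count (mset w) x"] by linarith
  qed
  moreover have "(\<Sum>x\<in>UNIV. (1 + ln (real ?n + 1)) + ?c x * ln (?c x) - ?c x)
     = real CARD('a) * (1 + ln (real ?n + 1)) + (\<Sum>x\<in>UNIV. ?c x * ln (?c x)) - real ?n"
    using sum_count_mult[of w "\<lambda>_. 1"] by (simp add: sum.distrib sum_subtractf sum_list_triv)
  moreover have "real ?n * ent (emp w) = real ?n * ln ?n - (\<Sum>x\<in>UNIV. ?c x * ln (?c x))"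
  proof -
    have "real ?n * (emp w x * ln (emp w x)) = ?c x * ln (?c x) - ?c x * ln ?n" for x
    proof (cases "count (mset w) x = 0")
      case False
      then show ?thesis using n by (simp add: emp_def ln_div right_diff_distrib)
    next
      case True
      then show ?thesis unfolding emp_def by (simp only:)
    qed
    then have "real ?n * (\<Sum>x\<in>UNIV. emp w x * ln (emp w x)) = (\<Sum>x\<in>UNIV. ?c x * ln (?c x)) - (\<Sum>x\<in>UNIV. ?c x * ln ?n)"
      by (simp only: sum_distrib_left sum_subtractf)
    also have "(\<Sum>x\<in>UNIV. ?c x * ln ?n) = real ?n * ln ?n"
      using sum_count_mult[of w "\<lambda>_. ln ?n"] by (simp add: sum_list_triv)
    finally show ?thesis by (simp add: ent_def)
  qed
  ultimately have "real ?n * ent (emp w) \<le> real CARD('a) * (1 + ln (real ?n + 1)) + ln (type_size w)"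
    using ln_fact_ge[of ?n] by linarith
  then have "exp (real ?n * ent (emp w)) \<le> exp (real CARD('a) * (1 + ln (real ?n + 1)) + ln (type_size w))"
    by simp
  also have "\<dots> = (exp 1 * (real ?n + 1)) ^ CARD('a) * type_size w"
    using type_size_pos[of w] n by (simp add: exp_add exp_of_nat_mult)
  finally show ?thesis .
qed

section \<open>Counting types\<close>

lemma card_types_le: "card (mset ` (words n :: 'a::finite list set)) \<le> (n + 1) ^ CARD('a)"
proof -
  have "card (mset ` (words n :: 'a list set)) = card (count ` mset ` (words n :: 'a list set))"
    by (rule card_image[symmetric]) (simp add: inj_on_def count_inject)
  also have "\<dots> \<le> card (Pi\<^sub>E (UNIV :: 'a set) (\<lambda>_. {..n}))"
    by (intro card_mono finite_PiE)
       (auto simp: words_def PiE_def extensional_def intro: order_trans[OF count_le_size])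
  also have "\<dots> = (n + 1) ^ CARD('a)" by (simp add: card_PiE)
  finally show ?thesis .
qed

text \<open>Every type class contributes exactly 1, so the sum is the number of types.\<close>

lemma sum_inverse_type_size:
  "(\<Sum>w\<in>(words n :: 'a::finite list set). 1 / type_size w) \<le> (real n + 1) ^ CARD('a)"
proof -
  have "(\<Sum>w\<in>(words n :: 'a list set). 1 / type_size w) = (\<Sum>M\<in>mset ` (words n :: 'a list set). \<Sum>w\<in>{v \<in> words n. mset v = M}. 1 / type_size w)"
    by (rule sum.group[symmetric]) auto
  also have "\<dots> = (\<Sum>M\<in>mset ` (words n :: 'a list set). 1)"
  proof (rule sum.cong)
    fix M assume "M \<in> mset ` (words n :: 'a list set)"
    then obtain w where w: "w \<in> words n" "M = mset w" by auto
    have "{v \<in> words n. mset v = M} = permutations_of_multiset (mset w)"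
      using permutations_of_mset_subset_words[OF w(1)] w(2) by (auto simp: permutations_of_multiset_def)
    then have "(\<Sum>w\<in>{v \<in> words n. mset v = M}. 1 / type_size w) = type_size w * (1 / type_size w)"
      by (simp only:) (rule sum_type_const, simp add: type_size_def)
    then show "(\<Sum>w\<in>{v \<in> words n. mset v = M}. 1 / type_size w) = 1"
      using type_size_pos[of w] by simp
  qed simp
  also have "\<dots> = real (card (mset ` (words n :: 'a list set)))" by simp
  also have "\<dots> \<le> real ((n + 1) ^ CARD('a))" using card_types_le[where 'a='a, of n] by (simp only: of_nat_le_iff)
  finally show ?thesis by (simp add: add.commute)
qed

text \<open>Comparing \<open>q\<close> with \<open>c / type_size\<close> word by word makes this
  work for an arbitrary set \<open>B\<close>, not just for unions of type classes.\<close>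

lemma sum_le_types:
  fixes q :: "'a::finite list \<Rightarrow> real"
  assumes "B \<subseteq> words n" "0 \<le> c" "\<And>w. w \<in> B \<Longrightarrow> q w * type_size w \<le> c"
  shows "(\<Sum>w\<in>B. q w) \<le> (real n + 1) ^ CARD('a) * c"
proof -
  have "(\<Sum>w\<in>B. q w) \<le> (\<Sum>w\<in>B. c * (1 / type_size w))"
  proof (rule sum_mono)
    fix w assume "w \<in> B"
    then have "q w \<le> c / type_size w" using assms(3) pos_le_divide_eq[OF type_size_pos] by blast
    then show "q w \<le> c * (1 / type_size w)" by simp
  qed
  also have "\<dots> \<le> (\<Sum>w\<in>(words n :: 'a list set). c * (1 / type_size w))"
    using assms by (intro sum_mono2) (auto intro!: divide_nonneg_pos type_size_pos)
  also have "\<dots> = c * (\<Sum>w\<in>(words n :: 'a list set). 1 / type_size w)" by (rule sum_distrib_left[symmetric])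
  also have "\<dots> \<le> c * (real n + 1) ^ CARD('a)"
    by (intro mult_left_mono sum_inverse_type_size assms)
  finally show ?thesis by (simp add: mult.commute)
qed

lemma type_size_mult_iid_le_exp:
  fixes P :: "'a::finite pmf"
  assumes w: "w \<noteq> []" and ac: "set w \<subseteq> set_pmf P"
  shows "iid (pmf P) w * type_size w \<le> exp (- (real (length w) * rel_ent (emp w) P))"
proof -
  have "iid (pmf P) w * type_size w \<le> exp (real (length w) * (\<Sum>a\<in>UNIV. emp w a * ln (pmf P a))) * exp (real (length w) * ent (emp w))"
    using w ac type_size_le[OF w] by (subst iid_eq_exp_emp) (auto simp: pmf_positive_iff)
  also have "\<dots> = exp (- (real (length w) * rel_ent (emp w) P))"
    by (simp add: rel_ent_eq exp_add[symmetric] algebra_simps)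
  finally show ?thesis .
qed

subsection \<open>The weak law of large numbers\<close>

text \<open>Both moments go through one induction: the cross term of the square vanishes by the
  statement on the mean.\<close>

lemma iid_second_moment:
  fixes V g :: "'a::finite \<Rightarrow> real"
  assumes V: "sum V UNIV = 1" and g: "(\<Sum>a\<in>UNIV. V a * g a) = 0"
  shows "(\<Sum>w\<in>words n. iid V w * sum_list (map g w)) = 0"
    and "(\<Sum>w\<in>words n. iid V w * (sum_list (map g w))\<^sup>2) = real n * (\<Sum>a\<in>UNIV. V a * (g a)\<^sup>2)"
proof (induction n)
  case (Suc n)
  let ?S = "\<lambda>w. sum_list (map g w)"
  have 0: "(\<Sum>w\<in>words n. iid V w) = 1" by (simp add: sum_iid V)
  { case 1
    have "(\<Sum>w\<in>words (Suc n). iid V w * ?S w) = (\<Sum>a\<in>UNIV. V a * g a * (\<Sum>w\<in>words n. iid V w) + V a * (\<Sum>w\<in>words n. iid V w * ?S w))"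
      unfolding sum_words_Suc by (intro sum.cong refl) (simp add: sum_distrib_left sum.distrib[symmetric] algebra_simps)
    then show ?case unfolding 0 Suc(1) by (simp add: g) }
  { case 2
    have "(\<Sum>w\<in>words (Suc n). iid V w * (?S w)\<^sup>2) = (\<Sum>a\<in>UNIV. V a * (g a)\<^sup>2 * (\<Sum>w\<in>words n. iid V w)
        + 2 * V a * g a * (\<Sum>w\<in>words n. iid V w * ?S w) + V a * (\<Sum>w\<in>words n. iid V w * (?S w)\<^sup>2))"
      unfolding sum_words_Suc
      by (intro sum.cong refl) (simp add: sum_distrib_left sum.distrib[symmetric] power2_eq_square algebra_simps)
    then show ?case
      unfolding 0 Suc mult_zero_right add_0_right mult_1_right sum.distrib sum_distrib_right[symmetric] V
      by (simp add: algebra_simps) }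
qed (simp_all add: words_0)

text \<open>Chebyshev's inequality for the centred function \<open>g\<close>: variance
  \<open>n * v\<close> against the threshold \<open>(n * e)^2\<close>.\<close>

lemma weak_law:
  fixes V f :: "'a::finite \<Rightarrow> real"
  assumes V: "V \<in> prob_simplex" and e: "e > 0"
  shows "(\<lambda>n. \<Sum>w | w \<in> words n \<and> real n * e \<le> \<bar>sum_list (map f w) - real n * (\<Sum>a\<in>UNIV. V a * f a)\<bar>. iid V w) \<longlonglongrightarrow> 0"
proof -
  define m where "m = (\<Sum>a\<in>UNIV. V a * f a)"
  define g where "g = (\<lambda>a. f a - m)"
  define v where "v = (\<Sum>a\<in>UNIV. V a * (g a)\<^sup>2)"
  have nn: "0 \<le> iid V w" for w by (rule iid_nonneg[OF prob_simplex_nonneg[OF V]])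
  have g0: "(\<Sum>a\<in>UNIV. V a * g a) = 0"
    using prob_simplex_sum[OF V]
    by (simp add: g_def right_diff_distrib sum_subtractf sum_distrib_right[symmetric] m_def[symmetric])
  have Sg: "sum_list (map g w) = sum_list (map f w) - real n * m" if "w \<in> words n" for w n
  proof -
    have "sum_list (map g w) = sum_list (map f w) - real (length w) * m"
      by (induction w) (auto simp: g_def algebra_simps)
    then show ?thesis using that by (simp add: words_def)
  qed
  have bound: "(\<Sum>w | w \<in> words n \<and> real n * e \<le> \<bar>sum_list (map f w) - real n * m\<bar>. iid V w) \<le> v / e\<^sup>2 / real n"
    if n: "n > 0" for n
  proof -
    let ?B = "{w. w \<in> words n \<and> real n * e \<le> \<bar>sum_list (map f w) - real n * m\<bar>}"
    have "(\<Sum>w\<in>?B. iid V w) * (real n * e)\<^sup>2 = (\<Sum>w\<in>?B. iid V w * (real n * e)\<^sup>2)"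
      by (rule sum_distrib_right)
    also have "\<dots> \<le> (\<Sum>w\<in>?B. iid V w * (sum_list (map g w))\<^sup>2)"
    proof (intro sum_mono mult_left_mono nn)
      fix w assume "w \<in> ?B"
      then show "(real n * e)\<^sup>2 \<le> (sum_list (map g w))\<^sup>2"
        using e by (simp add: Sg[of _ n]) (metis abs_le_square_iff abs_of_nonneg less_imp_le mult_nonneg_nonneg of_nat_0_le_iff)
    qed
    also have "\<dots> \<le> (\<Sum>w\<in>words n. iid V w * (sum_list (map g w))\<^sup>2)"
      by (intro sum_mono2) (auto simp: nn)
    also have "\<dots> = real n * v"
      unfolding v_def by (rule iid_second_moment(2)[OF prob_simplex_sum[OF V] g0])
    finally have "(\<Sum>w\<in>?B. iid V w) \<le> real n * v / (real n * e)\<^sup>2"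
      using n e by (simp add: pos_le_divide_eq)
    also have "\<dots> = v / e\<^sup>2 / real n" using n by (simp add: power2_eq_square)
    finally show ?thesis .
  qed
  show ?thesis unfolding m_def[symmetric]
  proof (rule tendsto_sandwich[of "\<lambda>_. 0" _ _ "\<lambda>n. v / e\<^sup>2 / real n"])
    show "(\<lambda>n. v / e\<^sup>2 / real n) \<longlonglongrightarrow> 0" by (rule lim_const_over_n)
    show "eventually (\<lambda>n. (\<Sum>w | w \<in> words n \<and> real n * e \<le> \<bar>sum_list (map f w) - real n * m\<bar>. iid V w) \<le> v / e\<^sup>2 / real n) sequentially"
      using eventually_gt_at_top[of 0] by eventually_elim (rule bound)
  qed (auto intro!: always_eventually sum_nonneg nn)
qed

text \<open>An open set of the product topology contains a box around \<open>V\<close>. Leaving the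
  box means that the frequency of some letter deviates, which \<open>weak_law\<close> for its
  indicator and a union bound control.\<close>

lemma emp_concentrates:
  fixes V :: "'a::finite \<Rightarrow> real"
  assumes V: "V \<in> prob_simplex" and S: "open S" "V \<in> S"
  shows "(\<lambda>n. \<Sum>w | w \<in> words n \<and> emp w \<notin> S. iid V w) \<longlonglongrightarrow> 0"
proof -
  have nn: "0 \<le> iid V w" for w by (rule iid_nonneg[OF prob_simplex_nonneg[OF V]])
  obtain X where X: "V \<in> Pi\<^sub>E UNIV X" "\<And>a. open (X a)" "Pi\<^sub>E UNIV X \<subseteq> S"
  proof -
    have "openin (product_topology (\<lambda>_. euclidean) UNIV) S"
      using S(1) unfolding open_fun_def .
    from product_topology_open_contains_basis[OF this S(2)] show ?thesis
      using that unfolding open_openin[symmetric] by blast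
  qed
  have "\<exists>e>0. \<forall>y. dist y (V a) < e \<longrightarrow> y \<in> X a" for a
    using X(1,2) by (auto simp: open_dist)
  then obtain e where e: "\<And>a. e a > 0" "\<And>a y. dist y (V a) < e a \<Longrightarrow> y \<in> X a" by metis
  define B where "B = (\<lambda>n a. {w \<in> words n. real n * e a \<le> \<bar>sum_list (map (indicator {a}) w) - real n * (\<Sum>b\<in>UNIV. V b * indicator {a} b)\<bar>})"
  have "(\<lambda>n. \<Sum>a\<in>UNIV. \<Sum>w\<in>B n a. iid V w) \<longlonglongrightarrow> (\<Sum>a\<in>(UNIV::'a set). 0)"
    unfolding B_def by (intro tendsto_sum weak_law V e)
  then have lim: "(\<lambda>n. \<Sum>a\<in>UNIV. \<Sum>w\<in>B n a. iid V w) \<longlonglongrightarrow> 0" by simp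
  have le: "(\<Sum>w | w \<in> words n \<and> emp w \<notin> S. iid V w) \<le> (\<Sum>a\<in>UNIV. \<Sum>w\<in>B n a. iid V w)" if n: "n > 0" for n
  proof -
    have "{w \<in> words n. emp w \<notin> S} \<subseteq> (\<Union>a\<in>UNIV. B n a)"
    proof
      fix w assume w: "w \<in> {w \<in> words n. emp w \<notin> S}"
      then have "emp w \<notin> Pi\<^sub>E UNIV X" using X(3) by blast
      then obtain a where "emp w a \<notin> X a" by (auto simp: PiE_def)
      then have a: "e a \<le> \<bar>emp w a - V a\<bar>" using e(2)[of "emp w a" a] by (force simp: dist_real_def)
      have l: "length w = n" using w by (simp add: words_def)
      have "(\<Sum>b\<in>UNIV. f b * indicator {a} b) = f a" for f :: "'a \<Rightarrow> real"
        by (simp add: indicator_def if_distrib cong: if_cong)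
      note ind = this
      have "sum_list (map (indicator {a}) w) = real n * emp w a"
        using sum_emp_mult[of w "indicator {a}"] n l by (simp add: ind field_simps)
      then have "\<bar>sum_list (map (indicator {a}) w) - real n * (\<Sum>b\<in>UNIV. V b * indicator {a} b)\<bar> = real n * \<bar>emp w a - V a\<bar>"
        by (simp add: ind right_diff_distrib[symmetric] abs_mult)
      then have "w \<in> B n a" using a w n by (simp add: B_def)
      then show "w \<in> (\<Union>a\<in>UNIV. B n a)" by blast
    qed
    then have "(\<Sum>w | w \<in> words n \<and> emp w \<notin> S. iid V w) \<le> (\<Sum>w\<in>(\<Union>a\<in>UNIV. B n a). iid V w)"
      by (intro sum_mono2) (auto simp: nn B_def)
    also have "\<dots> \<le> (\<Sum>a\<in>UNIV. \<Sum>w\<in>B n a. iid V w)"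
    proof -
      have "(\<Union>a\<in>UNIV. B n a) = snd ` Sigma UNIV (B n)" by force
      then have "(\<Sum>w\<in>(\<Union>a\<in>UNIV. B n a). iid V w) \<le> sum (iid V \<circ> snd) (Sigma UNIV (B n))"
        by (simp only:) (intro sum_image_le, auto simp: nn B_def)
      also have "\<dots> = (\<Sum>a\<in>UNIV. \<Sum>w\<in>B n a. iid V w)"
        by (subst sum.Sigma) (auto simp: B_def split_beta)
      finally show ?thesis .
    qed
    finally show ?thesis .
  qed
  show ?thesis
  proof (rule tendsto_sandwich[OF _ _ tendsto_const lim])
    show "eventually (\<lambda>n. (\<Sum>w | w \<in> words n \<and> emp w \<notin> S. iid V w) \<le> (\<Sum>a\<in>UNIV. \<Sum>w\<in>B n a. iid V w)) sequentially"
      using eventually_gt_at_top[of 0] by eventually_elim (rule le)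
  qed (auto intro!: always_eventually sum_nonneg nn)
qed

subsection \<open>Permutation invariant Markov distributions\<close>

lemma pmf_map_inj_on:
  assumes "inj_on f A" "set_pmf M \<subseteq> A" "x \<in> A"
  shows "pmf (map_pmf f M) (f x) = pmf M x"
proof (cases "x \<in> set_pmf M")
  case True
  then show ?thesis using assms by (intro pmf_map_inj) (auto intro: inj_on_subset)
next
  case False
  then have "f x \<notin> set_pmf (map_pmf f M)" using assms by (auto dest: inj_onD)
  then show ?thesis using False by (metis pmf_eq_0_set_pmf)
qed

lemma permute_list_inverse:
  assumes "p permutes {..<length w}"
  shows "permute_list p (permute_list (inv p) w) = w"
proof -
  have "permute_list (inv p \<circ> p) w = permute_list p (permute_list (inv p) w)"
    by (rule permute_list_compose[OF assms])
  then show ?thesis by (simp add: permutes_inv_o(2)[OF assms])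
qed

lemma inj_on_permute_list:
  assumes p: "p permutes {..<n}"
  shows "inj_on (permute_list p) (words n)"
proof (rule inj_on_inverseI[of _ "permute_list (inv p)"])
  fix w :: "'a list" assume "w \<in> words n"
  then have l: "length w = n" by (simp add: words_def)
  have "permute_list (inv (inv p)) w = permute_list p w" by (simp add: permutes_inv_inv[OF p])
  then show "permute_list (inv p) (permute_list p w) = w"
    using permute_list_inverse[of "inv p" w] permutes_inv[OF p] l by simp
qed

lemma permutation_invariantD:
  assumes "permutation_invariant n M" "set_pmf M \<subseteq> words n" "mset v = mset w" "w \<in> words n"
  shows "pmf M v = pmf M w"
proof -
  obtain p where p: "p permutes {..<length w}" "permute_list p w = v"
    using mset_eq_permutation[OF assms(3)] .
  have l: "length w = n" using assms(4) by (simp add: words_def)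
  have "pmf M v = pmf (map_pmf (permute_list p) M) (permute_list p w)"
    using assms(1) p l by (simp add: permutation_invariant_def)
  also have "\<dots> = pmf M w"
    using assms p l by (intro pmf_map_inj_on[OF inj_on_permute_list]) auto
  finally show ?thesis .
qed

lemma permutation_invariantI:
  assumes sub: "set_pmf M \<subseteq> words n" and sym: "\<And>v w. v \<in> words n \<Longrightarrow> mset v = mset w \<Longrightarrow> pmf M v = pmf M w"
  shows "permutation_invariant n M"
  unfolding permutation_invariant_def
proof (intro allI impI pmf_eqI)
  fix p v assume p: "p permutes {..<n}"
  show "pmf (map_pmf (permute_list p) M) v = pmf M v"
  proof (cases "v \<in> words n")
    case True
    then have l: "length v = n" by (simp add: words_def)
    have "pmf (map_pmf (permute_list p) M) (permute_list p (permute_list (inv p) v)) = pmf M (permute_list (inv p) v)"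
      using l by (intro pmf_map_inj_on[OF inj_on_permute_list[OF p] sub]) (simp add: words_def)
    moreover have "permute_list p (permute_list (inv p) v) = v"
      using permute_list_inverse[of p v] p l by simp
    moreover have "pmf M v = pmf M (permute_list (inv p) v)"
      using permutes_inv[OF p] l by (intro sym True) simp
    ultimately show ?thesis by simp
  next
    case False
    then have "v \<notin> set_pmf M" "v \<notin> set_pmf (map_pmf (permute_list p) M)"
      using sub by (auto simp: words_def)
    then show ?thesis by (metis pmf_eq_0_set_pmf)
  qed
qed

lemma permutation_invariant_map:
  assumes "permutation_invariant n M" "set_pmf M \<subseteq> words n"
  shows "permutation_invariant n (map_pmf (map g) M)"
  unfolding permutation_invariant_def
proof (intro allI impI)
  fix p assume p: "p permutes {..<n}"
  have "map_pmf (permute_list p) (map_pmf (map g) M) = map_pmf (map g) (map_pmf (permute_list p) M)"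
    unfolding map_pmf_comp using assms(2) p
    by (intro map_pmf_cong refl permute_list_map) (auto simp: words_def)
  then show "map_pmf (permute_list p) (map_pmf (map g) M) = map_pmf (map g) M"
    using assms(1) p by (simp add: permutation_invariant_def)
qed

section \<open>Marginals of Markov distributions, for letters and for words\<close>

lemma set_markov_pmf:
  "set_pmf (markov_pmf QY QX QZ) = {(x, y, z). y \<in> set_pmf QY \<and> x \<in> set_pmf (QX y) \<and> z \<in> set_pmf (QZ y)}"
  by (auto simp: markov_pmf_def)

text \<open>With the discarded channel replaced by a unit-valued one the projection becomes
  injective, so the marginal can be read off without a sum.\<close>

lemma map_pXY_markov_pmf: "map_pmf pXY (markov_pmf QY QX QZ) = map_pmf pXY (markov_pmf QY QX (\<lambda>_. return_pmf ()))"
  by (simp add: markov_pmf_def map_bind_pmf bind_return_pmf pXY_def)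

lemma map_snd_markov_pmf: "map_pmf snd (markov_pmf QY QX QZ) = map_pmf snd (markov_pmf QY (\<lambda>_. return_pmf ()) QZ)"
  by (simp add: markov_pmf_def map_bind_pmf bind_return_pmf)

lemma map_pY_markov_pmf: "map_pmf pY (markov_pmf QY QX QZ) = QY"
  by (simp add: markov_pmf_def map_bind_pmf bind_return_pmf' pY_def)

lemma pmf_map_pXY_markov_pmf: "pmf (map_pmf pXY (markov_pmf QY QX QZ)) (x, y) = pmf QY y * pmf (QX y) x"
proof -
  have "inj (pXY :: 'a \<times> 'b \<times> unit \<Rightarrow> _)" by (auto simp: inj_def pXY_def)
  from pmf_map_inj'[OF this, of "markov_pmf QY QX (\<lambda>_. return_pmf ())" "(x, y, ())"]
  show ?thesis unfolding map_pXY_markov_pmf[of QY QX QZ] by (simp add: pmf_markov_pmf pXY_def)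
qed

lemma pmf_map_snd_markov_pmf: "pmf (map_pmf snd (markov_pmf QY QX QZ)) (y, z) = pmf QY y * pmf (QZ y) z"
proof -
  have "inj (snd :: unit \<times> 'a \<times> 'b \<Rightarrow> _)" by (auto simp: inj_def)
  from pmf_map_inj'[OF this, of "markov_pmf QY (\<lambda>_. return_pmf ()) QZ" "((), y, z)"]
  show ?thesis unfolding map_snd_markov_pmf[of QY QX QZ] by (simp add: pmf_markov_pmf)
qed

lemma zip3_words:
  assumes "xs \<in> words n" "ys \<in> words n" "zs \<in> words n"
  shows "zip3 (xs, ys, zs) \<in> words n" "map fst (zip3 (xs, ys, zs)) = xs" "map pY (zip3 (xs, ys, zs)) = ys"
    "map (snd \<circ> snd) (zip3 (xs, ys, zs)) = zs" "map pXY (zip3 (xs, ys, zs)) = zip xs ys" "map snd (zip3 (xs, ys, zs)) = zip ys zs"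
proof -
  have l: "length xs = n" "length ys = n" "length zs = n" using assms by (auto simp: words_def)
  show "zip3 (xs, ys, zs) \<in> words n" "map fst (zip3 (xs, ys, zs)) = xs" "map snd (zip3 (xs, ys, zs)) = zip ys zs"
    using l by (auto simp: zip3_def words_def)
  have "map pY (zip3 (xs, ys, zs)) = map fst (map snd (zip3 (xs, ys, zs)))" by (simp add: pY_def)
  then show "map pY (zip3 (xs, ys, zs)) = ys" using l by (simp add: zip3_def)
  have "map (snd \<circ> snd) (zip3 (xs, ys, zs)) = map snd (map snd (zip3 (xs, ys, zs)))" by simp
  then show "map (snd \<circ> snd) (zip3 (xs, ys, zs)) = zs" using l by (simp add: zip3_def)
  show "map pXY (zip3 (xs, ys, zs)) = zip xs ys"
    using l by (intro nth_equalityI) (auto simp: zip3_def pXY_def)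
qed

lemma zip3_unzip: "zip3 (map fst w, map pY w, map (snd \<circ> snd) w) = w"
  by (induction w) (auto simp: zip3_def pY_def)

lemma inj_on_zip3: "inj_on zip3 (words n \<times> words n \<times> words n)"
proof (rule inj_on_inverseI)
  fix u :: "'a list \<times> 'b list \<times> 'c list" assume "u \<in> words n \<times> words n \<times> words n"
  then show "(\<lambda>w. (map fst w, map pY w, map (snd \<circ> snd) w)) (zip3 u) = u"
    by (cases u) (auto simp: zip3_words[of _ n] simp del: map_map)
qed

lemma map_in_words: "w \<in> words n \<Longrightarrow> map f w \<in> words n"
  by (simp add: words_def)

text \<open>The support conditions of \<open>markov_perm_inv\<close> without the symmetry. Whole
  words play the role of letters of a Markov triple here, and \<open>zip3\<close> is injective on
  these supports.\<close>

locale block_markov =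
  fixes n :: nat and QY :: "'y list pmf" and QX :: "'y list \<Rightarrow> 'x list pmf" and QZ :: "'y list \<Rightarrow> 'z list pmf"
  assumes QY: "set_pmf QY \<subseteq> words n"
    and QX: "\<And>ys. ys \<in> words n \<Longrightarrow> set_pmf (QX ys) \<subseteq> words n"
    and QZ: "\<And>ys. ys \<in> words n \<Longrightarrow> set_pmf (QZ ys) \<subseteq> words n"
begin

abbreviation "Q \<equiv> map_pmf zip3 (markov_pmf QY QX QZ)"

lemma support: "set_pmf (markov_pmf QY QX QZ) \<subseteq> words n \<times> words n \<times> words n"
proof
  fix u assume "u \<in> set_pmf (markov_pmf QY QX QZ)"
  then obtain x y z where "u = (x, y, z)" "y \<in> set_pmf QY" "x \<in> set_pmf (QX y)" "z \<in> set_pmf (QZ y)"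
    by (auto simp: set_markov_pmf)
  then show "u \<in> words n \<times> words n \<times> words n" using QY QX[of y] QZ[of y] by auto
qed

lemma support_zip3: "set_pmf Q \<subseteq> words n"
  using support by (auto intro!: zip3_words(1) simp del: zip3_def)

lemma pmf_zip3:
  assumes "w \<in> words n"
  shows "pmf Q w = pmf QY (map pY w) * pmf (QX (map pY w)) (map fst w) * pmf (QZ (map pY w)) (map (snd \<circ> snd) w)"
  using pmf_map_inj_on[OF inj_on_zip3 support, of "(map fst w, map pY w, map (snd \<circ> snd) w)"] assms
  unfolding zip3_unzip by (simp add: map_in_words pmf_markov_pmf del: map_map)

lemma pmf_XY:
  assumes "w \<in> words n"
  shows "pmf (map_pmf (map pXY) Q) (map pXY w) = pmf QY (map pY w) * pmf (QX (map pY w)) (map fst w)"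
proof -
  have "map_pmf (map pXY) Q = map_pmf (\<lambda>(xs, ys). zip xs ys) (map_pmf pXY (markov_pmf QY QX QZ))"
    unfolding map_pmf_comp using support
    by (intro map_pmf_cong refl) (auto simp: zip3_words[of _ n] pXY_def[of "(_, _)"])
  moreover have "map pXY w = (\<lambda>(xs, ys). zip xs ys) (map fst w, map pY w)"
    by (simp add: zip_map_map pXY_def pY_def) (simp add: zip_same_conv_map pXY_def)
  moreover have "inj_on (\<lambda>(xs, ys). zip xs ys) (words n \<times> words n :: ('x list \<times> 'y list) set)"
    by (rule inj_on_inverseI[of _ "\<lambda>u. (map fst u, map snd u)"]) (auto simp: words_def)
  moreover have "set_pmf (map_pmf pXY (markov_pmf QY QX QZ)) \<subseteq> words n \<times> words n"
    using support by (auto simp: pXY_def)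
  ultimately show ?thesis
    using pmf_map_inj_on[of "\<lambda>(xs, ys). zip xs ys" "words n \<times> words n" "map_pmf pXY (markov_pmf QY QX QZ)" "(map fst w, map pY w)"] assms
    by (simp add: map_in_words pmf_map_pXY_markov_pmf)
qed

lemma pmf_YZ:
  assumes "w \<in> words n"
  shows "pmf (map_pmf (map snd) Q) (map snd w) = pmf QY (map pY w) * pmf (QZ (map pY w)) (map (snd \<circ> snd) w)"
proof -
  have "map_pmf (map snd) Q = map_pmf (\<lambda>(ys, zs). zip ys zs) (map_pmf snd (markov_pmf QY QX QZ))"
    unfolding map_pmf_comp using support
    by (intro map_pmf_cong refl) (auto simp: zip3_words[of _ n])
  moreover have "map snd w = (\<lambda>(ys, zs). zip ys zs) (map pY w, map (snd \<circ> snd) w)"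
    by (simp add: zip_map_map pY_def) (simp add: zip_same_conv_map pXY_def)
  moreover have "inj_on (\<lambda>(ys, zs). zip ys zs) (words n \<times> words n :: ('y list \<times> 'z list) set)"
    by (rule inj_on_inverseI[of _ "\<lambda>u. (map fst u, map snd u)"]) (auto simp: words_def)
  moreover have "set_pmf (map_pmf snd (markov_pmf QY QX QZ)) \<subseteq> words n \<times> words n"
    using support by auto
  ultimately show ?thesis
    using pmf_map_inj_on[of "\<lambda>(ys, zs). zip ys zs" "words n \<times> words n" "map_pmf snd (markov_pmf QY QX QZ)" "(map pY w, map (snd \<circ> snd) w)"] assms
    by (simp add: map_in_words pmf_map_snd_markov_pmf del: map_map)
qed

lemma map_Y: "map_pmf (map pY) Q = QY"
proof -
  have "map_pmf (map pY) Q = map_pmf pY (markov_pmf QY QX QZ)"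
    unfolding map_pmf_comp using support
    by (intro map_pmf_cong refl) (auto simp: zip3_words[of _ n] pY_def[of "(_, _)"])
  then show ?thesis by (simp add: map_pY_markov_pmf)
qed

end

section \<open>The pointwise bound for symmetric Markov distributions\<close>

lemma measure_type_class:
  fixes M :: "'a::finite list pmf"
  assumes "permutation_invariant n M" "set_pmf M \<subseteq> words n" "w \<in> words n"
  shows "measure_pmf.prob M (permutations_of_multiset (mset w)) = type_size w * pmf M w"
  unfolding measure_measure_pmf_finite[OF finite_permutations_of_multiset]
  by (rule sum_type_const) (rule permutation_invariantD[OF assms(1,2) _ assms(3)])

text \<open>Both sides are probabilities of type classes, and \<open>map g\<close> sends the class
  of \<open>w\<close> into that of \<open>map g w\<close>.\<close>

lemma type_size_mult_pmf_le:
  fixes M :: "'a::finite list pmf" and g :: "'a \<Rightarrow> 'b::finite"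
  assumes "permutation_invariant n M" "set_pmf M \<subseteq> words n" "w \<in> words n"
  shows "type_size w * pmf M w \<le> type_size (map g w) * pmf (map_pmf (map g) M) (map g w)"
proof -
  have "type_size w * pmf M w = measure_pmf.prob M (permutations_of_multiset (mset w))"
    by (rule measure_type_class[OF assms, symmetric])
  also have "\<dots> \<le> measure_pmf.prob M (map g -` permutations_of_multiset (mset (map g w)))"
    by (rule measure_pmf.finite_measure_mono) (auto simp: permutations_of_multiset_def)
  also have "\<dots> = measure_pmf.prob (map_pmf (map g) M) (permutations_of_multiset (mset (map g w)))"
    by simp
  also have "\<dots> = type_size (map g w) * pmf (map_pmf (map g) M) (map g w)"
  proof (rule measure_type_class)
    show "permutation_invariant n (map_pmf (map g) M)" by (rule permutation_invariant_map[OF assms(1,2)])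
    show "set_pmf (map_pmf (map g) M) \<subseteq> words n" using assms(2) by (auto simp: words_def)
    show "map g w \<in> words n" using assms(3) by (simp add: words_def)
  qed
  finally show ?thesis .
qed

text \<open>With \<open>a\<close>, \<open>b\<close>, \<open>c\<close> the weights of the
  \<open>XY\<close>-, \<open>YZ\<close>- and \<open>Y\<close>-words, Markovity reads
  \<open>c * Q(w) = a * b\<close>. Projecting type classes gives \<open>NX * a <= N * c\<close> and
  \<open>NZ * b <= N * c\<close>, and \<open>N * c <= 1\<close>; hence
  \<open>Q(w) <= N^2 c / (NX NZ) <= N / (NX NZ)\<close>.\<close>

lemma pmf_markov_perm_inv_le:
  fixes Q :: "('x::finite \<times> 'y::finite \<times> 'z::finite) list pmf"
  assumes Q: "Q \<in> markov_perm_inv n" and w: "w \<in> words n"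
  shows "pmf Q w \<le> type_size (map pY w) / (type_size (map pXY w) * type_size (map snd w))"
proof -
  obtain QY QX QZ where inv: "permutation_invariant n Q"
    and bm: "block_markov n QY QX QZ" and Q': "Q = map_pmf zip3 (markov_pmf QY QX QZ)"
    using Q unfolding markov_perm_inv_def block_markov_def by blast
  interpret block_markov n QY QX QZ by (rule bm)
  note sup = support_zip3[folded Q']
  let ?A = "map_pmf (map pXY) Q" and ?B = "map_pmf (map snd) Q"
  define c a b where "c = pmf QY (map pY w)" and "a = pmf ?A (map pXY w)" and "b = pmf ?B (map snd w)"
  define N NX NZ where "N = type_size (map pY w)" and "NX = type_size (map pXY w)" and "NZ = type_size (map snd w)"
  have N: "N > 0" "NX > 0" "NZ > 0" by (auto simp: N_def NX_def NZ_def type_size_pos)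
  have mw: "map pXY w \<in> words n" "map snd w \<in> words n" "map pY w \<in> words n" by (auto intro: map_in_words w)
  have sA: "set_pmf ?A \<subseteq> words n" and sB: "set_pmf ?B \<subseteq> words n"
    using sup by (auto intro: map_in_words)
  have invA: "permutation_invariant n ?A" and invB: "permutation_invariant n ?B" and invY: "permutation_invariant n QY"
    using permutation_invariant_map[OF inv sup] map_Y by (auto simp: Q'[symmetric])
  have cY: "snd (pXY v) = pY v" "fst (snd v) = pY v" for v :: "'x \<times> 'y \<times> 'z" by (auto simp: pXY_def pY_def)
  have mY: "map_pmf (map snd) ?A = QY" "map_pmf (map fst) ?B = QY"
    using map_Y[folded Q'] by (simp_all add: map_pmf_comp cY comp_def)
  have "NX * a \<le> N * c"
    using type_size_mult_pmf_le[OF invA sA mw(1), of snd] unfolding mY by (simp add: NX_def a_def N_def c_def cY comp_def)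
  then have a: "a \<le> N * c / NX" using N by (simp add: pos_le_divide_eq mult.commute)
  have "NZ * b \<le> N * c"
    using type_size_mult_pmf_le[OF invB sB mw(2), of fst] unfolding mY by (simp add: NZ_def b_def N_def c_def cY comp_def)
  then have b: "b \<le> N * c / NZ" using N by (simp add: pos_le_divide_eq mult.commute)
  have c: "N * c \<le> 1"
    unfolding N_def c_def measure_type_class[OF invY QY mw(3), symmetric] by simp
  have ab: "a = c * pmf (QX (map pY w)) (map fst w)" "b = c * pmf (QZ (map pY w)) (map (snd \<circ> snd) w)"
    unfolding a_def b_def c_def Q' by (rule pmf_XY[OF w], rule pmf_YZ[OF w])
  have q: "c * pmf Q w = a * b"
    unfolding Q' pmf_zip3[OF w] ab c_def by simp
  show ?thesis
  proof (cases "c = 0")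
    case True
    then have "pmf Q w = 0" unfolding Q' pmf_zip3[OF w] c_def by simp
    then show ?thesis by (simp add: type_size_pos less_imp_le)
  next
    case False
    then have c0: "c > 0" by (simp add: c_def less_le)
    have "c * pmf Q w \<le> (N * c / NX) * (N * c / NZ)"
      unfolding q using a b c0 N by (intro mult_mono) (auto simp: b_def)
    also have "\<dots> = c * ((N * c) * (N / (NX * NZ)))" by (simp add: field_simps)
    finally have "pmf Q w \<le> (N * c) * (N / (NX * NZ))" using c0 by (simp only: mult_le_cancel_left_pos)
    also have "\<dots> \<le> 1 * (N / (NX * NZ))" using c N by (intro mult_right_mono) auto
    finally show ?thesis by (simp add: N_def NX_def NZ_def)
  qed
qed

section \<open>Memoryless Markov distributions and the type-II bound\<close>

fun channel_power :: "('y \<Rightarrow> 'x pmf) \<Rightarrow> 'y list \<Rightarrow> 'x list pmf" where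
  "channel_power W [] = return_pmf []"
| "channel_power W (y # ys) = map_pmf (\<lambda>(x, xs). x # xs) (pair_pmf (W y) (channel_power W ys))"

lemma set_channel_power: "set_pmf (channel_power W ys) \<subseteq> words (length ys)"
  by (induction ys) (auto simp: words_def)

text \<open>Input and output are read off one word \<open>w\<close>, which keeps their lengths
  equal.\<close>

lemma pmf_channel_power:
  fixes W :: "'y \<Rightarrow> 'x pmf"
  shows "pmf (channel_power W (map g w)) (map f w) = prod_list (map (\<lambda>a. pmf (W (g a)) (f a)) w)"
proof (induction w)
  case (Cons a w)
  have "inj (\<lambda>(x::'x, xs). x # xs)" by (auto simp: inj_def)
  from pmf_map_inj'[OF this, of "pair_pmf (W (g a)) (channel_power W (map g w))" "(f a, map f w)"]
  show ?case by (simp add: pmf_pair Cons)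
qed simp

text \<open>These are the members of the alternative against which bounds valid for every test are
  derived.\<close>

lemma iid_markov_in_markov_perm_inv:
  fixes QX :: "'y::finite \<Rightarrow> 'x::finite pmf" and QZ :: "'y \<Rightarrow> 'z::finite pmf"
  shows "replicate_pmf n (markov_pmf QY QX QZ) \<in> markov_perm_inv n"
proof -
  let ?M = "replicate_pmf n (markov_pmf QY QX QZ)"
  interpret block_markov n "replicate_pmf n QY" "channel_power QX" "channel_power QZ"
    by standard (use set_channel_power in \<open>auto simp: words_def set_replicate_pmf\<close>)
  have "?M = Q"
  proof (rule pmf_eqI)
    fix w
    show "pmf ?M w = pmf Q w"
    proof (cases "w \<in> words n")
      case True
      have "iid (pmf (markov_pmf QY QX QZ)) w = iid (pmf QY) (map pY w)
         * prod_list (map (\<lambda>a. pmf (QX (pY a)) (fst a)) w) * prod_list (map (\<lambda>a. pmf (QZ (pY a)) (snd (snd a))) w)"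
        by (induction w) (auto simp: pmf_markov_pmf pY_def)
      then show ?thesis
        unfolding pmf_replicate_words[OF True] pmf_zip3[OF True] pmf_channel_power
        by (simp add: pmf_replicate_words[OF map_in_words[OF True]])
    next
      case False
      then have "w \<notin> set_pmf ?M" "w \<notin> set_pmf Q" using set_replicate_pmf_subset[of n "markov_pmf QY QX QZ"] support_zip3 by auto
      then show ?thesis by (metis pmf_eq_0_set_pmf)
    qed
  qed
  moreover have "permutation_invariant n ?M"
  proof (rule permutation_invariantI[OF set_replicate_pmf_subset])
    fix v w :: "('x \<times> 'y \<times> 'z) list" assume v: "v \<in> words n" and m: "mset v = mset w"
    then have "w \<in> words n" by (auto simp: words_def dest: mset_eq_length)
    then show "pmf ?M v = pmf ?M w"
      unfolding pmf_replicate_words[OF v] by (simp add: pmf_replicate_words iid_cong_mset[OF m])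
  qed
  ultimately show ?thesis
    unfolding markov_perm_inv_def using QY QX QZ by blast
qed

text \<open>The four type class sizes combine to \<open>exp (- n I(emp w))\<close>. The exponent
  collects one polynomial factor for counting types and one for each lower bound on a pair type
  class in the denominator.\<close>

lemma sum_markov_perm_inv_le:
  fixes Q :: "('x::finite \<times> 'y::finite \<times> 'z::finite) list pmf"
  assumes Q: "Q \<in> markov_perm_inv n" and n: "n > 0"
    and B: "B \<subseteq> words n" "\<And>w. w \<in> B \<Longrightarrow> r \<le> mutual_info (emp w)"
  shows "(\<Sum>w\<in>B. pmf Q w) \<le> (exp 1 * (real n + 1)) ^ (CARD('x \<times> 'y \<times> 'z) + CARD('x \<times> 'y) + CARD('y \<times> 'z)) * exp (- (real n * r))"
proof -
  let ?e = "exp 1 * (real n + 1)"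
  let ?c = "?e ^ (CARD('x \<times> 'y) + CARD('y \<times> 'z)) * exp (- (real n * r))"
  have bound: "pmf Q w * type_size w \<le> ?c" if wB: "w \<in> B" for w
  proof -
    have w: "w \<in> words n" "length w = n" using wB B(1) by (auto simp: words_def)
    have ne: "w \<noteq> []" using w n by auto
    have "pmf Q w * type_size w \<le> type_size (map pY w) / (type_size (map pXY w) * type_size (map snd w)) * type_size w"
      by (rule mult_right_mono[OF pmf_markov_perm_inv_le[OF Q w(1)]]) (simp add: type_size_pos less_imp_le)
    also have "\<dots> \<le> exp (n * ent (emp (map pY w))) / ((exp (n * ent (emp (map pXY w))) / ?e ^ CARD('x \<times> 'y))
       * (exp (n * ent (emp (map snd w))) / ?e ^ CARD('y \<times> 'z))) * exp (n * ent (emp w))"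
    proof (intro mult_mono frac_le)
      show "type_size (map pY w) \<le> exp (n * ent (emp (map pY w)))" "type_size w \<le> exp (n * ent (emp w))"
        using type_size_le[of "map pY w"] type_size_le[of w] ne w by auto
      show "exp (n * ent (emp (map pXY w))) / ?e ^ CARD('x \<times> 'y) \<le> type_size (map pXY w)"
        using type_size_ge[of "map pXY w"] ne w by (simp add: pos_divide_le_eq mult.commute)
      show "exp (n * ent (emp (map snd w))) / ?e ^ CARD('y \<times> 'z) \<le> type_size (map snd w)"
        using type_size_ge[of "map snd w"] ne w by (simp add: pos_divide_le_eq mult.commute)
    qed (auto simp: type_size_pos less_imp_le intro!: mult_pos_pos divide_pos_pos)
    also have "\<dots> = ?e ^ (CARD('x \<times> 'y) + CARD('y \<times> 'z)) * exp (- (real n * mutual_info (emp w)))"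
      unfolding mutual_info_def marg_emp
      by (simp add: power_add exp_diff exp_add exp_minus right_diff_distrib distrib_left divide_simps)
    also have "\<dots> \<le> ?c" using B(2)[OF wB] n by (intro mult_left_mono) auto
    finally show ?thesis .
  qed
  have "(\<Sum>w\<in>B. pmf Q w) \<le> (real n + 1) ^ CARD('x \<times> 'y \<times> 'z) * ?c"
    by (rule sum_le_types[OF B(1) _ bound]) auto
  also have "\<dots> \<le> ?e ^ CARD('x \<times> 'y \<times> 'z) * ?c"
    by (intro mult_right_mono power_mono) (auto simp: mult_le_cancel_right1)
  finally show ?thesis by (simp add: power_add mult_ac)
qed

subsection \<open>Optimal tests\<close>

lemma feasible_iff:
  assumes "is_test n T"
  shows "type2_error (markov_perm_inv n) n T \<le> \<mu> \<longleftrightarrow> (\<forall>Q\<in>markov_perm_inv n. (\<Sum>w\<in>words n. pmf Q w * T w) \<le> \<mu>)"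
  by (rule type2_error_le_iff[OF markov_perm_inv_nonempty assms])

lemma type1_error_eq: "type1_error P n T = (\<Sum>w\<in>words n. iid (pmf P) w * (1 - T w))"
  unfolding type1_error_def by (intro sum.cong) (simp_all add: pmf_replicate_words)

lemma sum_iid_prob_simplex: "V \<in> prob_simplex \<Longrightarrow> (\<Sum>w\<in>words n. iid V w) = 1"
  by (simp add: sum_iid prob_simplex_sum)

lemma sum_iid_complement:
  "V \<in> prob_simplex \<Longrightarrow> (\<Sum>w\<in>words n. iid V w * (1 - T w)) = 1 - (\<Sum>w\<in>words n. iid V w * T w)"
  by (simp add: right_diff_distrib sum_subtractf sum_iid_prob_simplex)

lemma type1_error_nonneg: "is_test n T \<Longrightarrow> 0 \<le> type1_error P n T"
  unfolding type1_error_eq by (intro sum_nonneg mult_nonneg_nonneg iid_nonneg) (auto simp: is_test_def)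

lemma min_type1_error_le:
  assumes "is_test n T" "\<And>Q. Q \<in> markov_perm_inv n \<Longrightarrow> (\<Sum>w\<in>words n. pmf Q w * T w) \<le> \<mu>"
  shows "min_type1_error P markov_perm_inv n \<mu> \<le> type1_error P n T"
  unfolding min_type1_error_def
proof (rule cInf_lower)
  show "type1_error P n T \<in> type1_error P n ` {T. is_test n T \<and> type2_error (markov_perm_inv n) n T \<le> \<mu>}"
    using assms feasible_iff[OF assms(1)] by blast
  show "bdd_below (type1_error P n ` {T. is_test n T \<and> type2_error (markov_perm_inv n) n T \<le> \<mu>})"
    by (intro bdd_belowI[of _ 0]) (auto simp: type1_error_nonneg)
qed

lemma le_min_type1_error:
  assumes "0 \<le> \<mu>"
    and "\<And>T. is_test n T \<Longrightarrow> (\<And>Q. Q \<in> markov_perm_inv n \<Longrightarrow> (\<Sum>w\<in>words n. pmf Q w * T w) \<le> \<mu>) \<Longrightarrow> c \<le> type1_error P n T"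
  shows "c \<le> min_type1_error P markov_perm_inv n \<mu>"
proof -
  from min_type1_error_attained[of markov_perm_inv n \<mu> P, OF markov_perm_inv_nonempty assms(1)]
  obtain T where T: "is_test n T" "type2_error (markov_perm_inv n) n T \<le> \<mu>"
      "type1_error P n T = min_type1_error P markov_perm_inv n \<mu>"
    by (elim exE conjE)
  show ?thesis unfolding T(3)[symmetric] using T(2) feasible_iff[OF T(1)] by (intro assms(2) T(1)) auto
qed

lemma min_type1_error_le_1:
  assumes "0 \<le> \<mu>" shows "min_type1_error P markov_perm_inv n \<mu> \<le> 1"
proof -
  have "min_type1_error P markov_perm_inv n \<mu> \<le> type1_error P n (\<lambda>_. 0)"
    using assms by (intro min_type1_error_le) (auto simp: is_test_def)
  also have "\<dots> = 1" unfolding type1_error_eq by (simp add: sum_iid_prob_simplex pmf_in_prob_simplex)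
  finally show ?thesis .
qed

lemma min_type1_error_nonneg:
  assumes "0 \<le> \<mu>" shows "0 \<le> min_type1_error P markov_perm_inv n \<mu>"
  by (rule le_min_type1_error[OF assms]) (rule type1_error_nonneg)

subsection \<open>Change of measure\<close>

text \<open>The \<open>V\<close>-probability that the log-likelihood ratio of \<open>V\<close> to
  \<open>W\<close> deviates from its mean, which is D(V||W) if \<open>W\<close> is positive on the
  support of \<open>V\<close>.\<close>

definition llr_tail :: "('a::finite \<Rightarrow> real) \<Rightarrow> ('a \<Rightarrow> real) \<Rightarrow> real \<Rightarrow> nat \<Rightarrow> real" where
  "llr_tail V W e n = (\<Sum>w | w \<in> words n \<and> real n * e \<le> \<bar>sum_list (map (\<lambda>a. ln (V a) - ln (W a)) w)
     - real n * (\<Sum>a\<in>UNIV. V a * (ln (V a) - ln (W a)))\<bar>. iid V w)"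

lemma llr_tail_tendsto: "V \<in> prob_simplex \<Longrightarrow> e > 0 \<Longrightarrow> llr_tail V W e \<longlonglongrightarrow> 0"
  unfolding llr_tail_def by (rule weak_law)

text \<open>Off the tail event the likelihood ratio is at most \<open>exp (n (D + e))\<close>; on it
  the test is bounded by 1.\<close>

lemma change_of_measure:
  fixes V W :: "'a::finite \<Rightarrow> real"
  assumes V: "V \<in> prob_simplex" and W: "\<And>a. 0 \<le> W a" "\<And>a. V a > 0 \<Longrightarrow> W a > 0"
    and D: "D = (\<Sum>a\<in>UNIV. V a * (ln (V a) - ln (W a)))" and T: "is_test n T"
  shows "(\<Sum>w\<in>words n. iid V w * T w) \<le> llr_tail V W e n + exp (real n * (D + e)) * (\<Sum>w\<in>words n. iid W w * T w)"
proof -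
  let ?f = "\<lambda>a. ln (V a) - ln (W a)"
  let ?B = "{w. w \<in> words n \<and> real n * e \<le> \<bar>sum_list (map ?f w) - real n * D\<bar>}"
  have nn: "0 \<le> iid V w" "0 \<le> iid W w" for w by (rule iid_nonneg, rule prob_simplex_nonneg[OF V], rule iid_nonneg, rule W)
  have "iid V w * T w \<le> (if w \<in> ?B then iid V w else 0) + exp (real n * (D + e)) * (iid W w * T w)" if w: "w \<in> words n" for w
  proof -
    have Tw: "0 \<le> T w" "T w \<le> 1" using T w by (auto simp: is_test_def)
    show ?thesis
    proof (cases "w \<in> ?B")
      case True
      have "iid V w * T w \<le> iid V w" using Tw nn by (simp add: mult_left_le)
      moreover have "0 \<le> exp (real n * (D + e)) * (iid W w * T w)" using Tw nn by simp
      ultimately show ?thesis using True by simp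
    next
      case nB: False
      have "iid V w \<le> exp (real n * (D + e)) * iid W w"
      proof (cases "\<forall>a\<in>set w. V a > 0")
        case True
        have "iid V w = exp (sum_list (map ?f w)) * iid W w"
          using True W(2) by (simp add: iid_eq_exp exp_add[symmetric] sum_list_subtractf)
        moreover have "sum_list (map ?f w) \<le> real n * (D + e)" using nB w by (auto simp: distrib_left)
        ultimately show ?thesis using nn by (simp add: mult_right_mono)
      next
        case False
        then obtain a where "a \<in> set w" "V a = 0" using prob_simplex_nonneg[OF V] by (force simp: less_le)
        then show ?thesis using nn by (simp add: iid_eq_0)
      qed
      then have "iid V w * T w \<le> exp (real n * (D + e)) * iid W w * T w" using Tw by (intro mult_right_mono) auto
      then show ?thesis unfolding if_not_P[OF nB] by (simp add: mult.assoc)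
    qed
  qed
  then have "(\<Sum>w\<in>words n. iid V w * T w) \<le> (\<Sum>w\<in>words n. (if w \<in> ?B then iid V w else 0) + exp (real n * (D + e)) * (iid W w * T w))"
    by (intro sum_mono)
  also have "\<dots> = llr_tail V W e n + exp (real n * (D + e)) * (\<Sum>w\<in>words n. iid W w * T w)"
    by (simp add: sum.distrib sum_distrib_left llr_tail_def D sum.inter_filter[symmetric])
  finally show ?thesis .
qed

lemma change_of_measure_null:
  fixes V :: "'a::finite \<Rightarrow> real"
  assumes V: "V \<in> ac_simplex P" and T: "is_test n T"
    and half: "llr_tail V (pmf P) e n + 1/2 \<le> (\<Sum>w\<in>words n. iid V w * T w)"
  shows "exp (- (real n * (rel_ent V P + e))) / 2 \<le> (\<Sum>w\<in>words n. iid (pmf P) w * T w)"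
proof -
  have "1/2 \<le> exp (real n * (rel_ent V P + e)) * (\<Sum>w\<in>words n. iid (pmf P) w * T w)"
    using change_of_measure[OF ac_simplexD(1)[OF V] pmf_nonneg ac_simplexD(4)[OF V] rel_ent_def[of V P] T, of e] half
    by linarith
  then have "exp (- (real n * (rel_ent V P + e))) * (1/2)
      \<le> exp (- (real n * (rel_ent V P + e))) * (exp (real n * (rel_ent V P + e)) * (\<Sum>w\<in>words n. iid (pmf P) w * T w))"
    by (intro mult_left_mono) auto
  then show ?thesis by (simp add: mult.assoc[symmetric] exp_add[symmetric])
qed

text \<open>Half of the gap \<open>r - mutual_info V\<close> pays for the deviation of the
  likelihood ratio, the other half survives as exponential decay.\<close>

definition converse_bound :: "('x::finite \<times> 'y::finite \<times> 'z::finite \<Rightarrow> real) \<Rightarrow> real \<Rightarrow> nat \<Rightarrow> real" where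
  "converse_bound V r n = llr_tail V (markov_proj V) ((r - mutual_info V) / 2) n + exp (- (real n * ((r - mutual_info V) / 2)))"

lemma exp_decay: "d > 0 \<Longrightarrow> (\<lambda>n. exp (- (real n * d))) \<longlonglongrightarrow> 0"
  by real_asymp

lemma converse_bound_tendsto:
  assumes "V \<in> prob_simplex" "mutual_info V < r"
  shows "converse_bound V r \<longlonglongrightarrow> 0"
proof -
  have "(r - mutual_info V) / 2 > 0" using assms by simp
  from tendsto_add[OF llr_tail_tendsto[OF assms(1) this] exp_decay[OF this]]
  show ?thesis unfolding converse_bound_def by simp
qed

text \<open>Change of measure from \<open>V\<close> to the memoryless power of its Markov
  projection: that power is in the alternative, and the divergence per letter is
  \<open>mutual_info V\<close>.\<close>

lemma converse_bound:
  fixes V :: "'x::finite \<times> 'y::finite \<times> 'z::finite \<Rightarrow> real"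
  assumes V: "V \<in> prob_simplex" and T: "is_test n T"
    and f: "\<And>Q. Q \<in> markov_perm_inv n \<Longrightarrow> (\<Sum>w\<in>words n. pmf Q w * T w) \<le> exp (- (real n * r))"
  shows "(\<Sum>w\<in>words n. iid V w * T w) \<le> converse_bound V r n"
proof -
  let ?e = "(r - mutual_info V) / 2"
  obtain QY QX QZ where Q: "pmf (markov_pmf QY QX QZ) = markov_proj V"
    using ex_markov_pmf_proj[OF V] .
  have "(\<Sum>w\<in>words n. iid (markov_proj V) w * T w) = (\<Sum>w\<in>words n. pmf (replicate_pmf n (markov_pmf QY QX QZ)) w * T w)"
    by (intro sum.cong) (simp_all add: pmf_replicate_words Q)
  also have "\<dots> \<le> exp (- (real n * r))" by (rule f[OF iid_markov_in_markov_perm_inv])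
  finally have "exp (real n * (mutual_info V + ?e)) * (\<Sum>w\<in>words n. iid (markov_proj V) w * T w)
     \<le> exp (real n * (mutual_info V + ?e)) * exp (- (real n * r))" by simp
  also have "\<dots> = exp (- (real n * ?e))" unfolding exp_add[symmetric] by (simp add: field_simps)
  finally show ?thesis
    using change_of_measure[OF V _ markov_proj_pos mutual_info_eq[OF V] T, of ?e] prob_simplex_nonneg[OF V]
      pmf_nonneg[of "markov_pmf QY QX QZ"]
    unfolding converse_bound_def Q by force
qed

text \<open>Since \<open>mutual_info V < r\<close>, every admissible test rejects under
  \<open>V\<close> with probability tending to 1; the rejection \<open>1 - T\<close> is then
  transported from \<open>V\<close> to \<open>P\<close>.\<close>

lemma min_type1_error_ge:
  fixes P :: "('x::finite \<times> 'y::finite \<times> 'z::finite) pmf"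
  assumes V: "V \<in> ac_simplex P" and r: "mutual_info V < r" and e: "e > 0"
  shows "eventually (\<lambda>n. exp (- (real n * (rel_ent V P + e))) / 2
     \<le> min_type1_error P markov_perm_inv n (exp (- (real n * r)))) sequentially"
proof -
  note Vs = ac_simplexD(1)[OF V]
  have "(\<lambda>n. converse_bound V r n + llr_tail V (pmf P) e n) \<longlonglongrightarrow> 0 + 0"
    by (intro tendsto_add converse_bound_tendsto llr_tail_tendsto Vs r e)
  then have "eventually (\<lambda>n. converse_bound V r n + llr_tail V (pmf P) e n < 1/2) sequentially"
    by (rule order_tendstoD(2)) simp
  then show ?thesis
  proof eventually_elim
    case (elim n)
    show ?case
    proof (rule le_min_type1_error)
      fix T :: "('x \<times> 'y \<times> 'z) list \<Rightarrow> real" assume T: "is_test n T" and f: "\<And>Q. Q \<in> markov_perm_inv n \<Longrightarrow> (\<Sum>w\<in>words n. pmf Q w * T w) \<le> exp (- (real n * r))"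
      have T': "is_test n (\<lambda>w. 1 - T w)" using T by (simp add: is_test_def)
      show "exp (- (real n * (rel_ent V P + e))) / 2 \<le> type1_error P n T"
        unfolding type1_error_eq
        by (rule change_of_measure_null[OF V T'])
           (use converse_bound[OF Vs T f] elim in \<open>simp add: sum_iid_complement[OF Vs]\<close>)
    qed simp
  qed
qed

lemma min_type1_error_tendsto_1:
  fixes P :: "('x::finite \<times> 'y::finite \<times> 'z::finite) pmf"
  assumes r: "mutual_info (pmf P) < r"
  shows "(\<lambda>n. min_type1_error P markov_perm_inv n (exp (- (real n * r)))) \<longlonglongrightarrow> 1"
proof (rule tendsto_sandwich[of "\<lambda>n. 1 - converse_bound (pmf P) r n" _ _ "\<lambda>_. 1"])
  have "(\<lambda>n. 1 - converse_bound (pmf P) r n) \<longlonglongrightarrow> 1 - 0"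
    by (intro tendsto_diff tendsto_const converse_bound_tendsto pmf_in_prob_simplex r)
  then show "(\<lambda>n. 1 - converse_bound (pmf P) r n) \<longlonglongrightarrow> 1" by simp
  show "eventually (\<lambda>n. 1 - converse_bound (pmf P) r n \<le> min_type1_error P markov_perm_inv n (exp (- (real n * r)))) sequentially"
  proof (intro always_eventually allI le_min_type1_error)
    fix n and T :: "('x \<times> 'y \<times> 'z) list \<Rightarrow> real" assume T: "is_test n T" and f: "\<And>Q. Q \<in> markov_perm_inv n \<Longrightarrow> (\<Sum>w\<in>words n. pmf Q w * T w) \<le> exp (- (real n * r))"
    show "1 - converse_bound (pmf P) r n \<le> type1_error P n T"
      unfolding type1_error_eq sum_iid_complement[OF pmf_in_prob_simplex]
      using converse_bound[OF pmf_in_prob_simplex T f] by simp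
  qed simp
qed (auto intro!: always_eventually min_type1_error_le_1)

subsection \<open>The empirical mutual information test\<close>

definition mi_test :: "real \<Rightarrow> ('x::finite \<times> 'y::finite \<times> 'z::finite) list \<Rightarrow> real" where
  "mi_test r w = of_bool (r \<le> mutual_info (emp w))"

lemma is_test_mi_test: "is_test n (mi_test r)"
  by (simp add: is_test_def mi_test_def)

lemma sum_mi_test: "(\<Sum>w\<in>words n. f w * mi_test r w) = (\<Sum>w | w \<in> words n \<and> r \<le> mutual_info (emp w). f w)"
  unfolding mi_test_def of_bool_def by (simp add: if_distrib[of "\<lambda>x. _ * x"] sum.inter_filter[symmetric] cong: if_cong)

lemma sum_mi_test': "(\<Sum>w\<in>words n. f w * (1 - mi_test r w)) = (\<Sum>w | w \<in> words n \<and> mutual_info (emp w) < r. f w)"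
proof -
  have "f w * (1 - mi_test r w) = (if mutual_info (emp w) < r then f w else 0)" for w by (simp add: mi_test_def)
  then show ?thesis by (simp add: sum.inter_filter[symmetric])
qed

lemma poly_le_exp:
  assumes d: "d > 0"
  shows "eventually (\<lambda>n. (exp 1 * (real n + 1)) ^ K \<le> exp (real n * d)) sequentially"
proof -
  have "(\<lambda>n. (1 + ln (real n + 1)) / real n) \<longlonglongrightarrow> 0" by real_asymp
  then have "(\<lambda>n. real K * ((1 + ln (real n + 1)) / real n)) \<longlonglongrightarrow> real K * 0" by (intro tendsto_intros)
  then have "eventually (\<lambda>n. real K * ((1 + ln (real n + 1)) / real n) < d) sequentially"
    using d by (intro order_tendstoD(2)) auto
  then show ?thesis using eventually_gt_at_top[of 0]
  proof eventually_elim
    case (elim n)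
    then have "real K * (1 + ln (real n + 1)) \<le> real n * d" by (simp add: field_simps)
    then have "exp (real K * (1 + ln (real n + 1))) \<le> exp (real n * d)" by simp
    then show ?case by (simp add: exp_of_nat_mult exp_add)
  qed
qed

lemma two_le_exp: "d > 0 \<Longrightarrow> eventually (\<lambda>n. 2 \<le> exp (real n * d)) sequentially"
  by real_asymp

text \<open>The gap between the threshold \<open>r'\<close> and the rate \<open>r\<close> absorbs
  the polynomial factor.\<close>

lemma mi_test_feasible:
  assumes r: "r < r'"
  shows "eventually (\<lambda>n. \<forall>Q\<in>(markov_perm_inv n :: ('x::finite \<times> 'y::finite \<times> 'z::finite) list pmf set).
      (\<Sum>w\<in>words n. pmf Q w * mi_test r' w) \<le> exp (- (real n * r))) sequentially"
proof -
  have "r' - r > 0" using r by simp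
  from poly_le_exp[OF this, of "CARD('x \<times> 'y \<times> 'z) + CARD('x \<times> 'y) + CARD('y \<times> 'z)"] eventually_gt_at_top[of 0]
  show ?thesis
  proof (eventually_elim, intro ballI)
    fix n and Q :: "('x \<times> 'y \<times> 'z) list pmf"
    assume p: "(exp 1 * (real n + 1)) ^ (CARD('x \<times> 'y \<times> 'z) + CARD('x \<times> 'y) + CARD('y \<times> 'z)) \<le> exp (real n * (r' - r))"
      and n: "0 < n" and Q: "Q \<in> markov_perm_inv n"
    have "(\<Sum>w\<in>words n. pmf Q w * mi_test r' w) \<le> (exp 1 * (real n + 1)) ^ (CARD('x \<times> 'y \<times> 'z) + CARD('x \<times> 'y) + CARD('y \<times> 'z)) * exp (- (real n * r'))"
      unfolding sum_mi_test by (rule sum_markov_perm_inv_le[OF Q n]) auto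
    also have "\<dots> \<le> exp (real n * (r' - r)) * exp (- (real n * r'))" using p by (intro mult_right_mono) auto
    also have "\<dots> = exp (- (real n * r))" by (simp add: exp_add[symmetric] algebra_simps)
    finally show "(\<Sum>w\<in>words n. pmf Q w * mi_test r' w) \<le> exp (- (real n * r))" .
  qed
qed

text \<open>Continuity of the mutual information holds relative to the simplex, which contains all
  empirical distributions of nonempty words.\<close>

lemma emp_mutual_info_concentrates:
  fixes V :: "'x::finite \<times> 'y::finite \<times> 'z::finite \<Rightarrow> real"
  assumes V: "V \<in> prob_simplex" and r: "r < mutual_info V"
  shows "(\<lambda>n. \<Sum>w\<in>words n. iid V w * (1 - mi_test r w)) \<longlonglongrightarrow> 0"
proof -
  have nn: "0 \<le> iid V w" for w by (rule iid_nonneg[OF prob_simplex_nonneg[OF V]])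
  obtain S :: "('x \<times> 'y \<times> 'z \<Rightarrow> real) set" where S: "open S" "S \<inter> prob_simplex = mutual_info -` {r<..} \<inter> prob_simplex"
    using continuous_on_open_invariant[THEN iffD1, OF continuous_on_mutual_info, rule_format, of "{r<..}"] by auto
  have VS: "V \<in> S" using S(2) V r by auto
  show ?thesis
  proof (rule tendsto_sandwich[OF _ _ tendsto_const emp_concentrates[OF V S(1) VS]])
    show "eventually (\<lambda>n. (\<Sum>w\<in>words n. iid V w * (1 - mi_test r w)) \<le> (\<Sum>w | w \<in> words n \<and> emp w \<notin> S. iid V w)) sequentially"
      using eventually_gt_at_top[of 0]
    proof eventually_elim
      case (elim n)
      have "emp w \<notin> S" if w: "w \<in> words n" "mutual_info (emp w) < r" for w :: "('x \<times> 'y \<times> 'z) list"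
      proof
        assume "emp w \<in> S"
        moreover have "w \<noteq> []" using w(1) elim by (auto simp: words_def)
        ultimately have "emp w \<in> S \<inter> prob_simplex" by (simp add: emp_in_prob_simplex)
        then show False unfolding S(2) using w(2) by auto
      qed
      then show ?case unfolding sum_mi_test' by (intro sum_mono2) (auto simp: nn)
    qed
    show "eventually (\<lambda>n. 0 \<le> (\<Sum>w\<in>words n. iid V w * (1 - mi_test r w))) sequentially"
      by (auto intro!: always_eventually sum_nonneg mult_nonneg_nonneg nn simp: mi_test_def)
  qed
qed

lemma min_type1_error_tendsto_0:
  fixes P :: "('x::finite \<times> 'y::finite \<times> 'z::finite) pmf"
  assumes r: "r < mutual_info (pmf P)"
  shows "(\<lambda>n. min_type1_error P markov_perm_inv n (exp (- (real n * r)))) \<longlonglongrightarrow> 0"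
proof -
  obtain r' where r': "r < r'" "r' < mutual_info (pmf P)" using dense[OF r] by blast
  show ?thesis
  proof (rule tendsto_sandwich[OF _ _ tendsto_const emp_mutual_info_concentrates[OF pmf_in_prob_simplex r'(2)]])
    show "eventually (\<lambda>n. min_type1_error P markov_perm_inv n (exp (- (real n * r))) \<le> (\<Sum>w\<in>words n. iid (pmf P) w * (1 - mi_test r' w))) sequentially"
      using mi_test_feasible[OF r'(1), where 'x='x and 'y='y and 'z='z]
    proof eventually_elim
      case (elim n)
      then show ?case
        unfolding type1_error_eq[symmetric] by (intro min_type1_error_le is_test_mi_test) auto
    qed
  qed (auto intro!: always_eventually min_type1_error_nonneg)
qed

text \<open>Counterpart of \<open>min_type1_error_ge\<close>: under \<open>V\<close> the empirical
  test accepts with probability tending to 1, and its acceptance is transported to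
  \<open>P\<close>.\<close>

lemma success_ge:
  fixes P :: "('x::finite \<times> 'y::finite \<times> 'z::finite) pmf"
  assumes V: "V \<in> ac_simplex P" and r: "r < mutual_info V" and e: "e > 0"
  shows "eventually (\<lambda>n. exp (- (real n * (rel_ent V P + e))) / 2
     \<le> 1 - min_type1_error P markov_perm_inv n (exp (- (real n * r)))) sequentially"
proof -
  note Vs = ac_simplexD(1)[OF V]
  obtain r' where r': "r < r'" "r' < mutual_info V" using dense[OF r] by blast
  have "(\<lambda>n. (\<Sum>w\<in>words n. iid V w * (1 - mi_test r' w)) + llr_tail V (pmf P) e n) \<longlonglongrightarrow> 0 + 0"
    by (intro tendsto_add emp_mutual_info_concentrates llr_tail_tendsto Vs r' e)
  then have "eventually (\<lambda>n. (\<Sum>w\<in>words n. iid V w * (1 - mi_test r' w)) + llr_tail V (pmf P) e n < 1/2) sequentially"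
    by (rule order_tendstoD(2)) simp
  then show ?thesis using mi_test_feasible[OF r'(1), where 'x='x and 'y='y and 'z='z]
  proof eventually_elim
    case (elim n)
    have "exp (- (real n * (rel_ent V P + e))) / 2 \<le> (\<Sum>w\<in>words n. iid (pmf P) w * mi_test r' w)"
      using elim(1) unfolding sum_iid_complement[OF Vs]
      by (intro change_of_measure_null[OF V is_test_mi_test]) simp
    also have "\<dots> = 1 - type1_error P n (mi_test r')"
      unfolding type1_error_eq sum_iid_complement[OF pmf_in_prob_simplex] by simp
    also have "\<dots> \<le> 1 - min_type1_error P markov_perm_inv n (exp (- (real n * r)))"
      using elim(2) by (intro diff_left_mono min_type1_error_le is_test_mi_test) auto
    finally show ?case .
  qed
qed

text \<open>A rejected word has empirical information below \<open>r'\<close>. There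
  \<open>s < 1\<close> makes the correction in \<open>exponent_at_le\<close> nonpositive, so its
  relative entropy to \<open>P\<close> is at least the exponent; counting types finishes.\<close>

lemma min_type1_error_upper:
  fixes P :: "('x::finite \<times> 'y::finite \<times> 'z::finite) pmf"
  assumes r: "r < r'" and s: "0 < s" "s < 1"
  shows "eventually (\<lambda>n. min_type1_error P markov_perm_inv n (exp (- (real n * r)))
     \<le> (exp 1 * (real n + 1)) ^ CARD('x \<times> 'y \<times> 'z) * exp (- (real n * exponent_at P r' s))) sequentially"
  using mi_test_feasible[OF r, where 'x='x and 'y='y and 'z='z] eventually_gt_at_top[of 0]
proof eventually_elim
  case (elim n)
  have "iid (pmf P) w * type_size w \<le> exp (- (real n * exponent_at P r' s))"
    if w: "w \<in> words n" "mutual_info (emp w) < r'" for w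
  proof (cases "set w \<subseteq> set_pmf P")
    case True
    have ne: "w \<noteq> []" "length w = n" using w elim by (auto simp: words_def)
    have ac: "emp w \<in> ac_simplex P"
      unfolding ac_simplex_def using emp_in_prob_simplex[OF ne(1)] True
      by (auto simp: emp_def set_pmf_iff)
    have "exponent_at P r' s \<le> rel_ent (emp w) P + (s - 1) / s * (r' - mutual_info (emp w))"
      by (rule exponent_at_le[OF ac s(1)])
    moreover have "(s - 1) / s * (r' - mutual_info (emp w)) \<le> 0"
      using s w(2) by (intro mult_nonpos_nonneg) (auto simp: divide_nonpos_pos)
    ultimately have "exponent_at P r' s \<le> rel_ent (emp w) P" by linarith
    then have "exp (- (real n * rel_ent (emp w) P)) \<le> exp (- (real n * exponent_at P r' s))"
      by (simp add: mult_left_mono)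
    then show ?thesis using type_size_mult_iid_le_exp[OF ne(1) True] unfolding ne(2) by linarith
  next
    case False
    then obtain a where "a \<in> set w" "pmf P a = 0" by (auto simp: set_pmf_iff)
    then show ?thesis by (simp add: iid_eq_0)
  qed
  then have "(\<Sum>w | w \<in> words n \<and> mutual_info (emp w) < r'. iid (pmf P) w)
     \<le> (real n + 1) ^ CARD('x \<times> 'y \<times> 'z) * exp (- (real n * exponent_at P r' s))"
    by (intro sum_le_types) auto
  also have "\<dots> \<le> (exp 1 * (real n + 1)) ^ CARD('x \<times> 'y \<times> 'z) * exp (- (real n * exponent_at P r' s))"
    by (intro mult_right_mono power_mono) (auto simp: mult_le_cancel_right1)
  finally have "type1_error P n (mi_test r') \<le> (exp 1 * (real n + 1)) ^ CARD('x \<times> 'y \<times> 'z) * exp (- (real n * exponent_at P r' s))"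
    unfolding type1_error_eq sum_mi_test' .
  moreover have "min_type1_error P markov_perm_inv n (exp (- (real n * r))) \<le> type1_error P n (mi_test r')"
    using elim(1) by (intro min_type1_error_le is_test_mi_test) auto
  ultimately show ?case by linarith
qed

lemma iid_mult: "iid (\<lambda>a. f a * g a) w = iid f w * iid g w" for f g :: "'a \<Rightarrow> real"
  by (induction w) auto

lemma iid_powr: "(\<And>a. 0 \<le> f a) \<Longrightarrow> iid (\<lambda>a. f a powr s) w = iid f w powr s" for f :: "'a \<Rightarrow> real"
  by (induction w) (auto simp: powr_mult iid_nonneg)

text \<open>The test is compared with the memoryless power of the Markov distribution optimal for
  \<open>s\<close>, splitting words by whether the likelihood ratio exceeds
  \<open>l\<close>.\<close>

lemma success_le:
  fixes P :: "('x::finite \<times> 'y::finite \<times> 'z::finite) pmf"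
  assumes s: "s > 1"
  shows "1 - min_type1_error P markov_perm_inv n (exp (- (real n * r))) \<le> 2 * exp (- (real n * exponent_at P r s))"
proof -
  obtain QY QX QZ where Q: "pmf (markov_pmf QY QX QZ) = markov_proj (maximizer P s)"
    using ex_markov_pmf_proj[OF ac_simplexD(1)[OF maximizer(1)]] .
  let ?Q = "markov_pmf QY QX QZ"
  have S: "tilt_sum P s ?Q > 0" "set_pmf P \<subseteq> set_pmf ?Q" "ln (tilt_sum P s ?Q) = max_variational P s"
    using tilt_sum_markov_proj[OF _ Q] s by auto
  \<comment> \<open>Chosen to balance the two parts: \<open>l1\<close> and \<open>l2\<close> show
    that both equal \<open>exp (- n E)\<close> with \<open>E\<close> the exponent, hence the
    constant 2.\<close>
  define l where "l = exp (real n * ((r + max_variational P s) / s))"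
  have l: "l > 0" by (simp add: l_def)
  have l1: "l * exp (- (real n * r)) = exp (- (real n * exponent_at P r s))"
    unfolding l_def exp_add[symmetric] exponent_at_def using s by (simp add: field_simps)
  have l2: "l powr (1 - s) * tilt_sum P s ?Q ^ n = exp (- (real n * exponent_at P r s))"
  proof -
    have "tilt_sum P s ?Q ^ n = exp (real n * max_variational P s)"
      unfolding S(3)[symmetric] using S(1) by (simp add: exp_of_nat_mult)
    then show ?thesis
      unfolding l_def exp_powr_real exponent_at_def using s by (simp add: exp_add[symmetric] field_simps)
  qed
  have tilt: "(\<Sum>w\<in>words n. iid (pmf P) w powr s * iid (pmf ?Q) w powr (1 - s)) = tilt_sum P s ?Q ^ n"
  proof -
    have ts: "tilt_sum P s ?Q = (\<Sum>a\<in>UNIV. pmf P a powr s * pmf ?Q a powr (1 - s))"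
      unfolding tilt_sum_def by (rule sum.mono_neutral_left) (auto simp: set_pmf_iff)
    show ?thesis unfolding ts sum_iid[symmetric] iid_mult by (simp add: iid_powr)
  qed
  have "1 - 2 * exp (- (real n * exponent_at P r s)) \<le> min_type1_error P markov_perm_inv n (exp (- (real n * r)))"
  proof (rule le_min_type1_error)
    fix T :: "('x \<times> 'y \<times> 'z) list \<Rightarrow> real" assume T: "is_test n T" and f: "\<And>Q. Q \<in> markov_perm_inv n \<Longrightarrow> (\<Sum>w\<in>words n. pmf Q w * T w) \<le> exp (- (real n * r))"
    have pw: "iid (pmf P) w * T w \<le> l * (iid (pmf ?Q) w * T w) + l powr (1 - s) * (iid (pmf P) w powr s * iid (pmf ?Q) w powr (1 - s))"
      if w: "w \<in> words n" for w
    proof -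
      define p q where "p = iid (pmf P) w" and "q = iid (pmf ?Q) w"
      have nn: "0 \<le> p" "0 \<le> q" by (auto simp: p_def q_def iid_nonneg)
      have Tw: "0 \<le> T w" "T w \<le> 1" using T w by (auto simp: is_test_def)
      \<comment> \<open>If \<open>p > l * q\<close>, then \<open>(p / (l * q)) powr (s - 1) > 1\<close>; summing both cases replaces Hoelder's inequality.\<close>
      show ?thesis unfolding p_def[symmetric] q_def[symmetric]
      proof (cases "p \<le> l * q")
        case True
        then have "p * T w \<le> l * q * T w" using Tw by (intro mult_right_mono) auto
        then show "p * T w \<le> l * (q * T w) + l powr (1 - s) * (p powr s * q powr (1 - s))"
          by (simp add: mult.assoc add_increasing2)
      next
        case False
        then have p: "p > 0" using l nn by (smt (verit) mult_nonneg_nonneg)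
        then have "set w \<subseteq> set_pmf P" unfolding p_def using iid_eq_0[of _ w "pmf P"] by (force simp: set_pmf_iff)
        then have q: "q > 0" unfolding q_def using S(2) by (intro iid_pos) (auto simp: pmf_positive_iff)
        have "(l * q) powr (s - 1) \<le> p powr (s - 1)" using False l q s by (intro powr_mono2) auto
        then have "p * (l * q) powr (s - 1) \<le> p powr s"
          using p by (simp add: powr_diff mult_left_mono pos_le_divide_eq mult.commute)
        then have "p \<le> p powr s / (l * q) powr (s - 1)" using l q by (simp add: pos_le_divide_eq)
        also have "\<dots> = l powr (1 - s) * (p powr s * q powr (1 - s))"
          using l q by (simp add: powr_mult powr_diff field_simps)
        finally have "p * T w \<le> l powr (1 - s) * (p powr s * q powr (1 - s))"
          using Tw p by (smt (verit) mult_left_le)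
        moreover have "0 \<le> l * (q * T w)" using l q Tw by simp
        ultimately show "p * T w \<le> l * (q * T w) + l powr (1 - s) * (p powr s * q powr (1 - s))" by linarith
      qed
    qed
    have fQ: "(\<Sum>w\<in>words n. iid (pmf ?Q) w * T w) \<le> exp (- (real n * r))"
      using f[OF iid_markov_in_markov_perm_inv[of n QY QX QZ]] by (simp add: pmf_replicate_words cong: sum.cong)
    have "(\<Sum>w\<in>words n. iid (pmf P) w * T w) \<le> (\<Sum>w\<in>words n. l * (iid (pmf ?Q) w * T w) + l powr (1 - s) * (iid (pmf P) w powr s * iid (pmf ?Q) w powr (1 - s)))"
      by (intro sum_mono pw)
    also have "\<dots> = l * (\<Sum>w\<in>words n. iid (pmf ?Q) w * T w) + l powr (1 - s) * tilt_sum P s ?Q ^ n"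
      unfolding sum.distrib sum_distrib_left[symmetric] tilt ..
    also have "\<dots> \<le> l * exp (- (real n * r)) + l powr (1 - s) * tilt_sum P s ?Q ^ n"
      using fQ l by simp
    also have "\<dots> = 2 * exp (- (real n * exponent_at P r s))" unfolding l1 l2 by simp
    finally show "1 - 2 * exp (- (real n * exponent_at P r s)) \<le> type1_error P n T"
      unfolding type1_error_eq sum_iid_complement[OF pmf_in_prob_simplex] by simp
  qed simp
  then show ?thesis by simp
qed

subsection \<open>Rates\<close>

lemma rate_ge:
  assumes b: "b > 1" and n: "n > 0" and x: "x \<le> exp (- (real n * c))"
  shows "ereal (c / ln b) \<le> - (ereal (1 / real n) * elog b x)"
proof (cases "x \<le> 0")
  case True
  then show ?thesis using n by (simp add: elog_def)
next
  case False
  then have "ln x \<le> - (real n * c)" using x by (metis exp_gt_zero ln_exp ln_le_cancel_iff not_le)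
  then have "c \<le> - (ln x / real n)" using n by (simp add: field_simps)
  then have "c / ln b \<le> - (ln x / real n) / ln b" using b by (intro divide_right_mono) auto
  then show ?thesis using False by (simp add: elog_def log_def mult.commute)
qed

lemma rate_le:
  assumes b: "b > 1" and n: "n > 0" and x: "exp (- (real n * c)) \<le> x"
  shows "- (ereal (1 / real n) * elog b x) \<le> ereal (c / ln b)"
proof -
  have x0: "x > 0" using x exp_gt_zero less_le_trans by blast
  then have "- (real n * c) \<le> ln x" using x by (simp add: ln_ge_iff)
  then have "- (ln x / real n) \<le> c" using n by (simp add: field_simps)
  then have "- (ln x / real n) / ln b \<le> c / ln b" using b by (intro divide_right_mono) auto
  then show ?thesis using x0 by (simp add: elog_def log_def mult.commute)
qed

lemma liminf_rate_ge:
  assumes b: "b > 1" and x: "eventually (\<lambda>n. x n \<le> exp (- (real n * c))) sequentially"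
  shows "ereal (c / ln b) \<le> liminf (\<lambda>n. - (ereal (1 / real n) * elog b (x n)))"
  by (rule Liminf_bounded) (use x eventually_gt_at_top[of 0] in \<open>eventually_elim, auto intro: rate_ge[OF b]\<close>)

lemma limsup_rate_le:
  assumes b: "b > 1" and x: "eventually (\<lambda>n. exp (- (real n * c)) \<le> x n) sequentially"
  shows "limsup (\<lambda>n. - (ereal (1 / real n) * elog b (x n))) \<le> ereal (c / ln b)"
  by (rule Limsup_bounded) (use x eventually_gt_at_top[of 0] in \<open>eventually_elim, auto intro: rate_le[OF b]\<close>)

lemma powr_minus_eq_exp: "b > 1 \<Longrightarrow> b powr (- real n * R) = exp (- (real n * (R * ln b)))"
  by (simp add: powr_def)

lemma half_exp_ge:
  assumes e: "e > 0"
  shows "eventually (\<lambda>n. exp (- (real n * (c + e))) \<le> exp (- (real n * c)) / 2) sequentially"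
  using two_le_exp[OF e]
proof eventually_elim
  case (elim n)
  have "exp (- (real n * (c + e))) * 2 \<le> exp (- (real n * (c + e))) * exp (real n * e)"
    using elim by (intro mult_left_mono) auto
  also have "\<dots> = exp (- (real n * c))" by (simp add: exp_add[symmetric] algebra_simps)
  finally show ?case by simp
qed

lemma error_exponent_le:
  assumes b: "b > 1" and V: "V \<in> ac_simplex P" and r: "mutual_info V < R * ln b" and e: "e > 0"
  shows "error_exponent b P markov_perm_inv R \<le> ereal ((rel_ent V P + e) / ln b)"
proof -
  have e2: "e / 2 > 0" using e by simp
  have "eventually (\<lambda>n. exp (- (real n * (rel_ent V P + e))) \<le> min_type1_error P markov_perm_inv n (b powr (- real n * R))) sequentially"
    using min_type1_error_ge[OF V r e2] half_exp_ge[OF e2, of "rel_ent V P + e / 2"]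
  proof eventually_elim
    case (elim n)
    then show ?case unfolding powr_minus_eq_exp[OF b] by (simp add: add.assoc)
  qed
  from limsup_rate_le[OF b this] show ?thesis
    unfolding error_exponent_def using Liminf_le_Limsup[OF sequentially_bot] order_trans by blast
qed

lemma strong_converse_exponent_le:
  assumes b: "b > 1" and V: "V \<in> ac_simplex P" and r: "R * ln b < mutual_info V" and e: "e > 0"
  shows "strong_converse_exponent b P markov_perm_inv R \<le> ereal ((rel_ent V P + e) / ln b)"
proof -
  have e2: "e / 2 > 0" using e by simp
  have "eventually (\<lambda>n. exp (- (real n * (rel_ent V P + e))) \<le> 1 - min_type1_error P markov_perm_inv n (b powr (- real n * R))) sequentially"
    using success_ge[OF V r e2] half_exp_ge[OF e2, of "rel_ent V P + e / 2"]
  proof eventually_elim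
    case (elim n)
    then show ?case unfolding powr_minus_eq_exp[OF b] by (simp add: add.assoc)
  qed
  from limsup_rate_le[OF b this] show ?thesis
    unfolding strong_converse_exponent_def .
qed

lemma error_exponent_ge:
  assumes b: "b > 1" and s: "0 < s" "s < 1"
  shows "ereal (exponent_at P (R * ln b) s / ln b) \<le> error_exponent b P markov_perm_inv R"
proof (rule ereal_le_epsilon2)
  fix e :: real assume e: "e > 0"
  define d where "d = e * ln b / 2"
  have d: "d > 0" using e b by (simp add: d_def)
  \<comment> \<open>\<open>exponent_at\<close> is affine in the rate with slope
    \<open>(s - 1) / s\<close>, so this shift lowers it by exactly \<open>d\<close>. A second
    \<open>d\<close> absorbs the polynomial factor.\<close>
  define r r' where "r = R * ln b" and "r' = r + d * s / (1 - s)"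
  have r': "r < r'" using s d by (simp add: r'_def)
  have E: "exponent_at P r' s = exponent_at P r s - d"
    using s by (simp add: exponent_at_def r'_def field_simps)
  have "eventually (\<lambda>n. min_type1_error P markov_perm_inv n (b powr (- real n * R)) \<le> exp (- (real n * (exponent_at P r s - 2 * d)))) sequentially"
    using min_type1_error_upper[OF r' s, of P] poly_le_exp[OF d, of "CARD('a \<times> 'b \<times> 'c)"]
  proof eventually_elim
    case (elim n)
    have "min_type1_error P markov_perm_inv n (exp (- (real n * r))) \<le> exp (real n * d) * exp (- (real n * exponent_at P r' s))"
      by (rule order_trans[OF elim(1) mult_right_mono[OF elim(2)]]) simp
    also have "\<dots> = exp (- (real n * (exponent_at P r s - 2 * d)))"
      unfolding E exp_add[symmetric] by (simp add: algebra_simps)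
    finally show ?case unfolding powr_minus_eq_exp[OF b] r_def .
  qed
  from liminf_rate_ge[OF b this]
  have "ereal ((exponent_at P r s - 2 * d) / ln b) \<le> error_exponent b P markov_perm_inv R"
    unfolding error_exponent_def .
  moreover have "(exponent_at P r s - 2 * d) / ln b = exponent_at P r s / ln b - e"
    using b by (simp add: d_def field_simps)
  ultimately show "ereal (exponent_at P (R * ln b) s / ln b) \<le> error_exponent b P markov_perm_inv R + ereal e"
    unfolding r_def by (cases "error_exponent b P markov_perm_inv R") auto
qed

lemma strong_converse_exponent_ge:
  assumes b: "b > 1" and s: "1 < s"
  shows "ereal (exponent_at P (R * ln b) s / ln b) \<le> strong_converse_exponent b P markov_perm_inv R"
proof (rule ereal_le_epsilon2)
  fix e :: real assume e: "e > 0"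
  define d where "d = e * ln b"
  have d: "d > 0" using e b by (simp add: d_def)
  define r where "r = R * ln b"
  have "eventually (\<lambda>n. 1 - min_type1_error P markov_perm_inv n (b powr (- real n * R)) \<le> exp (- (real n * (exponent_at P r s - d)))) sequentially"
    using half_exp_ge[OF d, of "exponent_at P r s - d"]
  proof eventually_elim
    case (elim n)
    then show ?case using success_le[OF s, of P n r] unfolding powr_minus_eq_exp[OF b] r_def by simp
  qed
  from liminf_rate_ge[OF b this]
  have "ereal ((exponent_at P r s - d) / ln b) \<le> strong_converse_exponent b P markov_perm_inv R"
    unfolding strong_converse_exponent_def using Liminf_le_Limsup[OF sequentially_bot] order_trans by blast
  moreover have "(exponent_at P r s - d) / ln b = exponent_at P r s / ln b - e"
    using b by (simp add: d_def field_simps)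
  ultimately show "ereal (exponent_at P (R * ln b) s / ln b) \<le> strong_converse_exponent b P markov_perm_inv R + ereal e"
    unfolding r_def by (cases "strong_converse_exponent b P markov_perm_inv R") auto
qed

lemma exponent_term_below:
  assumes b: "b > 1" and s: "0 < s" "s < 1"
  shows "ereal ((1 - s) / s) * (renyi_cmi b s P - ereal R) = ereal (exponent_at P (R * ln b) s / ln b)"
proof -
  have "(1 - s) / s * (max_variational P s / ((s - 1) * ln b) - R) = exponent_at P (R * ln b) s / ln b"
    using s b by (simp add: exponent_at_def divide_simps) (simp add: algebra_simps)
  then show ?thesis using s b by (simp add: renyi_cmi_eq(1))
qed

lemma exponent_term_above:
  assumes b: "b > 1" and s: "1 < s"
  shows "ereal ((s - 1) / s) * (ereal R - renyi_cmi b s P) = ereal (exponent_at P (R * ln b) s / ln b)"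
proof -
  have "(s - 1) / s * (R - max_variational P s / ((s - 1) * ln b)) = exponent_at P (R * ln b) s / ln b"
    using s b by (simp add: exponent_at_def divide_simps)
  then show ?thesis using s b by (simp add: renyi_cmi_eq(1))
qed

lemma error_exponent_eq:
  assumes b: "b > 1" and R: "ereal R > R_two_thirds b P"
  shows "error_exponent b P markov_perm_inv R = (SUP s\<in>{2/3<..<1}. ereal ((1 - s) / s) * (renyi_cmi b s P - ereal R))"
proof -
  let ?E = "\<lambda>s. ereal (exponent_at P (R * ln b) s / ln b)"
  have L: "ln b > 0" using b by simp
  have "(SUP s\<in>{2/3<..<1}. ereal ((1 - s) / s) * (renyi_cmi b s P - ereal R)) = (SUP s\<in>{2/3<..<1}. ?E s)"
    by (intro SUP_cong refl exponent_term_below[OF b]) auto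
  moreover have "error_exponent b P markov_perm_inv R = (SUP s\<in>{2/3<..<1}. ?E s)"
  proof (rule antisym)
    show "(SUP s\<in>{2/3<..<1}. ?E s) \<le> error_exponent b P markov_perm_inv R"
      by (intro SUP_least error_exponent_ge[OF b]) auto
    \<comment> \<open>The condition on \<open>R\<close> supplies \<open>s0 > 2/3\<close> whose
      maximiser has information below the rate, the starting point of
      \<open>exponent_approx_below\<close>.\<close>
    have "eventually (\<lambda>s. critical_rate b P s < ereal R \<and> 2/3 < s) (at_right (2/3))"
      using order_tendstoD(2)[OF tendsto_R_two_thirds[OF b] R] eventually_at_right_less by (rule eventually_conj)
    then obtain s0 where s0: "critical_rate b P s0 < ereal R" "2/3 < s0"
      using eventually_happens[of _ "at_right (2/3::real)"] by (auto simp: trivial_limit_at_right_real)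
    have mi0: "mutual_info (maximizer P s0) < R * ln b"
      using s0 L by (simp add: critical_rate_eq[OF b] pos_divide_less_eq)
    show "error_exponent b P markov_perm_inv R \<le> (SUP s\<in>{2/3<..<1}. ?E s)"
    proof (rule ereal_le_epsilon2)
      fix e :: real assume e: "e > 0"
      define d where "d = e * ln b / 2"
      have d: "d > 0" using e L by (simp add: d_def)
      obtain V s where V: "V \<in> ac_simplex P" "mutual_info V < R * ln b" and s: "2/3 < s" "s < 1"
        and le: "rel_ent V P \<le> exponent_at P (R * ln b) s + d"
        using exponent_approx_below[OF s0(2) mi0 d] by blast
      have "error_exponent b P markov_perm_inv R \<le> ereal ((rel_ent V P + d) / ln b)"
        by (rule error_exponent_le[OF b V d])
      also have "\<dots> \<le> ereal ((exponent_at P (R * ln b) s + 2 * d) / ln b)"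
        using le L by (simp add: divide_right_mono)
      also have "(exponent_at P (R * ln b) s + 2 * d) / ln b = exponent_at P (R * ln b) s / ln b + e"
        using L by (simp add: d_def add_divide_distrib)
      also have "ereal (exponent_at P (R * ln b) s / ln b + e) = ?E s + ereal e" by simp
      also have "\<dots> \<le> (SUP s\<in>{2/3<..<1}. ?E s) + ereal e"
        using s by (intro add_right_mono SUP_upper) auto
      finally show "error_exponent b P markov_perm_inv R \<le> (SUP s\<in>{2/3<..<1}. ?E s) + ereal e" .
    qed
  qed
  ultimately show ?thesis by simp
qed

lemma strong_converse_exponent_eq:
  assumes b: "b > 1" and R: "ereal R < R_infinity b P"
  shows "strong_converse_exponent b P markov_perm_inv R = (SUP s\<in>{1<..}. ereal ((s - 1) / s) * (ereal R - renyi_cmi b s P))"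
proof -
  let ?E = "\<lambda>s. ereal (exponent_at P (R * ln b) s / ln b)"
  have L: "ln b > 0" using b by simp
  have "(SUP s\<in>{1<..}. ereal ((s - 1) / s) * (ereal R - renyi_cmi b s P)) = (SUP s\<in>{1<..}. ?E s)"
    by (intro SUP_cong refl exponent_term_above[OF b]) auto
  moreover have "strong_converse_exponent b P markov_perm_inv R = (SUP s\<in>{1<..}. ?E s)"
  proof (rule antisym)
    show "(SUP s\<in>{1<..}. ?E s) \<le> strong_converse_exponent b P markov_perm_inv R"
      by (intro SUP_least strong_converse_exponent_ge[OF b]) auto
    \<comment> \<open>Here \<open>R < R_infinity\<close> supplies an \<open>s0\<close> whose
      maximiser has information above the rate, as \<open>exponent_approx_above\<close>
      requires.\<close>
    have "eventually (\<lambda>s. ereal R < critical_rate b P s \<and> 1 < s) at_top"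
      using order_tendstoD(1)[OF tendsto_R_infinity[OF b] R] eventually_gt_at_top by (rule eventually_conj)
    then obtain s0 where s0: "ereal R < critical_rate b P s0" "1 < s0"
      using eventually_happens[of _ "at_top :: real filter"] by auto
    have mi0: "R * ln b < mutual_info (maximizer P s0)"
      using s0 L by (simp add: critical_rate_eq[OF b] pos_less_divide_eq)
    show "strong_converse_exponent b P markov_perm_inv R \<le> (SUP s\<in>{1<..}. ?E s)"
    proof (rule ereal_le_epsilon2)
      fix e :: real assume e: "e > 0"
      define d where "d = e * ln b / 2"
      have d: "d > 0" using e L by (simp add: d_def)
      have s00: "0 < s0" using s0 by simp
      obtain V s where V: "V \<in> ac_simplex P" "R * ln b < mutual_info V" and s: "1 < s"
        and le: "rel_ent V P \<le> exponent_at P (R * ln b) s + d"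
        using exponent_approx_above[OF s00 mi0 d] by blast
      have "strong_converse_exponent b P markov_perm_inv R \<le> ereal ((rel_ent V P + d) / ln b)"
        by (rule strong_converse_exponent_le[OF b V d])
      also have "\<dots> \<le> ereal ((exponent_at P (R * ln b) s + 2 * d) / ln b)"
        using le L by (simp add: divide_right_mono)
      also have "(exponent_at P (R * ln b) s + 2 * d) / ln b = exponent_at P (R * ln b) s / ln b + e"
        using L by (simp add: d_def add_divide_distrib)
      also have "ereal (exponent_at P (R * ln b) s / ln b + e) = ?E s + ereal e" by simp
      also have "\<dots> \<le> (SUP s\<in>{1<..}. ?E s) + ereal e"
        using s by (intro add_right_mono SUP_upper) auto
      finally show "strong_converse_exponent b P markov_perm_inv R \<le> (SUP s\<in>{1<..}. ?E s) + ereal e" .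
    qed
  qed
  ultimately show ?thesis by simp
qed

section \<open>Threshold rates, with the behaviour at the critical rate itself left open\<close>

lemma Sup_threshold:
  assumes "\<And>R. R < x \<Longrightarrow> R \<in> S" "\<And>R. R > x \<Longrightarrow> R \<notin> S"
  shows "Sup (ereal ` S) = ereal x"
proof (rule antisym)
  show "Sup (ereal ` S) \<le> ereal x" using assms(2) by (intro SUP_least) (force simp: not_less)
  show "ereal x \<le> Sup (ereal ` S)"
  proof (rule ereal_le_epsilon2)
    fix e :: real assume "e > 0"
    then have "ereal (x - e) \<le> Sup (ereal ` S)" by (intro SUP_upper assms(1)) simp
    then show "ereal x \<le> Sup (ereal ` S) + ereal e" by (cases "Sup (ereal ` S)") auto
  qed
qed

lemma Inf_threshold:
  assumes "\<And>R. R > x \<Longrightarrow> R \<in> S" "\<And>R. R < x \<Longrightarrow> R \<notin> S"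
  shows "Inf (ereal ` S) = ereal x"
proof (rule antisym)
  show "ereal x \<le> Inf (ereal ` S)" using assms(2) by (intro INF_greatest) (force simp: not_less)
  show "Inf (ereal ` S) \<le> ereal x"
  proof (rule ereal_le_epsilon2)
    fix e :: real assume "e > 0"
    then have "Inf (ereal ` S) \<le> ereal (x + e)" by (intro INF_lower assms(1)) simp
    then show "Inf (ereal ` S) \<le> ereal x + ereal e" by simp
  qed
qed

lemma min_type1_error_limits:
  assumes b: "b > 1"
  shows "R < mutual_info (pmf P) / ln b \<Longrightarrow> (\<lambda>n. ereal (min_type1_error P markov_perm_inv n (b powr (- real n * R)))) \<longlonglongrightarrow> 0"
    and "R > mutual_info (pmf P) / ln b \<Longrightarrow> (\<lambda>n. ereal (min_type1_error P markov_perm_inv n (b powr (- real n * R)))) \<longlonglongrightarrow> 1"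
proof -
  have L: "ln b > 0" using b by simp
  show "(\<lambda>n. ereal (min_type1_error P markov_perm_inv n (b powr (- real n * R)))) \<longlonglongrightarrow> 0" if "R < mutual_info (pmf P) / ln b"
    using min_type1_error_tendsto_0[of "R * ln b" P] that L unfolding powr_minus_eq_exp[OF b]
    by (simp add: pos_less_divide_eq zero_ereal_def)
  show "(\<lambda>n. ereal (min_type1_error P markov_perm_inv n (b powr (- real n * R)))) \<longlonglongrightarrow> 1" if "R > mutual_info (pmf P) / ln b"
    using min_type1_error_tendsto_1[of P "R * ln b"] that L unfolding powr_minus_eq_exp[OF b]
    by (simp add: pos_divide_less_eq one_ereal_def)
qed

lemma threshold_rate_eq:
  assumes b: "b > 1"
  shows "threshold_rate b P markov_perm_inv = cmi b P"
  unfolding threshold_rate_def cmi_eq[OF b]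
proof (rule Sup_threshold)
  fix R
  show "R \<in> {R. limsup (\<lambda>n. ereal (min_type1_error P markov_perm_inv n (b powr (- real n * R)))) = 0}" if "R < mutual_info (pmf P) / ln b"
    using lim_imp_Limsup[OF _ min_type1_error_limits(1)[OF b that]] by simp
  show "R \<notin> {R. limsup (\<lambda>n. ereal (min_type1_error P markov_perm_inv n (b powr (- real n * R)))) = 0}" if "R > mutual_info (pmf P) / ln b"
    using lim_imp_Limsup[OF _ min_type1_error_limits(2)[OF b that]] by simp
qed

lemma strong_converse_threshold_rate_eq:
  assumes b: "b > 1"
  shows "strong_converse_threshold_rate b P markov_perm_inv = cmi b P"
  unfolding strong_converse_threshold_rate_def cmi_eq[OF b]
proof (rule Inf_threshold)
  fix R
  show "R \<in> {R. liminf (\<lambda>n. ereal (min_type1_error P markov_perm_inv n (b powr (- real n * R)))) = 1}" if "R > mutual_info (pmf P) / ln b"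
    using lim_imp_Liminf[OF _ min_type1_error_limits(2)[OF b that]] by simp
  show "R \<notin> {R. liminf (\<lambda>n. ereal (min_type1_error P markov_perm_inv n (b powr (- real n * R)))) = 1}" if "R < mutual_info (pmf P) / ln b"
    using lim_imp_Liminf[OF _ min_type1_error_limits(1)[OF b that]] by simp
qed

lemma renyi_cmi_finite_attained:
  assumes b: "b > 1" and s: "s > 0"
  shows "\<bar>renyi_cmi b s P\<bar> \<noteq> \<infinity> \<and> (\<exists>QY QX QZ. renyi_cmi b s P = renyi_div b s P (markov_pmf QY QX QZ))"
proof (cases "s = 1")
  case True
  then show ?thesis using renyi_cmi_1_eq[OF b, of P] by simp
next
  case False
  then show ?thesis using renyi_cmi_eq[OF b s False, of P] by simp
qed

text \<open>Infima, \<open>real_of_ereal\<close>, \<open>deriv\<close> and \<open>Lim\<close> are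
  total operators. The clauses on finiteness and attainment, differentiability and convergence
  certify that they denote a true minimum, derivative and limits.\<close>

theorem mainTheorem10:
  fixes b :: real
    and P :: "('x::finite \<times> 'y::finite \<times> 'z::finite) pmf"
  assumes "b > 1"
  shows
    "(\<forall>s>0. \<bar>renyi_cmi b s P\<bar> \<noteq> \<infinity> \<and>
        (\<exists>QY QX QZ. renyi_cmi b s P = renyi_div b s P (markov_pmf QY QX QZ))) \<and>
     (\<forall>s>2/3. phi b P differentiable (at s)) \<and>
     (critical_rate b P \<longlongrightarrow> R_two_thirds b P) (at_right (2/3)) \<and>
     (critical_rate b P \<longlongrightarrow> R_infinity b P) at_top \<and>
     threshold_rate b P markov_perm_inv = cmi b P \<and>
     strong_converse_threshold_rate b P markov_perm_inv = cmi b P \<and>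
     (\<forall>R. ereal R > R_two_thirds b P \<longrightarrow>
        error_exponent b P markov_perm_inv R =
          (SUP s\<in>{2/3<..<1}. ereal ((1 - s) / s) * (renyi_cmi b s P - ereal R))) \<and>
     (\<forall>R. 0 < R \<and> ereal R < R_infinity b P \<longrightarrow>
        strong_converse_exponent b P markov_perm_inv R =
          (SUP s\<in>{1<..}. ereal ((s - 1) / s) * (ereal R - renyi_cmi b s P)))"
proof (intro conjI allI impI)
  note b = assms
  fix s :: real
  show "\<bar>renyi_cmi b s P\<bar> \<noteq> \<infinity>" "\<exists>QY QX QZ. renyi_cmi b s P = renyi_div b s P (markov_pmf QY QX QZ)" if "s > 0"
    using renyi_cmi_finite_attained[OF b that, of P] by auto
  show "phi b P differentiable (at s)" if "s > 2/3"
    unfolding real_differentiable_def using phi_has_derivative[OF b, of s P] that by fastforce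
  show "(critical_rate b P \<longlongrightarrow> R_two_thirds b P) (at_right (2/3))" by (rule tendsto_R_two_thirds[OF b])
  show "(critical_rate b P \<longlongrightarrow> R_infinity b P) at_top" by (rule tendsto_R_infinity[OF b])
  show "threshold_rate b P markov_perm_inv = cmi b P" by (rule threshold_rate_eq[OF b])
  show "strong_converse_threshold_rate b P markov_perm_inv = cmi b P" by (rule strong_converse_threshold_rate_eq[OF b])
  fix R
  show "error_exponent b P markov_perm_inv R = (SUP s\<in>{2/3<..<1}. ereal ((1 - s) / s) * (renyi_cmi b s P - ereal R))"
    if "ereal R > R_two_thirds b P" by (rule error_exponent_eq[OF b that])
  show "strong_converse_exponent b P markov_perm_inv R = (SUP s\<in>{1<..}. ereal ((s - 1) / s) * (ereal R - renyi_cmi b s P))"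
    if "0 < R \<and> ereal R < R_infinity b P" by (rule strong_converse_exponent_eq[OF b]) (use that in simp)
qed

end
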